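(* Let $\mathcal{X}=\{(i_1,i_2)^T:i_1=1,2,\dots,\ i_2=1,2,\dots\}$ with the order $\boldsymbol{x}_1\preceq\boldsymbol{x}_2$ iff $x_{1,1}\le x_{2,1}$ and $x_{1,2}\le x_{2,2}$. Let $Z_1,Z_2,\dots,Z_n$ be i.i.d. random variables with values in $\mathcal{X}$ and probability mass function $\boldsymbol{p}$ that is bimonotone decreasing, i.e. $p_{\boldsymbol{x}_1}\ge p_{\boldsymbol{x}_2}$ whenever $\boldsymbol{x}_1\preceq\boldsymbol{x}_2$. Let $\hat{p}_{n,\boldsymbol{x}}=\frac1n\sum_{j=1}^n1\{Z_j=\boldsymbol{x}\}$ be the empirical estimator and let $$\hat{\boldsymbol{p}}_n^{*}=\underset{\xi\in\mathcal{F}^{an}}{\mathrm{argmin}}\sum_{\boldsymbol{x}\in\mathcal{X}}(\xi_{\boldsymbol{x}}-\hat{p}_{n,\boldsymbol{x}})^2,$$ where $\mathcal{F}^{an}$ is the set of bimonotone decreasing functions in $l_2=l_2(\mathcal{X})$ ($\hat{\boldsymbol{p}}_n^{*}$ is the maximum likelihood estimator of $\boldsymbol{p}$ under the bimonotone decreasing constraint). Then $$n^{1/2}(\hat{\boldsymbol{p}}_n^{*}-\boldsymbol{p})\stackrel{d}{\to}\varphi(\boldsymbol{Y}_{\boldsymbol{0},C})\quad\text{in }l_2,$$ where $\boldsymbol{Y}_{\boldsymbol{0},C}$ is a Gaussian process in $l_2$ with mean zero and covariance operator $C$ given by $\langle C\boldsymbol{e}_{\boldsymbol{i}},\boldsymbol{e}_{\boldsymbol{i}'}\rangle=p_{\boldsymbol{i}}\delta_{\boldsymbol{i},\boldsymbol{i}'}-p_{\boldsymbol{i}}p_{\boldsymbol{i}'}$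 ($\boldsymbol{e}_{\boldsymbol{i}}$ being the standard orthonormal basis of $l_2$, $\delta$ the Kronecker delta), and $\varphi:l_2\to l_2$ maps $\boldsymbol{\theta}$ to the concatenation of the separate (unweighted) isotonic regressions, with respect to $\preceq$, of the restrictions of $\boldsymbol{\theta}$ to the comparable level sets of $\boldsymbol{p}$.
   Context: Two elements $x,y$ are comparable if $x\preceq y$ or $y\preceq x$. A function $f$ on $A\subseteq\mathcal{X}$ is isotonic if $x,y\in A$, $x\preceq y$ imply $f(x)\le f(y)$. The unweighted isotonic regression of a square summable $\theta$ over $A\subseteq\mathcal{X}$ is the (unique) minimizer of $\sum_{x\in A}(f(x)-\theta(x))^2$ over square summable isotonic functions $f$ on $A$. Comparable level sets of $\boldsymbol{p}$: take the level sets $\{x\in\mathcal{X}:p_x=c\}$ and partition each of them into the connected components of the graph whose vertices are the elements of the level set and whose edges join comparable elements. These components partition $\mathcal{X}$. Operator $\varphi$: $\varphi(\boldsymbol{\theta})_x$ is the value at $x$ of the isotonic regression, over the comparable level set containing $x$, of the restriction of $\boldsymbol{\theta}$ to that set.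
   Formalization: The regressions in φ are taken decreasing with respect to ⪯ (isotonic for the reverse order), since with increasing ones the claim fails, e.g. for p = 1/2 at (1,1) and (1,2); the parenthetical remark that the estimator is the MLE is not part of the formal claim. *)

theory Defs
  imports "HOL-Probability.Probability"
begin

section \<open>The Hilbert space of square summable functions\<close>

lemma summable_on_mult_of_squares:
  fixes f g :: "'a \<Rightarrow> real"
  assumes "(\<lambda>x. (f x)\<^sup>2) summable_on A" "(\<lambda>x. (g x)\<^sup>2) summable_on A"
  shows "(\<lambda>x. f x * g x) summable_on A"
proof -
  have "(\<lambda>x. (f x)\<^sup>2 + (g x)\<^sup>2) summable_on A"
    using assms by (rule summable_on_add)
  moreover have "norm (f x * g x) \<le> (f x)\<^sup>2 + (g x)\<^sup>2" for x
  proof -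
    have "0 \<le> (\<bar>f x\<bar> - \<bar>g x\<bar>)\<^sup>2" "0 \<le> \<bar>f x\<bar> * \<bar>g x\<bar>" by simp_all
    then have "\<bar>f x\<bar> * \<bar>g x\<bar> \<le> \<bar>f x\<bar>\<^sup>2 + \<bar>g x\<bar>\<^sup>2"
      unfolding power2_diff by linarith
    then show ?thesis by (simp add: abs_mult)
  qed
  ultimately have "(\<lambda>x. norm (f x * g x)) summable_on A"
    by (rule Infinite_Sum.abs_summable_on_comparison_test')
  then show ?thesis by (rule abs_summable_summable)
qed

typedef 'a ell2 = "{f :: 'a \<Rightarrow> real. (\<lambda>x. (f x)\<^sup>2) summable_on UNIV}"
  morphisms ell2_nth Abs_ell2
  by (rule exI[of _ "\<lambda>_. 0"]) simp

setup_lifting type_definition_ell2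

lemma square_summable_ell2_nth: "(\<lambda>x. (ell2_nth f x)\<^sup>2) summable_on UNIV"
  using ell2_nth[of f] by simp

lemma summable_ell2_nth_mult: "(\<lambda>x. ell2_nth f x * ell2_nth g x) summable_on UNIV"
  by (intro summable_on_mult_of_squares square_summable_ell2_nth)

lemma square_summable_add:
  fixes f g :: "'a \<Rightarrow> real"
  assumes "(\<lambda>x. (f x)\<^sup>2) summable_on A" "(\<lambda>x. (g x)\<^sup>2) summable_on A"
  shows "(\<lambda>x. (f x + g x)\<^sup>2) summable_on A"
proof -
  have "(\<lambda>x. (f x)\<^sup>2 + (g x)\<^sup>2 + 2 * (f x * g x)) summable_on A"
    by (intro summable_on_add summable_on_cmult_right summable_on_mult_of_squares assms)
  then show ?thesis by (simp add: power2_sum mult.assoc)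
qed

lemma square_summable_scale:
  fixes f :: "'a \<Rightarrow> real"
  assumes "(\<lambda>x. (f x)\<^sup>2) summable_on A"
  shows "(\<lambda>x. (c * f x)\<^sup>2) summable_on A"
  using summable_on_cmult_right[OF assms, of "c\<^sup>2"] by (simp add: power_mult_distrib)

instantiation ell2 :: (type) real_inner
begin

lift_definition zero_ell2 :: "'a ell2" is "\<lambda>_. 0" by simp

lift_definition plus_ell2 :: "'a ell2 \<Rightarrow> 'a ell2 \<Rightarrow> 'a ell2" is "\<lambda>f g x. f x + g x"
  by (rule square_summable_add)

lift_definition uminus_ell2 :: "'a ell2 \<Rightarrow> 'a ell2" is "\<lambda>f x. - f x" by simp

lift_definition minus_ell2 :: "'a ell2 \<Rightarrow> 'a ell2 \<Rightarrow> 'a ell2" is "\<lambda>f g x. f x - g x"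
proof -
  fix f g :: "'a \<Rightarrow> real"
  assume "(\<lambda>x. (f x)\<^sup>2) summable_on UNIV" "(\<lambda>x. (g x)\<^sup>2) summable_on UNIV"
  then show "(\<lambda>x. (f x - g x)\<^sup>2) summable_on UNIV"
    using square_summable_add[of f UNIV "\<lambda>x. - g x"] by simp
qed

lift_definition scaleR_ell2 :: "real \<Rightarrow> 'a ell2 \<Rightarrow> 'a ell2" is "\<lambda>c f x. c * f x"
  by (rule square_summable_scale)

lift_definition inner_ell2 :: "'a ell2 \<Rightarrow> 'a ell2 \<Rightarrow> real" is "\<lambda>f g. \<Sum>\<^sub>\<infinity>x. f x * g x" .

definition norm_ell2 :: "'a ell2 \<Rightarrow> real" where "norm_ell2 f = sqrt (inner f f)"

definition sgn_ell2 :: "'a ell2 \<Rightarrow> 'a ell2" where "sgn_ell2 f = scaleR (inverse (norm f)) f"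

definition dist_ell2 :: "'a ell2 \<Rightarrow> 'a ell2 \<Rightarrow> real" where "dist_ell2 f g = norm (f - g)"

definition uniformity_ell2 :: "('a ell2 \<times> 'a ell2) filter" where
  "uniformity_ell2 = (INF e\<in>{0 <..}. principal {(x, y). dist x y < e})"

definition open_ell2 :: "'a ell2 set \<Rightarrow> bool" where
  "open_ell2 U \<longleftrightarrow> (\<forall>x\<in>U. \<forall>\<^sub>F (x', y) in uniformity. x' = x \<longrightarrow> y \<in> U)"

instance
proof
  fix f g h :: "'a ell2" and a b :: real
  show "f + g + h = f + (g + h)" by transfer (simp add: algebra_simps)
  show "f + g = g + f" by transfer (simp add: algebra_simps)
  show "0 + f = f" by transfer simp
  show "- f + f = 0" by transfer simp
  show "f - g = f + - g" by transfer simp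
  show "a *\<^sub>R (f + g) = a *\<^sub>R f + a *\<^sub>R g" by transfer (simp add: algebra_simps)
  show "(a + b) *\<^sub>R f = a *\<^sub>R f + b *\<^sub>R f" by transfer (simp add: algebra_simps)
  show "a *\<^sub>R b *\<^sub>R f = (a * b) *\<^sub>R f" by transfer (simp add: algebra_simps)
  show "1 *\<^sub>R f = f" by transfer simp
  show "sgn f = scaleR (inverse (norm f)) f" by (rule sgn_ell2_def)
  show "dist f g = norm (f - g)" by (rule dist_ell2_def)
  show "norm f = sqrt (inner f f)" by (rule norm_ell2_def)
  show "inner f g = inner g f" by transfer (simp add: mult.commute)
  show "inner (f + g) h = inner f h + inner g h"
    unfolding inner_ell2.rep_eq plus_ell2.rep_eq distrib_right
    by (intro infsum_add summable_ell2_nth_mult)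
  show "inner (a *\<^sub>R f) g = a * inner f g"
    unfolding inner_ell2.rep_eq scaleR_ell2.rep_eq mult.assoc
    by (intro infsum_cmult_right summable_ell2_nth_mult)
  show "0 \<le> inner f f"
    unfolding inner_ell2.rep_eq by (intro infsum_nonneg) simp
  show "inner f f = 0 \<longleftrightarrow> f = 0"
  proof
    assume "inner f f = 0"
    then have "ell2_nth f x * ell2_nth f x = 0" for x
      unfolding inner_ell2.rep_eq
      by (intro nonneg_infsum_le_0D[of "\<lambda>x. ell2_nth f x * ell2_nth f x" UNIV])
         (simp_all add: summable_ell2_nth_mult)
    then show "f = 0"
      by (simp add: ell2_nth_inject[symmetric] zero_ell2.rep_eq fun_eq_iff)
  next
    assume "f = 0"
    then show "inner f f = 0" by (simp add: inner_ell2.rep_eq zero_ell2.rep_eq)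
  qed
  show "(uniformity :: ('a ell2 \<times> 'a ell2) filter) = (INF e\<in>{0 <..}. principal {(x, y). dist x y < e})"
    by (rule uniformity_ell2_def)
next
  fix U :: "'a ell2 set"
  show "open U \<longleftrightarrow> (\<forall>x\<in>U. \<forall>\<^sub>F (x', y) in uniformity. x' = x \<longrightarrow> y \<in> U)"
    by (rule open_ell2_def)
qed

end

lift_definition ell2_basis :: "'a \<Rightarrow> 'a ell2" is "\<lambda>i x. if x = i then 1 else 0"
proof -
  fix i :: 'a
  have "(\<lambda>x. (if x = i then 1 else 0 :: real)\<^sup>2) summable_on {i}" by simp
  then show "(\<lambda>x. (if x = i then 1 else 0 :: real)\<^sup>2) summable_on UNIV"
    by (rule summable_on_cong_neutral[THEN iffD1, rotated -1]) auto
qed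

lemma square_summable_pmf: "(\<lambda>x. (pmf p x)\<^sup>2) summable_on UNIV"
proof -
  have "(\<lambda>x. norm (pmf p x)) summable_on UNIV"
    using pmf_abs_summable[of p UNIV] by (simp add: abs_summable_equivalent[symmetric])
  moreover have "norm ((pmf p x)\<^sup>2) \<le> norm (pmf p x)" for x
    by (simp add: power2_eq_square mult_left_le pmf_le_1)
  ultimately have "(\<lambda>x. norm ((pmf p x)\<^sup>2)) summable_on UNIV"
    by (rule Infinite_Sum.abs_summable_on_comparison_test)
  then show ?thesis by (rule abs_summable_summable)
qed

lift_definition ell2_of_pmf :: "'a pmf \<Rightarrow> 'a ell2" is pmf
  by (rule square_summable_pmf)


section \<open>The grid of pairs of positive integers\<close>

typedef grid = "{(i1 :: nat, i2 :: nat). 1 \<le> i1 \<and> 1 \<le> i2}"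
  morphisms coords Abs_grid
  by auto

instantiation grid :: order
begin

definition less_eq_grid :: "grid \<Rightarrow> grid \<Rightarrow> bool" where
  "x \<le> y \<longleftrightarrow> fst (coords x) \<le> fst (coords y) \<and> snd (coords x) \<le> snd (coords y)"

definition less_grid :: "grid \<Rightarrow> grid \<Rightarrow> bool" where
  "x < y \<longleftrightarrow> x \<le> y \<and> \<not> y \<le> (x :: grid)"

instance
  by standard (auto simp: less_eq_grid_def less_grid_def coords_inject[symmetric] prod_eq_iff)

end


section \<open>Isotonic regression and comparable level sets\<close>

text \<open>
  The order is a parameter, so that regression under a decreasing constraint is isotonic
  regression with respect to the reverse order. Functions on \<open>A\<close> are represented by
  functions in \<^term>\<open>extensional A\<close>, which makes the minimizer unique.
\<close>

definition isotonic_regression ::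
    "('a \<Rightarrow> 'a \<Rightarrow> bool) \<Rightarrow> 'a set \<Rightarrow> ('a \<Rightarrow> real) \<Rightarrow> 'a \<Rightarrow> real" where
  "isotonic_regression le A \<theta> =
    (THE f. is_arg_min (\<lambda>f. \<Sum>\<^sub>\<infinity>x\<in>A. (f x - \<theta> x)\<^sup>2)
      (\<lambda>f. f \<in> extensional A \<and> (\<lambda>x. (f x)\<^sup>2) summable_on A \<and> monotone_on A le (\<le>) f) f)"

definition comparable :: "('a \<Rightarrow> 'a \<Rightarrow> bool) \<Rightarrow> 'a \<Rightarrow> 'a \<Rightarrow> bool" where
  "comparable le x y \<longleftrightarrow> le x y \<or> le y x"

definition comparable_level_set ::
    "('a \<Rightarrow> 'a \<Rightarrow> bool) \<Rightarrow> ('a \<Rightarrow> real) \<Rightarrow> 'a \<Rightarrow> 'a set" where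
  "comparable_level_set le p x =
    {y. (x, y) \<in> {(u, v). p u = p x \<and> p v = p x \<and> comparable le u v}\<^sup>*}"

definition level_set_regression ::
    "('a \<Rightarrow> 'a \<Rightarrow> bool) \<Rightarrow> ('a \<Rightarrow> real) \<Rightarrow> 'a ell2 \<Rightarrow> 'a ell2" where
  "level_set_regression le p \<theta> =
    Abs_ell2 (\<lambda>x. isotonic_regression le (comparable_level_set le p x) (ell2_nth \<theta>) x)"


section \<open>The estimators\<close>

definition empirical_pmf :: "(nat \<Rightarrow> 'w \<Rightarrow> 'a) \<Rightarrow> nat \<Rightarrow> 'w \<Rightarrow> 'a \<Rightarrow> real" where
  "empirical_pmf Z n \<omega> x = (1 / real n) * (\<Sum>j=1..n. of_bool (Z j \<omega> = x))"

definition antitonic_ell2 :: "'a::order ell2 set" where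
  "antitonic_ell2 = {\<xi>. antimono (ell2_nth \<xi>)}"

definition antitonic_estimator :: "(nat \<Rightarrow> 'w \<Rightarrow> 'a::order) \<Rightarrow> nat \<Rightarrow> 'w \<Rightarrow> 'a ell2" where
  "antitonic_estimator Z n \<omega> =
    (THE \<xi>. is_arg_min (\<lambda>\<xi>. \<Sum>\<^sub>\<infinity>x. (ell2_nth \<xi> x - empirical_pmf Z n \<omega> x)\<^sup>2)
      (\<lambda>\<xi>. \<xi> \<in> antitonic_ell2) \<xi>)"


section \<open>Gaussian elements and convergence in distribution\<close>

text \<open>Point masses count as (degenerate) normal distributions.\<close>

definition gaussian_variable :: "'w measure \<Rightarrow> ('w \<Rightarrow> real) \<Rightarrow> bool" where
  "gaussian_variable M X \<longleftrightarrow> X \<in> borel_measurable M \<and>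
    ((\<exists>\<mu> \<sigma>. 0 < \<sigma> \<and> distributed M lborel X (normal_density \<mu> \<sigma>)) \<or> (\<exists>\<mu>. AE \<omega> in M. X \<omega> = \<mu>))"

definition gaussian_process ::
    "'w measure \<Rightarrow> ('w \<Rightarrow> 'h::real_inner) \<Rightarrow> 'h \<Rightarrow> ('h \<Rightarrow> 'h) \<Rightarrow> bool" where
  "gaussian_process M Y m C \<longleftrightarrow>
    prob_space M \<and> Y \<in> borel_measurable M \<and>
    (\<forall>h. gaussian_variable M (\<lambda>\<omega>. Y \<omega> \<bullet> h)) \<and>
    (\<forall>h. (\<integral>\<omega>. Y \<omega> \<bullet> h \<partial>M) = m \<bullet> h) \<and>
    (\<forall>u v. (\<integral>\<omega>. ((Y \<omega> - m) \<bullet> u) * ((Y \<omega> - m) \<bullet> v) \<partial>M) = C u \<bullet> v)"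

definition converges_in_distribution ::
    "'w measure \<Rightarrow> (nat \<Rightarrow> 'w \<Rightarrow> 'h::topological_space) \<Rightarrow> 'v measure \<Rightarrow> ('v \<Rightarrow> 'h) \<Rightarrow> bool" where
  "converges_in_distribution M X N Y \<longleftrightarrow>
    (\<forall>n. X n \<in> borel_measurable M) \<and> Y \<in> borel_measurable N \<and>
    (\<forall>f :: 'h \<Rightarrow> real. continuous_on UNIV f \<longrightarrow> bounded (range f) \<longrightarrow>
      (\<lambda>n. \<integral>\<omega>. f (X n \<omega>) \<partial>M) \<longlonglongrightarrow> (\<integral>\<omega>. f (Y \<omega>) \<partial>N))"

end

theory Submission
  imports Defs
begin

text \<open>
  Up to scaling, the estimator is the metric projection of the empirical fluctuation
  \<open>sqrt n (empirical - p)\<close> onto the closed convex set \<open>sqrt n (F - p)\<close>, with \<open>F\<close> the antitonic cone.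
  These sets fill up the tangent cone of \<open>F\<close> at \<open>p\<close>, which consists of the functions that are antitonic
  on the level sets of \<open>p\<close>, so the projections converge pointwise to the projection onto that cone. The
  latter is the level set regression. Since projections are 1-Lipschitz, the convergence is uniform on
  compact sets, and the claim follows from tightness and a central limit theorem in \<open>l2\<close>. That theorem is
  reduced to the real one: trigonometric polynomials in continuous linear functionals approximate
  bounded continuous functions on compact sets.
\<close>

section \<open>Square summable functions\<close>

text \<open>The masses of \<open>p\<close> may take infinitely many values accumulating at 0, so the
  strict inequalities \<open>p y < p x\<close> need not have a common positive gap. Hence
  \<open>sqrt n (F - p)\<close> need not exhaust the tangent cone for any \<open>n\<close>, and the
  projections need not agree with the limiting one from some \<open>n\<close> on. What remains is
  approximation: finitely supported directions in the cone are admissible for all large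
  \<open>n\<close>, and they are dense. On the null set of \<open>p\<close> density rests on the
  grid: every point has infinitely many points above it, which forces elements of the cone to be
  nonnegative there, and only finitely many below it. Conversely \<open>sqrt n (F - p)\<close> is
  contained in the cone, so closeness of the distances to the two sets forces closeness of the
  projections. Tightness has a single source for the sample and for the limit: coordinates have
  second moment at most \<open>p x\<close>, which is summable. Since \<open>C\<close> is prescribed
  on basis vectors only, its boundedness is what determines it elsewhere.\<close>

lemma ell2_norm_sq: "(norm f)\<^sup>2 = (\<Sum>\<^sub>\<infinity>x. (ell2_nth f x)\<^sup>2)"
  unfolding power2_norm_eq_inner by (simp add: inner_ell2.rep_eq power2_eq_square)

lemma ell2_sum_le_norm_sq: "finite F \<Longrightarrow> (\<Sum>x\<in>F. (ell2_nth f x)\<^sup>2) \<le> (norm f)\<^sup>2"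
  unfolding ell2_norm_sq
  by (intro finite_sum_le_infsum square_summable_ell2_nth) auto

lemma ell2_norm_sq_le:
  assumes "\<And>F. finite F \<Longrightarrow> (\<Sum>x\<in>F. (ell2_nth f x)\<^sup>2) \<le> B"
  shows "(norm f)\<^sup>2 \<le> B"
  unfolding ell2_norm_sq using assms
  by (intro infsum_le_finite_sums square_summable_ell2_nth) auto

lemma square_summableI:
  fixes f :: "'a \<Rightarrow> real"
  assumes "\<And>F. finite F \<Longrightarrow> F \<subseteq> A \<Longrightarrow> (\<Sum>x\<in>F. (f x)\<^sup>2) \<le> B"
  shows "(\<lambda>x. (f x)\<^sup>2) summable_on A"
  using assms by (intro nonneg_bdd_above_summable_on bdd_aboveI[of _ B]) auto

lemma ell2_nth_Abs: "(\<lambda>x. (f x)\<^sup>2) summable_on UNIV \<Longrightarrow> ell2_nth (Abs_ell2 f) = f"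
  by (simp add: Abs_ell2_inverse)

lemma ell2_eqI: "(\<And>x. ell2_nth f x = ell2_nth g x) \<Longrightarrow> f = g"
  by (simp add: ell2_nth_inject[symmetric] fun_eq_iff)

lemma abs_ell2_nth_le: "\<bar>ell2_nth f x\<bar> \<le> norm f"
  using ell2_sum_le_norm_sq[of "{x}" f] by (simp add: abs_le_square_iff[symmetric])

lemma inner_ell2_basis: "f \<bullet> ell2_basis i = ell2_nth f i"
proof -
  have "f \<bullet> ell2_basis i = (\<Sum>\<^sub>\<infinity>x\<in>{i}. ell2_nth f x)"
    unfolding inner_ell2.rep_eq ell2_basis.rep_eq
    by (intro infsum_cong_neutral) auto
  then show ?thesis by simp
qed

lemma ell2_nth_sum: "ell2_nth (\<Sum>i\<in>F. f i) x = (\<Sum>i\<in>F. ell2_nth (f i) x)"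
  by (induction F rule: infinite_finite_induct) (simp_all add: zero_ell2.rep_eq plus_ell2.rep_eq)

lemmas ell2_nth_simps = zero_ell2.rep_eq plus_ell2.rep_eq minus_ell2.rep_eq uminus_ell2.rep_eq
  scaleR_ell2.rep_eq ell2_nth_sum ell2_basis.rep_eq ell2_of_pmf.rep_eq

lift_definition ell2_restrict :: "'a set \<Rightarrow> 'a ell2 \<Rightarrow> 'a ell2" is "\<lambda>A f x. if x \<in> A then f x else 0"
proof -
  fix A and f :: "'a \<Rightarrow> real" assume *: "(\<lambda>x. (f x)\<^sup>2) summable_on UNIV"
  show "(\<lambda>x. (if x \<in> A then f x else 0)\<^sup>2) summable_on UNIV"
    by (rule summable_on_comparison_test[OF *]) auto
qed

lemma ell2_restrict_eq_sum:
  "finite F \<Longrightarrow> ell2_restrict F f = (\<Sum>x\<in>F. ell2_nth f x *\<^sub>R ell2_basis x)"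
  by (rule ell2_eqI) (auto simp: ell2_nth_simps ell2_restrict.rep_eq if_distrib[of "\<lambda>u. _ * u"] cong: if_cong)

text \<open>Stated for all supersets of \<open>F\<close> because a later truncation has to enlarge
  \<open>F\<close> to a finite set adapted to \<open>p\<close> before restricting.\<close>

lemma ell2_restrict_approx:
  assumes "0 < e"
  obtains F where "finite F" "\<And>A. F \<subseteq> A \<Longrightarrow> norm (f - ell2_restrict A f) < e"
proof -
  define s where "s = (\<Sum>\<^sub>\<infinity>x. (ell2_nth f x)\<^sup>2)"
  have "((\<lambda>x. (ell2_nth f x)\<^sup>2) has_sum s) UNIV"
    unfolding s_def by (intro has_sum_infsum square_summable_ell2_nth)
  then have "(sum (\<lambda>x. (ell2_nth f x)\<^sup>2) \<longlongrightarrow> s) (finite_subsets_at_top UNIV)"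
    by (simp add: has_sum_def)
  then have "\<forall>\<^sub>F F in finite_subsets_at_top UNIV. s - e\<^sup>2 / 2 < (\<Sum>x\<in>F. (ell2_nth f x)\<^sup>2)"
    by (rule order_tendstoD) (use assms in simp)
  then obtain F where F: "finite F" "s - e\<^sup>2 / 2 < (\<Sum>x\<in>F. (ell2_nth f x)\<^sup>2)"
    by (auto simp: eventually_finite_subsets_at_top)
  show thesis
  proof
    fix A assume A: "F \<subseteq> A"
    have "(norm (f - ell2_restrict A f))\<^sup>2 \<le> e\<^sup>2 / 2"
    proof (rule ell2_norm_sq_le)
      fix G :: "'a set" assume G: "finite G"
      have "(\<Sum>x\<in>G. (ell2_nth (f - ell2_restrict A f) x)\<^sup>2) = (\<Sum>x\<in>G - A. (ell2_nth f x)\<^sup>2)"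
        using G by (intro sum.mono_neutral_cong_right) (auto simp: ell2_nth_simps ell2_restrict.rep_eq)
      also have "\<dots> \<le> (\<Sum>x\<in>G - F. (ell2_nth f x)\<^sup>2)"
        using A G by (intro sum_mono2) auto
      finally have "(\<Sum>x\<in>G. (ell2_nth (f - ell2_restrict A f) x)\<^sup>2) \<le> (\<Sum>x\<in>G - F. (ell2_nth f x)\<^sup>2)" .
      moreover have "(\<Sum>x\<in>G - F. (ell2_nth f x)\<^sup>2) + (\<Sum>x\<in>F. (ell2_nth f x)\<^sup>2) \<le> s"
      proof (subst sum.union_disjoint[symmetric])
        show "(\<Sum>x\<in>G - F \<union> F. (ell2_nth f x)\<^sup>2) \<le> s"
          unfolding s_def ell2_norm_sq[symmetric] using F(1) G by (intro ell2_sum_le_norm_sq) auto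
      qed (use F(1) G in auto)
      ultimately show "(\<Sum>x\<in>G. (ell2_nth (f - ell2_restrict A f) x)\<^sup>2) \<le> e\<^sup>2 / 2"
        using F(2) by linarith
    qed
    also have "\<dots> < e\<^sup>2" using assms by simp
    finally show "norm (f - ell2_restrict A f) < e"
      by (rule power2_less_imp_less) (use assms in simp)
  qed fact
qed

text \<open>Applied to \<open>p\<close> itself, this makes positive level sets finite; applied to an
  element of a cone, it excludes a negative value that persists on an infinite set.\<close>

lemma ell2_superlevel_finite:
  assumes "0 < d" shows "finite {x. d \<le> \<bar>ell2_nth f x\<bar>}"
proof -
  obtain F where F: "finite F" "\<And>A. F \<subseteq> A \<Longrightarrow> norm (f - ell2_restrict A f) < d"
    using ell2_restrict_approx[OF assms] by blast
  have "x \<in> F" if "d \<le> \<bar>ell2_nth f x\<bar>" for x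
    using F(2)[of F] abs_ell2_nth_le[of "f - ell2_restrict F f" x] that
    by (auto simp: ell2_nth_simps ell2_restrict.rep_eq split: if_splits)
  then show ?thesis by (intro finite_subset[OF _ F(1)]) auto
qed

text \<open>Finitely supported vectors are dense by \<open>ell2_restrict_approx\<close>, and the
  difference of the two maps is bounded, linear and zero on them. Identities known only on basis
  vectors, such as those for \<open>C\<close>, are extended in this way.\<close>

lemma bounded_linear_eq_on_ell2_basis:
  fixes f g :: "'a ell2 \<Rightarrow> 'b::real_normed_vector"
  assumes f: "bounded_linear f" and g: "bounded_linear g"
    and eq: "\<And>i. f (ell2_basis i) = g (ell2_basis i)"
  shows "f = g"
proof
  fix u
  interpret d: bounded_linear "\<lambda>x. f x - g x" by (rule bounded_linear_sub[OF f g])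
  obtain K where K: "K > 0" "\<And>x. norm (f x - g x) \<le> norm x * K" using d.pos_bounded by blast
  have "norm (f u - g u) \<le> e" if e: "0 < e" for e
  proof -
    have "0 < e / K" using e K by simp
    then obtain F where F: "finite F" "\<And>A. F \<subseteq> A \<Longrightarrow> norm (u - ell2_restrict A u) < e / K"
      using ell2_restrict_approx[of "e / K" u] by blast
    have "f (ell2_restrict F u) - g (ell2_restrict F u) = 0"
      unfolding ell2_restrict_eq_sum[OF F(1)] d.sum d.scale by (simp add: eq)
    then have "f u - g u = f (u - ell2_restrict F u) - g (u - ell2_restrict F u)"
      using d.diff[of u "ell2_restrict F u"] by simp
    also have "norm \<dots> \<le> norm (u - ell2_restrict F u) * K" by (rule K)
    also have "\<dots> \<le> e / K * K" using F(2)[of F] K by (intro mult_right_mono) auto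
    finally show ?thesis using K by simp
  qed
  then have "norm (f u - g u) \<le> 0" by (rule field_le_epsilon) simp
  then show "f u = g u" by simp
qed

text \<open>A Cauchy sequence converges in every coordinate. The Cauchy bound is read on a finite
  set of coordinates, where the limit in the second index can be taken, and then carries over to the
  norm because the finite set is arbitrary.\<close>

instance ell2 :: (type) complete_space
proof
  fix X :: "nat \<Rightarrow> 'a ell2" assume X: "Cauchy X"
  have "Cauchy (\<lambda>n. ell2_nth (X n) x)" for x
  proof (rule metric_CauchyI)
    fix e :: real assume "0 < e"
    then obtain N where N: "\<And>m n. N \<le> m \<Longrightarrow> N \<le> n \<Longrightarrow> dist (X m) (X n) < e"
      using metric_CauchyD[OF X] by blast
    have "dist (ell2_nth (X m) x) (ell2_nth (X n) x) < e" if "N \<le> m" "N \<le> n" for m n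
      using abs_ell2_nth_le[of "X m - X n" x] N[OF that] by (simp add: dist_norm ell2_nth_simps)
    then show "\<exists>N. \<forall>m\<ge>N. \<forall>n\<ge>N. dist (ell2_nth (X m) x) (ell2_nth (X n) x) < e" by blast
  qed
  then have "\<exists>l. (\<lambda>n. ell2_nth (X n) x) \<longlonglongrightarrow> l" for x
    by (simp add: Cauchy_convergent_iff convergent_def)
  then obtain a where a: "\<And>x. (\<lambda>n. ell2_nth (X n) x) \<longlonglongrightarrow> a x" by metis
  have tail: "(\<Sum>x\<in>F. (ell2_nth (X m) x - a x)\<^sup>2) \<le> e\<^sup>2"
    if N: "\<And>m n. N \<le> m \<Longrightarrow> N \<le> n \<Longrightarrow> dist (X m) (X n) < e" and "N \<le> m" "finite F"
    for N m e and F :: "'a set"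
  proof (rule LIMSEQ_le_const2)
    show "(\<lambda>n. \<Sum>x\<in>F. (ell2_nth (X m) x - ell2_nth (X n) x)\<^sup>2) \<longlonglongrightarrow> (\<Sum>x\<in>F. (ell2_nth (X m) x - a x)\<^sup>2)"
      by (intro tendsto_intros a)
    have "(\<Sum>x\<in>F. (ell2_nth (X m) x - ell2_nth (X n) x)\<^sup>2) \<le> e\<^sup>2" if "N \<le> n" for n
    proof -
      have "(\<Sum>x\<in>F. (ell2_nth (X m) x - ell2_nth (X n) x)\<^sup>2) \<le> (norm (X m - X n))\<^sup>2"
        using ell2_sum_le_norm_sq[OF \<open>finite F\<close>, of "X m - X n"] by (simp add: ell2_nth_simps)
      also have "\<dots> \<le> e\<^sup>2"
        using N[OF \<open>N \<le> m\<close> that] by (intro power_mono) (auto simp: dist_norm)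
      finally show ?thesis .
    qed
    then show "\<exists>N. \<forall>n\<ge>N. (\<Sum>x\<in>F. (ell2_nth (X m) x - ell2_nth (X n) x)\<^sup>2) \<le> e\<^sup>2" by blast
  qed
  \<comment> \<open>The bound with \<open>e = 1\<close> already shows that \<open>X N - a\<close>,
    and hence \<open>a\<close>, is square summable.\<close>
  obtain N where "\<And>m n. N \<le> m \<Longrightarrow> N \<le> n \<Longrightarrow> dist (X m) (X n) < 1"
    using metric_CauchyD[OF X, of 1] by auto
  then have "(\<lambda>x. (ell2_nth (X N) x - a x)\<^sup>2) summable_on UNIV"
    using tail[of N 1 N] by (intro square_summableI[of _ _ 1]) auto
  from square_summable_add[OF square_summable_ell2_nth[of "- X N"] this]
  have asum: "(\<lambda>x. (a x)\<^sup>2) summable_on UNIV" by (simp add: ell2_nth_simps)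
  have "X \<longlonglongrightarrow> Abs_ell2 a"
  proof (rule metric_LIMSEQ_I)
    fix e :: real assume e: "0 < e"
    then obtain N where N: "\<And>m n. N \<le> m \<Longrightarrow> N \<le> n \<Longrightarrow> dist (X m) (X n) < e / 2"
      using metric_CauchyD[OF X, of "e / 2"] by auto
    have "dist (X n) (Abs_ell2 a) < e" if "N \<le> n" for n
    proof -
      have "(norm (X n - Abs_ell2 a))\<^sup>2 \<le> (e / 2)\<^sup>2"
        using tail[OF N that] by (intro ell2_norm_sq_le) (auto simp: ell2_nth_simps ell2_nth_Abs[OF asum])
      then have "norm (X n - Abs_ell2 a) \<le> e / 2" by (rule power2_le_imp_le) (use e in simp)
      then show ?thesis using e by (simp add: dist_norm)
    qed
    then show "\<exists>N. \<forall>n\<ge>N. dist (X n) (Abs_ell2 a) < e" by blast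
  qed
  then show "convergent X" by (rule convergentI)
qed

section \<open>Projection onto closed convex sets\<close>

text \<open>The choice is meaningful for nonempty, closed, convex \<open>S\<close> in a complete
  space, where \<open>nearest_exists\<close> and \<open>nearest_unique\<close> make it the metric
  projection.\<close>

definition nearest :: "'h::real_inner set \<Rightarrow> 'h \<Rightarrow> 'h" where
  "nearest S a = (SOME z. z \<in> S \<and> (\<forall>w\<in>S. norm (a - z) \<le> norm (a - w)))"

text \<open>The parallelogram law for \<open>a - z\<close> and \<open>a - w\<close>, whose half sum
  is \<open>a\<close> minus the midpoint; convexity keeps the midpoint at distance at least
  \<open>d\<close>. With \<open>d\<close> the infimum it makes minimizing sequences Cauchy, with
  \<open>d\<close> attained it gives uniqueness.\<close>

lemma convex_midpoint_norm:
  fixes a z w :: "'h::real_inner"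
  assumes "convex S" "z \<in> S" "w \<in> S" "0 \<le> d" "\<And>v. v \<in> S \<Longrightarrow> d \<le> norm (a - v)"
  shows "(norm (z - w))\<^sup>2 \<le> 2 * (norm (a - z))\<^sup>2 + 2 * (norm (a - w))\<^sup>2 - 4 * d\<^sup>2"
proof -
  define m where "m = (1/2) *\<^sub>R z + (1/2) *\<^sub>R w"
  have "m \<in> S" unfolding m_def using assms by (intro convexD) auto
  then have "d\<^sup>2 \<le> (norm (a - m))\<^sup>2" using assms by (intro power_mono) auto
  moreover have "(norm (z - w))\<^sup>2 = 2 * (norm (a - z))\<^sup>2 + 2 * (norm (a - w))\<^sup>2 - 4 * (norm (a - m))\<^sup>2"
    unfolding m_def power2_norm_eq_inner
    by (simp add: inner_diff_left inner_diff_right inner_add_left inner_add_right inner_commute algebra_simps)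
  ultimately show ?thesis by linarith
qed

lemma nearest_unique:
  fixes a :: "'h::real_inner"
  assumes "convex S" "z \<in> S" "\<And>v. v \<in> S \<Longrightarrow> norm (a - z) \<le> norm (a - v)"
    and "w \<in> S" "norm (a - w) \<le> norm (a - z)"
  shows "w = z"
proof -
  have "norm (a - w) = norm (a - z)" using assms by (intro antisym) auto
  then have "(norm (w - z))\<^sup>2 \<le> 0"
    using convex_midpoint_norm[OF assms(1,4,2), of "norm (a - z)" a] assms(3) by simp
  then show ?thesis by simp
qed

lemma nearest_exists:
  fixes a :: "'h::{real_inner, complete_space}"
  assumes "closed S" "convex S" "S \<noteq> {}"
  shows "\<exists>z\<in>S. \<forall>w\<in>S. norm (a - z) \<le> norm (a - w)"
proof -
  define d where "d = (INF w\<in>S. norm (a - w))"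
  have bdd: "bdd_below ((\<lambda>w. norm (a - w)) ` S)" by (intro bdd_belowI[of _ 0]) auto
  have d_le: "d \<le> norm (a - w)" if "w \<in> S" for w
    unfolding d_def using bdd that by (rule cINF_lower)
  have d0: "0 \<le> d" unfolding d_def using assms by (intro cINF_greatest) auto
  have "\<exists>w\<in>S. norm (a - w) < d + 1 / Suc n" for n
  proof -
    have "(INF w\<in>S. norm (a - w)) < d + 1 / Suc n" by (simp add: d_def)
    then show ?thesis by (subst (asm) cINF_less_iff[OF assms(3) bdd]) auto
  qed
  then obtain z where z: "\<And>n. z n \<in> S" "\<And>n. norm (a - z n) < d + 1 / Suc n" by metis
  have lim: "(\<lambda>n. norm (a - z n)) \<longlonglongrightarrow> d"
  proof (rule real_tendsto_sandwich[of "\<lambda>_. d"])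
    show "(\<lambda>n. d + 1 / Suc n) \<longlonglongrightarrow> d"
      using tendsto_add[OF tendsto_const[of d] LIMSEQ_inverse_real_of_nat] by (simp add: inverse_eq_divide)
    show "\<forall>\<^sub>F n in sequentially. norm (a - z n) \<le> d + 1 / Suc n"
      using z(2) by (intro always_eventually allI less_imp_le)
  qed (use z(1) d_le in \<open>auto intro!: always_eventually\<close>)
  have "Cauchy z"
  proof (rule metric_CauchyI)
    fix e :: real assume e: "0 < e"
    have "(\<lambda>n. 4 * (norm (a - z n))\<^sup>2) \<longlonglongrightarrow> 4 * d\<^sup>2" by (intro tendsto_intros lim)
    then have "\<forall>\<^sub>F n in sequentially. 4 * (norm (a - z n))\<^sup>2 < 4 * d\<^sup>2 + e\<^sup>2"
      by (rule order_tendstoD) (use e in simp)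
    then obtain N where N: "\<And>n. N \<le> n \<Longrightarrow> 4 * (norm (a - z n))\<^sup>2 < 4 * d\<^sup>2 + e\<^sup>2"
      by (auto simp: eventually_sequentially)
    have "dist (z m) (z n) < e" if "N \<le> m" "N \<le> n" for m n
    proof -
      have "(norm (z m - z n))\<^sup>2 < e\<^sup>2"
        using convex_midpoint_norm[OF assms(2) z(1) z(1) d0 d_le, of m n] N[OF that(1)] N[OF that(2)]
        by simp
      then show ?thesis using e by (simp add: dist_norm power2_less_imp_less)
    qed
    then show "\<exists>N. \<forall>m\<ge>N. \<forall>n\<ge>N. dist (z m) (z n) < e" by blast
  qed
  then obtain l where l: "z \<longlonglongrightarrow> l" by (auto simp: Cauchy_convergent_iff convergent_def)
  have "l \<in> S" using assms(1) z(1) l by (auto simp: closed_sequential_limits)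
  moreover have "norm (a - l) = d"
    by (rule LIMSEQ_unique[OF _ lim]) (intro tendsto_intros l)
  ultimately show ?thesis using d_le by auto
qed

context
  fixes S :: "'h::{real_inner, complete_space} set"
  assumes S: "closed S" "convex S" "S \<noteq> {}"
begin

lemma nearest_in: "nearest S a \<in> S"
  and nearest_le: "w \<in> S \<Longrightarrow> norm (a - nearest S a) \<le> norm (a - w)"
  using someI_ex[of "\<lambda>z. z \<in> S \<and> (\<forall>w\<in>S. norm (a - z) \<le> norm (a - w))"] nearest_exists[OF S, of a]
  unfolding nearest_def by blast+

lemma nearest_eqI:
  assumes "w \<in> S" "norm (a - w) \<le> norm (a - nearest S a)"
  shows "w = nearest S a"
  using S(2) nearest_in nearest_le assms by (rule nearest_unique)

text \<open>Moving from the projection a fraction \<open>t\<close> towards \<open>w\<close> stays in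
  \<open>S\<close> and cannot come closer to \<open>a\<close>; the term of first order in
  \<open>t\<close>, as \<open>t\<close> tends to 0, is the claim.\<close>

lemma nearest_inner_le:
  assumes w: "w \<in> S" shows "(a - nearest S a) \<bullet> (w - nearest S a) \<le> 0"
proof -
  define z where "z = nearest S a"
  have "2 * ((a - z) \<bullet> (w - z)) \<le> t * (norm (w - z))\<^sup>2" if t: "0 < t" "t \<le> 1" for t
  proof -
    have "(1 - t) *\<^sub>R z + t *\<^sub>R w \<in> S"
      using S(2) nearest_in w t unfolding z_def by (intro convexD) auto
    then have "(norm (a - z))\<^sup>2 \<le> (norm (a - ((1 - t) *\<^sub>R z + t *\<^sub>R w)))\<^sup>2"
      unfolding z_def by (intro power_mono nearest_le) auto
    also have "a - ((1 - t) *\<^sub>R z + t *\<^sub>R w) = (a - z) - t *\<^sub>R (w - z)" by (simp add: algebra_simps)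
    also have "(norm \<dots>)\<^sup>2 = (norm (a - z))\<^sup>2 - 2 * t * ((a - z) \<bullet> (w - z)) + t * t * (norm (w - z))\<^sup>2"
    proof -
      have "(norm (u - t *\<^sub>R v))\<^sup>2 = (norm u)\<^sup>2 - 2 * t * (u \<bullet> v) + t * t * (norm v)\<^sup>2" for u v :: 'h
        unfolding power2_norm_eq_inner by (simp add: inner_diff_left inner_diff_right inner_commute)
      then show ?thesis .
    qed
    finally have "t * (2 * ((a - z) \<bullet> (w - z))) \<le> t * (t * (norm (w - z))\<^sup>2)" by (simp add: algebra_simps)
    then show ?thesis using t by (simp only: mult_le_cancel_left_pos)
  qed
  then have "\<forall>\<^sub>F t in at_right 0. 2 * ((a - z) \<bullet> (w - z)) \<le> t * (norm (w - z))\<^sup>2"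
    by (auto simp: eventually_at_right[of 0 1] intro!: exI[of _ 1])
  moreover have "((\<lambda>t. t * (norm (w - z))\<^sup>2) \<longlongrightarrow> 0 * (norm (w - z))\<^sup>2) (at_right 0)"
    by (intro tendsto_intros)
  ultimately have "2 * ((a - z) \<bullet> (w - z)) \<le> 0"
    using tendsto_lowerbound[of "\<lambda>t. t * (norm (w - z))\<^sup>2" 0 "at_right (0::real)"] by simp
  then show ?thesis by (simp add: z_def)
qed

text \<open>With \<open>z\<close> the projection, the cross term in the expansion of
  \<open>(a - z) - (w - z)\<close> has the right sign by \<open>nearest_inner_le\<close>. The
  inequality turns an almost minimal distance into closeness to \<open>z\<close>, which is how
  convergence of projections is obtained later.\<close>

lemma nearest_pythagoras:
  assumes "w \<in> S"
  shows "(norm (w - nearest S a))\<^sup>2 \<le> (norm (a - w))\<^sup>2 - (norm (a - nearest S a))\<^sup>2"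
  using nearest_inner_le[OF assms, of a] unfolding power2_norm_eq_inner
  by (simp add: inner_diff_left inner_diff_right inner_commute algebra_simps)

text \<open>Testing each projection against the other in \<open>nearest_inner_le\<close> and adding
  bounds \<open>u \<bullet> u\<close> by \<open>(a - b) \<bullet> u\<close>; Cauchy-Schwarz does the
  rest.\<close>

lemma nearest_lipschitz: "norm (nearest S a - nearest S b) \<le> norm (a - b)"
proof -
  define u where "u = nearest S a - nearest S b"
  have "u \<bullet> u \<le> (a - b) \<bullet> u"
    using nearest_inner_le[OF nearest_in, of a b] nearest_inner_le[OF nearest_in, of b a]
    unfolding u_def by (simp add: inner_diff_left inner_diff_right inner_commute algebra_simps)
  also have "\<dots> \<le> norm (a - b) * norm u" by (rule norm_cauchy_schwarz)
  finally have "norm u * norm u \<le> norm (a - b) * norm u"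
    by (simp add: power2_norm_eq_inner[symmetric] power2_eq_square)
  then show ?thesis unfolding u_def[symmetric] by (cases "norm u = 0") (auto simp: mult_le_cancel_right)
qed

lemma continuous_on_nearest: "continuous_on A (nearest S)"
  unfolding continuous_on_iff
proof (intro ballI allI impI)
  fix x e :: _ assume "0 < (e::real)"
  then show "\<exists>d>0. \<forall>x'\<in>A. dist x' x < d \<longrightarrow> dist (nearest S x') (nearest S x) < e"
    using nearest_lipschitz by (intro exI[of _ e]) (auto simp: dist_norm intro: le_less_trans)
qed

end

section \<open>Compact ellipsoids and tightness\<close>

text \<open>Bounding all finite partial sums includes convergence of the weighted series and
  presents the set as an intersection of conditions on finitely many coordinates, hence as closed
  under pointwise convergence.\<close>

definition ell2_ellipsoid :: "('a \<Rightarrow> real) \<Rightarrow> real \<Rightarrow> 'a ell2 set" where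
  "ell2_ellipsoid w R = {f. \<forall>F. finite F \<longrightarrow> (\<Sum>x\<in>F. w x * (ell2_nth f x)\<^sup>2) \<le> R}"

text \<open>As a set of functions the ellipsoid is closed in a product of compact intervals, so it
  is compact for pointwise convergence by Tychonoff. On it, pointwise convergence implies norm
  convergence: outside the finite set where \<open>w \<le> r\<close>, two elements differ by at most
  \<open>4 * R / r\<close> in squared norm.\<close>

lemma compact_ell2_ellipsoid:
  fixes w :: "'a \<Rightarrow> real"
  assumes c: "0 < c" "\<And>x. c \<le> w x" and fin: "\<And>r. finite {x. w x \<le> r}"
  shows "compact (ell2_ellipsoid w R)"
proof -
  define K where "K = {a :: 'a \<Rightarrow> real. \<forall>F. finite F \<longrightarrow> (\<Sum>x\<in>F. w x * (a x)\<^sup>2) \<le> R}"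
  define b where "b = sqrt (R / c)"
  have sq: "(\<Sum>x\<in>F. (a x)\<^sup>2) \<le> R / c" if "a \<in> K" "finite F" for a and F :: "'a set"
  proof -
    have "c * (\<Sum>x\<in>F. (a x)\<^sup>2) \<le> (\<Sum>x\<in>F. w x * (a x)\<^sup>2)"
      unfolding sum_distrib_left using c by (intro sum_mono mult_right_mono) auto
    also have "\<dots> \<le> R" using that by (simp add: K_def)
    finally show ?thesis using c by (simp add: field_simps)
  qed
  have nth: "ell2_nth (Abs_ell2 a) = a" if "a \<in> K" for a
    using sq[OF that] by (intro ell2_nth_Abs square_summableI) auto
  have img: "ell2_ellipsoid w R = Abs_ell2 ` K"
  proof (intro equalityI subsetI)
    fix f assume "f \<in> ell2_ellipsoid w R"
    then have "ell2_nth f \<in> K" by (simp add: ell2_ellipsoid_def K_def)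
    then show "f \<in> Abs_ell2 ` K" by (intro image_eqI[of _ _ "ell2_nth f"]) (simp_all add: ell2_nth_inverse)
  next
    fix f assume "f \<in> Abs_ell2 ` K"
    then obtain a where a: "a \<in> K" "f = Abs_ell2 a" by blast
    show "f \<in> ell2_ellipsoid w R"
      using a(1) unfolding a(2) ell2_ellipsoid_def mem_Collect_eq nth[OF a(1)] by (simp add: K_def)
  qed
  have "compact (PiE UNIV (\<lambda>_::'a. {-b..b}))"
    using compactin_PiE[of "\<lambda>_::'a. euclidean" UNIV "\<lambda>_. {-b..b}"]
    by (simp add: euclidean_product_topology)
  moreover have "closed K"
  proof -
    have "K = (\<Inter>F\<in>Collect finite. {a. (\<Sum>x\<in>F. w x * (a x)\<^sup>2) \<le> R})" by (auto simp: K_def)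
    then show ?thesis
      by (auto intro!: closed_INT closed_Collect_le continuous_intros continuous_on_product_coordinates)
  qed
  moreover have "K \<subseteq> PiE UNIV (\<lambda>_. {-b..b})"
  proof
    fix a assume a: "a \<in> K"
    have "\<bar>a x\<bar> \<le> b" for x
      using real_sqrt_le_mono[OF sq[OF a, of "{x}"]] by (simp add: b_def)
    then show "a \<in> PiE UNIV (\<lambda>_. {-b..b})" by (auto simp: abs_le_iff minus_le_iff)
  qed
  ultimately have "compact K" by (metis compact_Int_closed inf.absorb2)
  moreover have "continuous_on K Abs_ell2"
    unfolding continuous_on_def
  proof (intro ballI tendstoI)
    fix a and e :: real assume a: "a \<in> K" and e: "0 < e"
    have R: "0 \<le> R" using a by (auto simp: K_def dest: spec[of _ "{}"])
    \<comment> \<open>The tail costs at most \<open>4 * R / r\<close>, and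
      \<open>8 * R / e^2\<close> makes this half of \<open>e^2\<close>; adding 1 keeps
      \<open>r\<close> positive when \<open>R = 0\<close>.\<close>
    define r where "r = 8 * R / e\<^sup>2 + 1"
    have r: "0 < r" unfolding r_def using R e by (intro add_nonneg_pos) auto
    have "4 * R \<le> e\<^sup>2 / 2 * r" unfolding r_def using R e by (simp add: algebra_simps)
    then have r2: "4 * R / r \<le> e\<^sup>2 / 2" using r by (simp add: divide_le_eq)
    define G where "G = {x. w x \<le> r}"
    have "((\<lambda>b. \<Sum>x\<in>G. (b x - a x)\<^sup>2) \<longlongrightarrow> (\<Sum>x\<in>G. (a x - a x)\<^sup>2)) (at a within K)"
      by (intro continuous_on_tendsto_compose[of K "\<lambda>b. \<Sum>x\<in>G. (b x - a x)\<^sup>2"]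
          continuous_intros continuous_on_subset[OF continuous_on_product_coordinates subset_UNIV]
          tendsto_ident_at a)
        (auto simp: eventually_at_filter)
    then have "\<forall>\<^sub>F b in at a within K. (\<Sum>x\<in>G. (b x - a x)\<^sup>2) < e\<^sup>2 / 2"
      by (rule order_tendstoD) (use e in simp)
    moreover have "\<forall>\<^sub>F b in at a within K. b \<in> K" by (auto simp: eventually_at_filter)
    ultimately show "\<forall>\<^sub>F b in at a within K. dist (Abs_ell2 b) (Abs_ell2 a) < e"
    proof eventually_elim
      case (elim b)
      have "(norm (Abs_ell2 b - Abs_ell2 a))\<^sup>2 \<le> (\<Sum>x\<in>G. (b x - a x)\<^sup>2) + 4 * R / r"
      proof (rule ell2_norm_sq_le)
        fix F :: "'a set" assume F: "finite F"
        have "(\<Sum>x\<in>F. (b x - a x)\<^sup>2) \<le> (\<Sum>x\<in>G \<union> (F - G). (b x - a x)\<^sup>2)"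
          using F fin by (intro sum_mono2) (auto simp: G_def)
        also have "\<dots> = (\<Sum>x\<in>G. (b x - a x)\<^sup>2) + (\<Sum>x\<in>F - G. (b x - a x)\<^sup>2)"
          using F fin by (intro sum.union_disjoint) (auto simp: G_def)
        also have "(\<Sum>x\<in>F - G. (b x - a x)\<^sup>2)
            \<le> (\<Sum>x\<in>F - G. (2 / r) * (w x * (b x)\<^sup>2) + (2 / r) * (w x * (a x)\<^sup>2))"
        proof (rule sum_mono)
          fix x assume "x \<in> F - G"
          then have w: "r \<le> w x" by (simp add: G_def)
          have "(b x - a x)\<^sup>2 \<le> 2 * ((b x)\<^sup>2 + (a x)\<^sup>2)"
            using sum_squares_bound[of "b x" "- a x"] by (simp add: power2_diff)
          then have "r * (b x - a x)\<^sup>2 \<le> w x * (2 * ((b x)\<^sup>2 + (a x)\<^sup>2))"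
            using w r by (intro mult_mono) auto
          then show "(b x - a x)\<^sup>2 \<le> (2 / r) * (w x * (b x)\<^sup>2) + (2 / r) * (w x * (a x)\<^sup>2)"
            using r by (simp add: field_simps)
        qed
        also have "\<dots> = (2 / r) * ((\<Sum>x\<in>F - G. w x * (b x)\<^sup>2) + (\<Sum>x\<in>F - G. w x * (a x)\<^sup>2))"
          by (simp add: sum.distrib sum_distrib_left distrib_left)
        also have "\<dots> \<le> (2 / r) * (R + R)"
          using elim(2) a F r by (intro mult_left_mono add_mono) (auto simp: K_def)
        finally show "(\<Sum>x\<in>F. (ell2_nth (Abs_ell2 b - Abs_ell2 a) x)\<^sup>2) \<le> (\<Sum>x\<in>G. (b x - a x)\<^sup>2) + 4 * R / r"
          by (simp add: minus_ell2.rep_eq nth[OF a] nth[OF elim(2)])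
      qed
      also have "\<dots> < e\<^sup>2" using elim(1) r2 by linarith
      finally show ?case using e by (simp add: dist_norm power2_less_imp_less)
    qed
  qed
  ultimately show ?thesis unfolding img by (intro compact_continuous_image)
qed

text \<open>With \<open>t k\<close> the \<open>k\<close>-th tail of a convergent positive series, the terms
  \<open>(t k - t (Suc k)) / sqrt (t k)\<close> are dominated by the telescoping \<open>2 (sqrt (t k) - sqrt (t (Suc k)))\<close>.\<close>

lemma exists_divergent_weight:
  fixes p :: "'a::countable pmf"
  obtains w :: "'a \<Rightarrow> real" and c B :: real
  where "0 < c" "\<And>x. c \<le> w x" "\<And>r. finite {x. w x \<le> r}" "0 \<le> B"
    "\<And>F. finite F \<Longrightarrow> (\<Sum>x\<in>F. w x * pmf p x) \<le> B"
proof -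
  define p' where "p' k = (\<Sum>x\<in>to_nat -` {k}. pmf p x)" for k
  have fib: "to_nat -` {to_nat x} = {x}" for x :: 'a by auto
  have fibfin: "finite (to_nat -` {k} :: 'a set)" for k
    by (intro finite_vimageI) auto
  have p'_to_nat: "p' (to_nat x) = pmf p x" for x by (simp add: p'_def fib)
  have p'0: "0 \<le> p' k" for k by (auto simp: p'_def intro: sum_nonneg)
  have "summable p'"
  proof (rule summableI_nonneg_bounded[OF p'0])
    fix n
    have "(\<Sum>k<n. p' k) = (\<Sum>x\<in>(\<Union>k<n. to_nat -` {k}). pmf p x)"
      unfolding p'_def by (subst sum.UNION_disjoint) (auto simp: fibfin)
    also have "\<dots> = measure (measure_pmf p) (\<Union>k<n. to_nat -` {k})"
      by (simp add: measure_measure_pmf_finite fibfin)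
    finally show "(\<Sum>k<n. p' k) \<le> 1" by simp
  qed
  \<comment> \<open>The geometric term makes every tail \<open>t k\<close> positive, even if
    \<open>p'\<close> vanishes from some index on, so that \<open>1 / sqrt (t k)\<close> is a
    genuine weight; the total stays finite.\<close>
  define q where "q k = p' k + (1/2)^k" for k
  have q: "summable q" unfolding q_def by (intro summable_add \<open>summable p'\<close> summable_geometric) simp
  have q0: "0 < q k" for k unfolding q_def using p'0[of k] by (intro add_nonneg_pos) auto
  define t where "t k = (\<Sum>j. q (j + k))" for k
  have t_pos: "0 < t k" for k
    unfolding t_def using q q0 by (intro suminf_pos summable_ignore_initial_segment) auto
  have t_Suc: "t k = q k + t (Suc k)" for k
    unfolding t_def using suminf_split_head[OF summable_ignore_initial_segment[OF q, of k]] by simp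
  have t_dec: "decseq t" 
  proof (rule decseq_SucI)
    show "t (Suc k) \<le> t k" for k using t_Suc[of k] q0[of k] by linarith
  qed
  have t_lim: "t \<longlonglongrightarrow> 0" unfolding t_def by (rule suminf_exist_split2[OF q])
  define w where "w k = 1 / sqrt (t k)" for k
  have bound: "(\<Sum>k<n. w k * q k) \<le> 2 * sqrt (t 0)" for n
  proof -
    have "w k * q k \<le> 2 * (sqrt (t k) - sqrt (t (Suc k)))" for k
    proof -
      define u v where "u = sqrt (t k)" and "v = sqrt (t (Suc k))"
      have uv: "0 < u" "0 < v" "v \<le> u"
        using t_pos decseqD[OF t_dec, of k "Suc k"] by (auto simp: u_def v_def)
      have "q k = u\<^sup>2 - v\<^sup>2"
        unfolding u_def v_def using t_Suc[of k] t_pos[of k] t_pos[of "Suc k"]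
          real_sqrt_pow2[of "t k"] real_sqrt_pow2[of "t (Suc k)"] by linarith
      then have "q k = (u - v) * (u + v)" by (simp add: power2_eq_square algebra_simps)
      also have "\<dots> \<le> (u - v) * (2 * u)" using uv by (intro mult_left_mono) auto
      finally show ?thesis using uv by (simp add: w_def u_def[symmetric] v_def[symmetric] field_simps)
    qed
    then have "(\<Sum>k<n. w k * q k) \<le> (\<Sum>k<n. 2 * (sqrt (t k) - sqrt (t (Suc k))))" by (rule sum_mono)
    also have "\<dots> = 2 * (sqrt (t 0) - sqrt (t n))"
      by (simp only: sum_distrib_left[symmetric] sum_lessThan_telescope'[of "\<lambda>k. sqrt (t k)"])
    also have "\<dots> \<le> 2 * sqrt (t 0)" using t_pos[of n] by simp
    finally show ?thesis .
  qed
  show thesis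
  proof (rule that[of "1 / sqrt (t 0)" "\<lambda>x. w (to_nat x)" "2 * sqrt (t 0)"])
    show "0 < 1 / sqrt (t 0)" "0 \<le> 2 * sqrt (t 0)" using t_pos[of 0] by auto
    show "1 / sqrt (t 0) \<le> w (to_nat x)" for x :: 'a
      unfolding w_def using t_pos decseqD[OF t_dec, of 0 "to_nat x"]
      by (intro divide_left_mono) (auto intro!: mult_pos_pos)
    show "finite {x::'a. w (to_nat x) \<le> r}" for r
    proof -
      \<comment> \<open>The maximum provides a positive threshold, and thus a meaningful
        \<open>1 / s\<close>, also for \<open>r \<le> 0\<close>.\<close>
      define s where "s = max r 1"
      have "\<forall>\<^sub>F k in sequentially. t k < (1 / s)\<^sup>2"
        by (rule order_tendstoD[OF t_lim]) (simp add: s_def)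
      then obtain N where N: "\<And>k. N \<le> k \<Longrightarrow> t k < (1 / s)\<^sup>2" by (auto simp: eventually_sequentially)
      have "to_nat x < N" if "w (to_nat x) \<le> r" for x :: 'a
      proof (rule ccontr)
        assume "\<not> to_nat x < N"
        then have "sqrt (t (to_nat x)) < 1 / s"
          using N[of "to_nat x"] by (intro real_less_lsqrt) (auto simp: s_def)
        moreover have "0 < s" by (simp add: s_def)
        ultimately have "s < w (to_nat x)" using t_pos[of "to_nat x"] by (simp add: w_def field_simps)
        then show False using that by (simp add: s_def)
      qed
      then have "{x::'a. w (to_nat x) \<le> r} \<subseteq> to_nat -` {..<N}" by auto
      then show ?thesis by (rule finite_subset) (intro finite_vimageI, auto)
    qed
    fix F :: "'a set" assume F: "finite F"
    then obtain n where n: "to_nat ` F \<subseteq> {..<n}" using finite_nat_iff_bounded by blast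
    have "(\<Sum>x\<in>F. w (to_nat x) * pmf p x) \<le> (\<Sum>x\<in>F. w (to_nat x) * q (to_nat x))"
      using t_pos by (intro sum_mono mult_left_mono) (auto simp: q_def p'_to_nat w_def less_imp_le)
    also have "\<dots> = (\<Sum>k\<in>to_nat ` F. w k * q k)" by (subst sum.reindex) (auto simp: inj_on_def)
    also have "\<dots> \<le> (\<Sum>k<n. w k * q k)"
      using n t_pos q0 by (intro sum_mono2) (auto simp: w_def less_imp_le)
    also note bound
    finally show "(\<Sum>x\<in>F. w (to_nat x) * pmf p x) \<le> 2 * sqrt (t 0)" .
  qed
qed

section \<open>Uniform tightness from summable second moments of the coordinates\<close>

lemma borel_measurable_ell2_nth [measurable]: "(\<lambda>f. ell2_nth f x) \<in> borel_measurable borel"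
  unfolding inner_ell2_basis[symmetric]
  by (intro borel_measurable_continuous_onI continuous_intros)

text \<open>The index type is arbitrary, so that a single limit variable is covered as a family over
  \<open>unit\<close>.\<close>

definition uniformly_tight :: "'w measure \<Rightarrow> ('i \<Rightarrow> 'w \<Rightarrow> 'h::topological_space) \<Rightarrow> bool" where
  "uniformly_tight M X \<longleftrightarrow>
    (\<forall>e>0. \<exists>K. compact K \<and> (\<forall>i. measure M {\<omega>\<in>space M. X i \<omega> \<notin> K} \<le> e))"

text \<open>With the weight of \<open>exists_divergent_weight\<close>, the expected weighted sum of
  squares over any finite set is at most \<open>B\<close>, so Markov's inequality bounds the
  probability of leaving the ellipsoid by \<open>B / R\<close>, uniformly in
  \<open>i\<close>.\<close>

lemma ell2_uniformly_tight:
  fixes p :: "'a::countable pmf" and X :: "'i \<Rightarrow> 'w \<Rightarrow> 'a ell2"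
  assumes M: "prob_space M" and meas: "\<And>i. X i \<in> borel_measurable M"
    and int: "\<And>i x. integrable M (\<lambda>\<omega>. (ell2_nth (X i \<omega>) x)\<^sup>2)"
    and le: "\<And>i x. (\<integral>\<omega>. (ell2_nth (X i \<omega>) x)\<^sup>2 \<partial>M) \<le> pmf p x"
  shows "uniformly_tight M X"
  unfolding uniformly_tight_def
proof (intro allI impI)
  fix e :: real assume e: "0 < e"
  interpret prob_space M by fact
  obtain w :: "'a \<Rightarrow> real" and c B where w: "0 < c" "\<And>x. c \<le> w x" "\<And>r. finite {x. w x \<le> r}" "0 \<le> B"
    "\<And>F. finite F \<Longrightarrow> (\<Sum>x\<in>F. w x * pmf p x) \<le> B"
    by (rule exists_divergent_weight[of p]) (rule that)
  have w0: "0 \<le> w x" for x using w(1) w(2)[of x] by linarith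
  define R where "R = B / e + 1"
  have R: "0 < R" unfolding R_def using w(4) e by (intro add_nonneg_pos) auto
  have "B \<le> e * R" unfolding R_def using w(4) e by (simp add: algebra_simps)
  then have R2: "B / R \<le> e" using R by (simp add: divide_le_eq)
  have "measure M {\<omega>\<in>space M. X i \<omega> \<notin> ell2_ellipsoid w R} \<le> e" for i
  proof -
    \<comment> \<open>Initial segments of an enumeration replace arbitrary finite sets: the events
      \<open>R \<le> S n\<close> increase with \<open>n\<close> and cover the exit event, so a bound
      for every \<open>n\<close> passes to the union.\<close>
    define F where "F n = (to_nat -` {..<n} :: 'a set)" for n
    have F: "finite (F n)" for n unfolding F_def by (intro finite_vimageI) auto
    define S where "S n \<omega> = (\<Sum>x\<in>F n. w x * (ell2_nth (X i \<omega>) x)\<^sup>2)" for n \<omega>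
    note [measurable] = meas[of i]
    have [measurable]: "S n \<in> borel_measurable M" for n unfolding S_def by measurable
    have mono: "S n \<omega> \<le> S m \<omega>" if "n \<le> m" for n m \<omega>
      unfolding S_def using that w0 F by (intro sum_mono2) (auto simp: F_def)
    have "{\<omega>\<in>space M. X i \<omega> \<notin> ell2_ellipsoid w R} \<subseteq> (\<Union>n. {\<omega>\<in>space M. R \<le> S n \<omega>})"
    proof
      fix \<omega> assume \<omega>: "\<omega> \<in> {\<omega>\<in>space M. X i \<omega> \<notin> ell2_ellipsoid w R}"
      then obtain G where G: "finite G" "R < (\<Sum>x\<in>G. w x * (ell2_nth (X i \<omega>) x)\<^sup>2)"
        by (auto simp: ell2_ellipsoid_def not_le)
      obtain n where n: "to_nat ` G \<subseteq> {..<n}" using G(1) finite_nat_iff_bounded by blast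
      have "(\<Sum>x\<in>G. w x * (ell2_nth (X i \<omega>) x)\<^sup>2) \<le> S n \<omega>"
        unfolding S_def using n w0 F by (intro sum_mono2) (auto simp: F_def)
      then have "R \<le> S n \<omega>" using G(2) by linarith
      then show "\<omega> \<in> (\<Union>n. {\<omega>\<in>space M. R \<le> S n \<omega>})" using \<omega> by blast
    qed
    then have "measure M {\<omega>\<in>space M. X i \<omega> \<notin> ell2_ellipsoid w R} \<le> measure M (\<Union>n. {\<omega>\<in>space M. R \<le> S n \<omega>})"
      by (rule finite_measure_mono) measurable
    also have "\<dots> \<le> e"
    proof (rule LIMSEQ_le_const2)
      show "(\<lambda>n. measure M {\<omega>\<in>space M. R \<le> S n \<omega>}) \<longlonglongrightarrow> measure M (\<Union>n. {\<omega>\<in>space M. R \<le> S n \<omega>})"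
      proof (rule finite_Lim_measure_incseq)
        show "incseq (\<lambda>n. {\<omega>\<in>space M. R \<le> S n \<omega>})"
        proof (rule incseq_SucI, safe)
          fix n \<omega> assume "R \<le> S n \<omega>"
          then show "R \<le> S (Suc n) \<omega>" using mono[of n "Suc n" \<omega>] by simp
        qed
      qed (simp add: image_subset_iff)
      have "measure M {\<omega>\<in>space M. R \<le> S n \<omega>} \<le> e" for n
      proof -
        have "measure M {\<omega>\<in>space M. R \<le> S n \<omega>} \<le> (\<integral>\<omega>. S n \<omega> \<partial>M) / R"
          using R w0 unfolding S_def
          by (intro integral_Markov_inequality_measure[where A = "space M"] Bochner_Integration.integrable_sum
              integrable_mult_right int AE_I2) (auto intro!: sum_nonneg)
        also have "(\<integral>\<omega>. S n \<omega> \<partial>M) = (\<Sum>x\<in>F n. w x * (\<integral>\<omega>. (ell2_nth (X i \<omega>) x)\<^sup>2 \<partial>M))"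
          unfolding S_def by (simp add: int)
        also have "\<dots> / R \<le> (\<Sum>x\<in>F n. w x * pmf p x) / R"
          using R w0 le by (intro divide_right_mono sum_mono mult_left_mono) auto
        also have "\<dots> \<le> B / R" using R w(5)[OF F] by (intro divide_right_mono) auto
        finally show ?thesis using R2 by linarith
      qed
      then show "\<exists>N. \<forall>n\<ge>N. measure M {\<omega>\<in>space M. R \<le> S n \<omega>} \<le> e" by blast
    qed
    finally show ?thesis .
  qed
  then show "\<exists>K. compact K \<and> (\<forall>i. measure M {\<omega>\<in>space M. X i \<omega> \<notin> K} \<le> e)"
    using compact_ell2_ellipsoid[OF w(1-3), of R] by blast
qed

section \<open>Weak convergence from trigonometric test functions\<close>

text \<open>Real trigonometric polynomials in the functionals \<open>x \<bullet> h\<close>: the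
  phase \<open>a\<close> covers sines, and \<open>h = 0\<close> gives constants. Products stay
  inside by the addition formulas, so this is an algebra to which Stone-Weierstrass applies on
  compact sets.\<close>

inductive_set trig_functions :: "('h::real_inner \<Rightarrow> real) set" where
  cos: "(\<lambda>x. c * cos (x \<bullet> h + a)) \<in> trig_functions"
| add: "f \<in> trig_functions \<Longrightarrow> g \<in> trig_functions \<Longrightarrow> (\<lambda>x. f x + g x) \<in> trig_functions"

lemma trig_functions_const: "(\<lambda>_. c) \<in> trig_functions"
  using trig_functions.cos[of c 0 0] by simp

lemma trig_functions_mult:
  assumes "f \<in> trig_functions" "g \<in> trig_functions"
  shows "(\<lambda>x. f x * g x) \<in> trig_functions"
  using assms(1)
proof induction
  case (cos c h a)
  show ?case using assms(2)
  proof induction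
    case (cos d k b)
    have "(c * cos (x \<bullet> h + a)) * (d * cos (x \<bullet> k + b)) =
        (c * d / 2) * cos (x \<bullet> (h - k) + (a - b)) + (c * d / 2) * cos (x \<bullet> (h + k) + (a + b))" for x
    proof -
      have "x \<bullet> (h - k) + (a - b) = (x \<bullet> h + a) - (x \<bullet> k + b)"
        "x \<bullet> (h + k) + (a + b) = (x \<bullet> h + a) + (x \<bullet> k + b)" by (simp_all add: inner_diff_right inner_add_right)
      then show ?thesis by (simp only: cos_diff cos_add) (simp add: field_simps)
    qed
    then show ?case by (simp only: trig_functions.intros)
  next
    case (add f g)
    then show ?case unfolding distrib_left by (intro trig_functions.add)
  qed
next
  case (add f g)
  then show ?case unfolding distrib_right by (intro trig_functions.add)
qed

lemma trig_functions_sum: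
  "(\<And>i. i \<in> I \<Longrightarrow> f i \<in> trig_functions) \<Longrightarrow> (\<lambda>x. \<Sum>i\<in>I. f i x) \<in> trig_functions"
  by (induction I rule: infinite_finite_induct)
    (auto intro: trig_functions_const trig_functions.add)

lemma trig_functions_power: "f \<in> trig_functions \<Longrightarrow> (\<lambda>x. f x ^ n) \<in> trig_functions"
  by (induction n) (auto intro: trig_functions_const trig_functions_mult)

lemma trig_functions_continuous: "f \<in> trig_functions \<Longrightarrow> continuous_on S f"
  by (induction rule: trig_functions.induct) (auto intro!: continuous_intros)

lemma trig_functions_bounded: "f \<in> trig_functions \<Longrightarrow> \<exists>B. \<forall>x. \<bar>f x\<bar> \<le> B"
proof (induction rule: trig_functions.induct)
  case (cos c h a)
  have "\<bar>c * cos (x \<bullet> h + a)\<bar> \<le> \<bar>c\<bar> * 1" for x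
    unfolding abs_mult by (intro mult_left_mono) auto
  then show ?case by blast
next
  case (add f g)
  then obtain B D where "\<And>x. \<bar>f x\<bar> \<le> B" "\<And>x. \<bar>g x\<bar> \<le> D" by blast
  then have "\<bar>f x + g x\<bar> \<le> B + D" for x by (intro abs_triangle_ineq[THEN order_trans] add_mono)
  then show ?case by blast
qed

lemma trig_functions_separate:
  fixes x y :: "'h::real_inner"
  assumes "x \<noteq> y"
  shows "\<exists>f\<in>trig_functions. f x \<noteq> f y"
proof
  \<comment> \<open>Scaled so that \<open>(y - x) \<bullet> h = pi\<close>; with the phase
    \<open>- (x \<bullet> h)\<close> the cosine is 1 at \<open>x\<close> and -1 at
    \<open>y\<close>.\<close>
  define h where "h = (pi / ((y - x) \<bullet> (y - x))) *\<^sub>R (y - x)"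
  have "(y - x) \<bullet> (y - x) \<noteq> 0" using assms by simp
  then have "(y - x) \<bullet> h = pi" by (simp add: h_def)
  then have "y \<bullet> h + - (x \<bullet> h) = pi" by (simp add: inner_diff_left)
  then show "1 * cos (x \<bullet> h + - (x \<bullet> h)) \<noteq> 1 * cos (y \<bullet> h + - (x \<bullet> h))" by simp
  show "(\<lambda>z. 1 * cos (z \<bullet> h + - (x \<bullet> h))) \<in> trig_functions" by (rule trig_functions.cos)
qed

text \<open>A Stone--Weierstrass approximation is only controlled on the compact set; composing it with a
  polynomial close to the clamping function on its bounded range controls it everywhere.\<close>

lemma trig_functions_approx:
  fixes f :: "'h::real_inner \<Rightarrow> real"
  assumes K: "compact K" and f: "continuous_on K f" and B: "\<And>x. x \<in> K \<Longrightarrow> \<bar>f x\<bar> \<le> B" "0 \<le> B" and e: "0 < e"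
  obtains g where "g \<in> trig_functions" "\<And>x. x \<in> K \<Longrightarrow> \<bar>f x - g x\<bar> \<le> e" "\<And>x. \<bar>g x\<bar> \<le> B + e"
proof -
  interpret function_ring_on "trig_functions :: ('h \<Rightarrow> real) set" K
    by standard (use K in \<open>auto intro: trig_functions_continuous trig_functions.add trig_functions_mult
        trig_functions_const dest: trig_functions_separate\<close>)
  obtain g where g: "g \<in> trig_functions" "\<And>x. x \<in> K \<Longrightarrow> \<bar>f x - g x\<bar> < e / 2"
    using Stone_Weierstrass_basic[OF f, of "e / 2"] e by auto
  obtain D where D: "\<And>x. \<bar>g x\<bar> \<le> D" using trig_functions_bounded[OF g(1)] by blast
  define clamp where "clamp u = max (- B) (min B u)" for u :: real
  have "continuous_on {-D..D} clamp" unfolding clamp_def by (intro continuous_intros)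
  then obtain q where q: "polynomial_function q" "\<And>u. u \<in> {-D..D} \<Longrightarrow> norm (clamp u - q u) < e / 2"
    using Stone_Weierstrass_polynomial_function[of "{-D..D}" clamp "e / 2"] e by auto
  from q(1) have "real_polynomial_function q" by (simp add: real_polynomial_function_eq)
  then obtain a n where "q = (\<lambda>u. \<Sum>i\<le>n. a i * u ^ i)" by (auto simp: real_polynomial_function_iff_sum)
  then have qg: "(\<lambda>x. q (g x)) \<in> trig_functions"
    using g(1) by (simp add: trig_functions_sum trig_functions_mult trig_functions_power trig_functions_const)
  have qD: "\<bar>clamp (g x) - q (g x)\<bar> < e / 2" for x
    using q(2)[of "g x"] D[of x] by (simp add: abs_le_iff minus_le_iff)
  show thesis
  proof
    show "(\<lambda>x. q (g x)) \<in> trig_functions" by fact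
    show "\<bar>f x - q (g x)\<bar> \<le> e" if "x \<in> K" for x
    proof -
      have "\<bar>f x - clamp (g x)\<bar> \<le> \<bar>f x - g x\<bar>" using B(1)[OF that] B(2) by (auto simp: clamp_def)
      then show ?thesis using g(2)[OF that] qD[of x] by linarith
    qed
    show "\<bar>q (g x)\<bar> \<le> B + e" for x
    proof -
      have "\<bar>clamp (g x)\<bar> \<le> B" using B(2) by (auto simp: clamp_def)
      then show ?thesis using qD[of x] e by linarith
    qed
  qed
qed

lemma (in prob_space) abs_expectation_le_split:
  fixes u :: "'a \<Rightarrow> real"
  assumes u: "u \<in> borel_measurable M" and A: "A \<in> events" and "0 \<le> e" "0 \<le> D"
    and le: "\<And>\<omega>. \<omega> \<in> space M \<Longrightarrow> \<omega> \<notin> A \<Longrightarrow> \<bar>u \<omega>\<bar> \<le> e" "\<And>\<omega>. \<omega> \<in> space M \<Longrightarrow> \<bar>u \<omega>\<bar> \<le> D"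
  shows "\<bar>expectation u\<bar> \<le> e + D * prob A"
proof -
  have int: "integrable M u" using u le(2) by (intro integrable_const_bound[of _ D]) auto
  have "\<bar>expectation u\<bar> \<le> expectation (\<lambda>\<omega>. \<bar>u \<omega>\<bar>)" by (rule integral_abs_bound)
  also have "\<dots> \<le> expectation (\<lambda>\<omega>. e + D * indicator A \<omega>)"
  proof (rule integral_mono)
    show "\<bar>u \<omega>\<bar> \<le> e + D * indicator A \<omega>" if "\<omega> \<in> space M" for \<omega>
      using le[OF that] assms(3,4) by (cases "\<omega> \<in> A") (auto simp: add.commute intro: add_increasing)
  qed (use int A in \<open>auto simp: emeasure_eq_measure\<close>)
  also have "\<dots> = e + D * prob A" using A by (simp add: prob_space emeasure_eq_measure)
  finally show ?thesis .
qed

lemma uniformly_tightE: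
  assumes "uniformly_tight M X" "0 < e"
  obtains K where "compact K" "\<And>i. measure M {\<omega>\<in>space M. X i \<omega> \<notin> K} \<le> e"
  using assms unfolding uniformly_tight_def by blast

lemma measurable_notin_compact:
  fixes X :: "'w \<Rightarrow> 'h::t2_space"
  assumes "X \<in> borel_measurable M" "compact K"
  shows "{\<omega>\<in>space M. X \<omega> \<notin> K} \<in> sets M"
proof -
  have "{\<omega>\<in>space M. X \<omega> \<notin> K} = X -` (- K) \<inter> space M" by auto
  also have "\<dots> \<in> sets M" using assms by (intro measurable_sets[OF assms(1)] borel_open) (auto intro: compact_imp_closed)
  finally show ?thesis .
qed

lemma borel_measurable_continuous_compose:
  assumes "continuous_on UNIV f" "X \<in> borel_measurable M"
  shows "(\<lambda>\<omega>. f (X \<omega>)) \<in> borel_measurable M"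
  using measurable_compose[OF assms(2) borel_measurable_continuous_onI[OF assms(1)]] .

lemma (in prob_space) integrable_bounded_continuous:
  fixes f :: "'h::topological_space \<Rightarrow> real"
  assumes "continuous_on UNIV f" "X \<in> borel_measurable M" "\<And>x. \<bar>f x\<bar> \<le> B"
  shows "integrable M (\<lambda>\<omega>. f (X \<omega>))"
  using borel_measurable_continuous_compose[OF assms(1,2)] assms(3)
  by (intro integrable_const_bound[of _ B]) simp_all

text \<open>The test function is replaced by a trigonometric polynomial close to it on a compact
  set. Off that set the global bound \<open>B + e\<close> on the approximant counts: the difference
  is at most \<open>2 * B + e\<close> there, on an event of probability at most
  \<open>e\<close>.\<close>

theorem weak_convergence_trigI:
  fixes X :: "nat \<Rightarrow> 'w \<Rightarrow> 'h::real_inner" and Y :: "'v \<Rightarrow> 'h"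
  assumes M: "prob_space M" and N: "prob_space N"
    and X: "\<And>n. X n \<in> borel_measurable M" and Y: "Y \<in> borel_measurable N"
    and tX: "uniformly_tight M X" and tY: "uniformly_tight N (\<lambda>_::unit. Y)"
    and conv: "\<And>h a. (\<lambda>n. \<integral>\<omega>. cos (X n \<omega> \<bullet> h + a) \<partial>M) \<longlonglongrightarrow> (\<integral>\<omega>. cos (Y \<omega> \<bullet> h + a) \<partial>N)"
    and f: "continuous_on UNIV f" "bounded (range (f :: 'h \<Rightarrow> real))"
  shows "(\<lambda>n. \<integral>\<omega>. f (X n \<omega>) \<partial>M) \<longlonglongrightarrow> (\<integral>\<omega>. f (Y \<omega>) \<partial>N)"
proof (rule LIMSEQ_I)
  fix r :: real assume r: "0 < r"
  interpret M: prob_space M by fact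
  interpret N: prob_space N by fact
  obtain B where B: "\<And>x. \<bar>f x\<bar> \<le> B" using f(2) by (auto simp: bounded_iff)
  have B0: "0 \<le> B" using B[of 0] by linarith
  have trig_int: "integrable M (\<lambda>\<omega>. g (X n \<omega>))" "integrable N (\<lambda>\<omega>. g (Y \<omega>))"
    if g: "g \<in> trig_functions" for g n
  proof -
    obtain D where D: "\<And>x. \<bar>g x\<bar> \<le> D" using trig_functions_bounded[OF g] by blast
    show "integrable M (\<lambda>\<omega>. g (X n \<omega>))" "integrable N (\<lambda>\<omega>. g (Y \<omega>))"
      using M.integrable_bounded_continuous[OF trig_functions_continuous[OF g] X D]
        N.integrable_bounded_continuous[OF trig_functions_continuous[OF g] Y D] .
  qed
  have trig: "(\<lambda>n. \<integral>\<omega>. g (X n \<omega>) \<partial>M) \<longlonglongrightarrow> (\<integral>\<omega>. g (Y \<omega>) \<partial>N)" if "g \<in> trig_functions" for g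
    using that
  proof induction
    case (cos c h a)
    show ?case by (simp del: cos_add) (intro tendsto_mult_left conv)
  next
    case (add g k)
    then show ?case using trig_int by (simp add: tendsto_add)
  qed
  \<comment> \<open>Chosen for \<open>e + (2 * B + e) * e \<le> e * (2 * B + 2) \<le> r / 4\<close>;
    the cap 1 linearizes the quadratic term. Approximation under each of the two laws and
    convergence for the approximant cost \<open>r / 4\<close> each.\<close>
  define e where "e = min 1 (r / (4 * (2 * B + 2)))"
  have "e \<le> r / (4 * (2 * B + 2))" by (simp add: e_def)
  then have e: "e * (4 * (2 * B + 2)) \<le> r" using B0 by (simp add: pos_le_divide_eq)
  have "0 < r / (4 * (2 * B + 2))" using r B0 by (intro divide_pos_pos) auto
  with e have e: "0 < e" "e \<le> 1" "e * (4 * (2 * B + 2)) \<le> r" by (simp_all add: e_def)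
  obtain K1 where K1: "compact K1" "\<And>n. M.prob {\<omega>\<in>space M. X n \<omega> \<notin> K1} \<le> e"
    using uniformly_tightE[OF tX e(1)] by blast
  obtain K2 where K2: "compact K2" "N.prob {\<omega>\<in>space N. Y \<omega> \<notin> K2} \<le> e"
    using uniformly_tightE[OF tY e(1)] by blast
  define K where "K = K1 \<union> K2"
  have K: "compact K" unfolding K_def using K1 K2 by (intro compact_Un)
  obtain g where g: "g \<in> trig_functions" "\<And>x. x \<in> K \<Longrightarrow> \<bar>f x - g x\<bar> \<le> e" "\<And>x. \<bar>g x\<bar> \<le> B + e"
    using trig_functions_approx[OF K continuous_on_subset[OF f(1) subset_UNIV] B B0 e(1)] by blast
  have diff: "\<bar>f x - g x\<bar> \<le> 2 * B + e" for x using B[of x] g(3)[of x] by linarith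
  have cfg: "continuous_on UNIV (\<lambda>x. f x - g x)"
    by (intro continuous_intros f trig_functions_continuous g)
  have close: "e + (2 * B + e) * e \<le> r / 4"
  proof -
    have "e + (2 * B + e) * e \<le> e + (2 * B + 1) * e" using e B0 by (intro add_left_mono mult_right_mono) auto
    then show ?thesis using e(3) by (simp add: algebra_simps)
  qed
  have MX: "\<bar>(\<integral>\<omega>. f (X n \<omega>) \<partial>M) - (\<integral>\<omega>. g (X n \<omega>) \<partial>M)\<bar> \<le> r / 4" for n
  proof -
    have "integrable M (\<lambda>\<omega>. f (X n \<omega>))"
      by (rule M.integrable_bounded_continuous[OF f(1) X B])
    then have "(\<integral>\<omega>. f (X n \<omega>) \<partial>M) - (\<integral>\<omega>. g (X n \<omega>) \<partial>M) = (\<integral>\<omega>. f (X n \<omega>) - g (X n \<omega>) \<partial>M)"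
      using trig_int[OF g(1)] by simp
    also have "\<bar>\<dots>\<bar> \<le> e + (2 * B + e) * M.prob {\<omega>\<in>space M. X n \<omega> \<notin> K1}"
      using K1(1) e B0 g(2) diff
      by (intro M.abs_expectation_le_split measurable_notin_compact X borel_measurable_continuous_compose[OF cfg])
        (auto simp: K_def)
    also have "\<dots> \<le> e + (2 * B + e) * e" using e B0 K1 by (intro add_left_mono mult_left_mono) auto
    finally show ?thesis using close by linarith
  qed
  have NY: "\<bar>(\<integral>\<omega>. f (Y \<omega>) \<partial>N) - (\<integral>\<omega>. g (Y \<omega>) \<partial>N)\<bar> \<le> r / 4"
  proof -
    have "integrable N (\<lambda>\<omega>. f (Y \<omega>))"
      by (rule N.integrable_bounded_continuous[OF f(1) Y B])
    then have "(\<integral>\<omega>. f (Y \<omega>) \<partial>N) - (\<integral>\<omega>. g (Y \<omega>) \<partial>N) = (\<integral>\<omega>. f (Y \<omega>) - g (Y \<omega>) \<partial>N)"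
      using trig_int[OF g(1)] by simp
    also have "\<bar>\<dots>\<bar> \<le> e + (2 * B + e) * N.prob {\<omega>\<in>space N. Y \<omega> \<notin> K2}"
      using K2(1) e B0 g(2) diff
      by (intro N.abs_expectation_le_split measurable_notin_compact Y borel_measurable_continuous_compose[OF cfg])
        (auto simp: K_def)
    also have "\<dots> \<le> e + (2 * B + e) * e" using e B0 K2 by (intro add_left_mono mult_left_mono) auto
    finally show ?thesis using close by linarith
  qed
  obtain n0 where n0: "\<And>n. n0 \<le> n \<Longrightarrow> \<bar>(\<integral>\<omega>. g (X n \<omega>) \<partial>M) - (\<integral>\<omega>. g (Y \<omega>) \<partial>N)\<bar> < r / 4"
    using LIMSEQ_D[OF trig[OF g(1)], of "r / 4"] r by auto
  have "norm ((\<integral>\<omega>. f (X n \<omega>) \<partial>M) - (\<integral>\<omega>. f (Y \<omega>) \<partial>N)) < r" if "n0 \<le> n" for n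
    using MX[of n] NY n0[OF that] r unfolding real_norm_def by linarith
  then show "\<exists>no. \<forall>n\<ge>no. norm ((\<integral>\<omega>. f (X n \<omega>) \<partial>M) - (\<integral>\<omega>. f (Y \<omega>) \<partial>N)) < r" by blast
qed

text \<open>A continuous mapping theorem for maps that vary with the index. The common Lipschitz
  bound upgrades pointwise convergence to uniform closeness of \<open>f (Q n y)\<close> and
  \<open>f (P y)\<close> on compact sets, and tightness discards the rest. Stated for the
  difference, it leaves the fixed map \<open>P\<close> to ordinary weak convergence.\<close>

theorem weak_convergence_lipschitz_maps:
  fixes X :: "nat \<Rightarrow> 'w \<Rightarrow> 'h::real_normed_vector" and Q :: "nat \<Rightarrow> 'h \<Rightarrow> 'h"
  assumes M: "prob_space M" and X: "\<And>n. X n \<in> borel_measurable M" and tX: "uniformly_tight M X"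
    and Q: "\<And>n x y. norm (Q n x - Q n y) \<le> norm (x - y)" and lim: "\<And>x. (\<lambda>n. Q n x) \<longlonglongrightarrow> P x"
    and f: "continuous_on UNIV f" "bounded (range (f :: 'h \<Rightarrow> real))"
  shows "(\<lambda>n. (\<integral>\<omega>. f (Q n (X n \<omega>)) \<partial>M) - (\<integral>\<omega>. f (P (X n \<omega>)) \<partial>M)) \<longlonglongrightarrow> 0"
proof (rule LIMSEQ_I)
  fix r :: real assume r: "0 < r"
  interpret prob_space M by fact
  obtain B where B: "\<And>x. \<bar>f x\<bar> \<le> B" using f(2) by (auto simp: bounded_iff)
  have B0: "0 \<le> B" using B[of 0] by linarith
  have P: "norm (P x - P y) \<le> norm (x - y)" for x y
    by (rule LIMSEQ_le_const2[of "\<lambda>n. norm (Q n x - Q n y)"]) (auto intro!: tendsto_intros lim Q)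
  have cont: "continuous_on UNIV g" if "\<And>x y. norm (g x - g y) \<le> norm (x - y)" for g :: "'h \<Rightarrow> 'h"
    unfolding continuous_on_iff dist_norm
  proof (intro ballI allI impI)
    fix x and s :: real assume "0 < s"
    then show "\<exists>d>0. \<forall>y\<in>UNIV. norm (y - x) < d \<longrightarrow> norm (g y - g x) < s"
      using that by (intro exI[of _ s]) (auto intro: le_less_trans)
  qed
  note cQ = cont[OF Q] and cP = cont[OF P]
  \<comment> \<open>This gives \<open>e + 2 * B * e = r / 2\<close>: the error on the compact set
    plus the trivial bound \<open>2 * B\<close> times the exceptional mass.\<close>
  define e where "e = r / (2 + 4 * B)"
  have e: "0 < e" "e * (2 + 4 * B) \<le> r" using r B0 by (auto simp: e_def)
  obtain K where K: "compact K" "\<And>n. prob {\<omega>\<in>space M. X n \<omega> \<notin> K} \<le> e"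
    using uniformly_tightE[OF tX e(1)] by blast
  \<comment> \<open>For \<open>y\<close> near \<open>x\<close> and large \<open>n\<close>, both
    \<open>Q n y\<close> and \<open>P y\<close> are close to \<open>P x\<close>, so continuity of
    \<open>f\<close> at this one point suffices; finitely many such balls cover
    \<open>K\<close>.\<close>
  have "\<exists>d>0. \<exists>m. \<forall>n\<ge>m. \<forall>y. norm (y - x) < d \<longrightarrow> \<bar>f (Q n y) - f (P y)\<bar> \<le> e" for x
  proof -
    have "isCont f (P x)" using f(1) by (simp add: continuous_on_eq_continuous_at)
    then obtain s where s: "0 < s" "\<And>z. norm (z - P x) < s \<Longrightarrow> \<bar>f z - f (P x)\<bar> < e / 2"
      using e(1) unfolding continuous_at_eps_delta dist_norm real_norm_def by (metis half_gt_zero)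
    obtain m where m: "\<And>n. m \<le> n \<Longrightarrow> norm (Q n x - P x) < s / 2"
      using LIMSEQ_D[OF lim[of x], of "s / 2"] s(1) by auto
    have "\<bar>f (Q n y) - f (P y)\<bar> \<le> e" if "m \<le> n" "norm (y - x) < s / 2" for n y
    proof -
      have "norm (Q n y - P x) < s"
        using norm_triangle_ineq[of "Q n y - Q n x" "Q n x - P x"] Q[of n y x] m[OF that(1)] that(2) by simp
      moreover have "norm (P y - P x) < s" using P[of y x] that(2) s(1) by simp
      ultimately show ?thesis using s(2)[of "Q n y"] s(2)[of "P y"] by linarith
    qed
    then show ?thesis using s(1) half_gt_zero by blast
  qed
  then obtain d m where dm: "\<And>x. 0 < d x"
    "\<And>x n y. m x \<le> n \<Longrightarrow> norm (y - x) < d x \<Longrightarrow> \<bar>f (Q n y) - f (P y)\<bar> \<le> e" by metis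
  have "K \<subseteq> (\<Union>x\<in>K. ball x (d x))" using dm(1) by (auto intro: centre_in_ball[THEN iffD2])
  then obtain C where C: "C \<subseteq> K" "finite C" "K \<subseteq> (\<Union>x\<in>C. ball x (d x))"
    using compactE_image[OF K(1), of K "\<lambda>x. ball x (d x)"] open_ball by metis
  obtain m' where m': "\<And>x. x \<in> C \<Longrightarrow> m x \<le> m'"
    using C(2) finite_nat_set_iff_bounded_le[of "m ` C"] by auto
  have unif: "\<bar>f (Q n y) - f (P y)\<bar> \<le> e" if n: "m' \<le> n" and y: "y \<in> K" for n y
  proof -
    obtain x where x: "x \<in> C" "dist x y < d x" using C(3) y by auto
    show ?thesis using dm(2)[of x n y] m'[OF x(1)] n x(2) by (simp add: dist_norm norm_minus_commute)
  qed
  have fQ: "continuous_on UNIV (\<lambda>x. f (Q n x))" for n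
    using continuous_on_compose2[OF f(1) cQ] by simp
  have fP: "continuous_on UNIV (\<lambda>x. f (P x))"
    using continuous_on_compose2[OF f(1) cP] by simp
  have "norm (((\<integral>\<omega>. f (Q n (X n \<omega>)) \<partial>M) - (\<integral>\<omega>. f (P (X n \<omega>)) \<partial>M)) - 0) < r" if "m' \<le> n" for n
  proof -
    have "integrable M (\<lambda>\<omega>. f (Q n (X n \<omega>)))" "integrable M (\<lambda>\<omega>. f (P (X n \<omega>)))"
      using integrable_bounded_continuous[OF fQ X B] integrable_bounded_continuous[OF fP X B] .
    then have "(\<integral>\<omega>. f (Q n (X n \<omega>)) \<partial>M) - (\<integral>\<omega>. f (P (X n \<omega>)) \<partial>M) = (\<integral>\<omega>. f (Q n (X n \<omega>)) - f (P (X n \<omega>)) \<partial>M)"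
      by simp
    also have "\<bar>\<dots>\<bar> \<le> e + (2 * B) * prob {\<omega>\<in>space M. X n \<omega> \<notin> K}"
    proof (intro abs_expectation_le_split measurable_notin_compact X K)
      show "(\<lambda>\<omega>. f (Q n (X n \<omega>)) - f (P (X n \<omega>))) \<in> borel_measurable M"
        using borel_measurable_continuous_compose[OF fQ X] borel_measurable_continuous_compose[OF fP X] by simp
      show "\<bar>f (Q n (X n \<omega>)) - f (P (X n \<omega>))\<bar> \<le> 2 * B" for \<omega>
        using B[of "Q n (X n \<omega>)"] B[of "P (X n \<omega>)"] by linarith
    qed (use e B0 unif[OF that] in auto)
    also have "\<dots> \<le> e + (2 * B) * e" using B0 K by (intro add_left_mono mult_left_mono) auto
    also have "\<dots> \<le> r / 2" using e(2) by (simp add: algebra_simps)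
    also have "\<dots> < r" using r by simp
    finally show ?thesis by simp
  qed
  then show "\<exists>no. \<forall>n\<ge>no. norm (((\<integral>\<omega>. f (Q n (X n \<omega>)) \<partial>M) - (\<integral>\<omega>. f (P (X n \<omega>)) \<partial>M)) - 0) < r" by blast
qed

section \<open>Gaussian variables\<close>

lemma distributed_std_normal: "distributed std_normal_distribution lborel (\<lambda>z. z) (\<lambda>z. ennreal (std_normal_density z))"
  unfolding distributed_def
  by (auto simp: distr_id2 sets_eq_imp_space_eq)

lemma distributed_normal_expectation:
  fixes g :: "real \<Rightarrow> real"
  assumes "distributed N lborel U (normal_density \<mu> \<sigma>)" "0 < \<sigma>" "g \<in> borel_measurable borel"
  shows "(\<integral>\<omega>. g (U \<omega>) \<partial>N) = (\<integral>z. g (\<mu> + \<sigma> * z) \<partial>std_normal_distribution)"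
proof -
  interpret prob_space std_normal_distribution by (rule prob_space_normal_density) simp
  have std: "distributed std_normal_distribution lborel (\<lambda>z. \<mu> + \<sigma> * z) (normal_density \<mu> \<sigma>)"
    using normal_density_affine[OF distributed_std_normal, of \<sigma> \<mu>] assms(2) by simp
  show ?thesis
    using distributed_integral[OF assms(1), of g] distributed_integral[OF std, of g] assms(3) by simp
qed

text \<open>A centred normal variable of variance \<open>v\<close> and the point mass at 0 both have
  the law of \<open>sqrt v\<close> times a standard normal one. The limit in the central limit
  theorem below has the same form, so the two can be compared without distinguishing cases.\<close>

lemma gaussian_variable_moments:
  assumes N: "prob_space N" and U: "gaussian_variable N U"
    and mean: "(\<integral>\<omega>. U \<omega> \<partial>N) = 0" and var: "(\<integral>\<omega>. U \<omega> * U \<omega> \<partial>N) = v"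
  shows "integrable N (\<lambda>\<omega>. (U \<omega>)\<^sup>2)"
    and "g \<in> borel_measurable borel \<Longrightarrow>
      (\<integral>\<omega>. g (U \<omega>) \<partial>N) = (\<integral>z. g (sqrt v * z) \<partial>std_normal_distribution :: real)"
proof -
  interpret prob_space N by fact
  have Um [measurable]: "U \<in> borel_measurable N" using U by (simp add: gaussian_variable_def)
  consider (normal) \<mu> \<sigma> where "0 < \<sigma>" "distributed N lborel U (normal_density \<mu> \<sigma>)"
    | (const) \<mu> where "AE \<omega> in N. U \<omega> = \<mu>"
    using U by (auto simp: gaussian_variable_def)
  then have "integrable N (\<lambda>\<omega>. (U \<omega>)\<^sup>2) \<and> (g \<in> borel_measurable borel \<longrightarrow>
      (\<integral>\<omega>. g (U \<omega>) \<partial>N) = (\<integral>z. g (sqrt v * z) \<partial>std_normal_distribution :: real))"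
  proof cases
    case normal
    have "\<mu> = 0"
      using distributed_integral[OF normal(2), of "\<lambda>x. x"] integral_normal_moment_nz_1[OF normal(1), of \<mu>] mean by simp
    have "integrable lborel (\<lambda>x. normal_density \<mu> \<sigma> x * x\<^sup>2)"
      using integrable_normal_moment[OF normal(1), of \<mu> 2] \<open>\<mu> = 0\<close> by simp
    then have "integrable N (\<lambda>\<omega>. (U \<omega>)\<^sup>2)"
      using distributed_integrable[OF normal(2), of "\<lambda>x. x\<^sup>2"] by simp
    moreover have "v = \<sigma>\<^sup>2"
      using distributed_integral[OF normal(2), of "\<lambda>x. x\<^sup>2"] integral_normal_moment_even[OF normal(1), of \<mu> 1]
        var \<open>\<mu> = 0\<close> by (simp add: power2_eq_square)
    ultimately show ?thesis
      using distributed_normal_expectation[OF normal(2,1), of g] normal(1) \<open>\<mu> = 0\<close> by simp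
  next
    case const
    have "(\<integral>\<omega>. U \<omega> \<partial>N) = (\<integral>\<omega>. \<mu> \<partial>N)" using const by (intro integral_cong_AE) auto
    then have \<mu>: "\<mu> = 0" using mean by (simp add: prob_space)
    have "integrable N (\<lambda>\<omega>. (U \<omega>)\<^sup>2)"
      by (subst integrable_cong_AE[where g = "\<lambda>_. 0"]) (use const \<mu> in auto)
    moreover have "(\<integral>\<omega>. U \<omega> * U \<omega> \<partial>N) = (\<integral>\<omega>. 0 \<partial>N)" using const \<mu> by (intro integral_cong_AE) auto
    then have "v = 0" using var by simp
    moreover have "(\<integral>\<omega>. g (U \<omega>) \<partial>N) = (\<integral>z. g 0 \<partial>std_normal_distribution)" if [measurable]: "g \<in> borel_measurable borel"
    proof -
      interpret S: prob_space std_normal_distribution by (rule prob_space_normal_density) simp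
      have "(\<integral>\<omega>. g (U \<omega>) \<partial>N) = (\<integral>\<omega>. g 0 \<partial>N)" using const \<mu> by (intro integral_cong_AE) auto
      then show ?thesis by (simp add: prob_space S.prob_space[simplified])
    qed
    ultimately show ?thesis by simp
  qed
  then show "integrable N (\<lambda>\<omega>. (U \<omega>)\<^sup>2)"
    and "g \<in> borel_measurable borel \<Longrightarrow>
      (\<integral>\<omega>. g (U \<omega>) \<partial>N) = (\<integral>z. g (sqrt v * z) \<partial>std_normal_distribution :: real)" by auto
qed

section \<open>Sums of independent variables\<close>

lemma (in prob_space) square_sum_indep_vars:
  fixes X :: "'i \<Rightarrow> 'a \<Rightarrow> real"
  assumes "finite I" "indep_vars (\<lambda>_. borel) X I"
    and "\<And>i. i \<in> I \<Longrightarrow> integrable M (\<lambda>\<omega>. (X i \<omega>)\<^sup>2)" "\<And>i. i \<in> I \<Longrightarrow> expectation (X i) = 0"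
  shows "integrable M (\<lambda>\<omega>. (\<Sum>i\<in>I. X i \<omega>)\<^sup>2) \<and>
    expectation (\<lambda>\<omega>. (\<Sum>i\<in>I. X i \<omega>)\<^sup>2) = (\<Sum>i\<in>I. expectation (\<lambda>\<omega>. (X i \<omega>)\<^sup>2))"
  using assms
proof (induction I rule: finite_induct)
  case (insert i I)
  have X: "X j \<in> borel_measurable M" if "j \<in> insert i I" for j
    using insert.prems(1) that by (auto simp: indep_vars_def)
  have int: "integrable M (X j)" if "j \<in> insert i I" for j
    using X[OF that] insert.prems(2)[OF that] by (rule square_integrable_imp_integrable)
  define S where "S \<omega> = (\<Sum>i\<in>I. X i \<omega>)" for \<omega>
  have IH: "integrable M (\<lambda>\<omega>. (S \<omega>)\<^sup>2)" "expectation (\<lambda>\<omega>. (S \<omega>)\<^sup>2) = (\<Sum>i\<in>I. expectation (\<lambda>\<omega>. (X i \<omega>)\<^sup>2))"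
    using insert.IH indep_vars_subset[OF insert.prems(1)] insert.prems unfolding S_def by auto
  have S: "integrable M S" "expectation S = 0"
    unfolding S_def using int insert.prems(3) by (auto simp: Bochner_Integration.integral_sum)
  have "indep_var borel (X i) borel S"
    unfolding S_def by (rule indep_vars_sum[OF insert.hyps insert.prems(1)])
  then have XS: "integrable M (\<lambda>\<omega>. X i \<omega> * S \<omega>)" "expectation (\<lambda>\<omega>. X i \<omega> * S \<omega>) = 0"
    using int[of i] S by (auto simp: indep_var_integrable indep_var_lebesgue_integral)
  have eq: "(\<Sum>j\<in>insert i I. X j \<omega>)\<^sup>2 = (X i \<omega>)\<^sup>2 + (S \<omega>)\<^sup>2 + 2 * (X i \<omega> * S \<omega>)" for \<omega>
    using insert.hyps by (simp add: S_def power2_sum algebra_simps)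
  show ?case
    unfolding eq using insert.hyps insert.prems(2)[of i] IH XS by simp
qed simp

text \<open>The sample is indexed from 1, the central limit theorem from 0. A finite index set
  \<open>J\<close> is transported to its image under \<open>Suc\<close>, with \<open>k - 1\<close>
  undoing the shift on the events.\<close>

lemma (in prob_space) indep_vars_Suc:
  assumes "indep_vars M' Z {1..}"
  shows "indep_vars (\<lambda>i. M' (Suc i)) (\<lambda>i. Z (Suc i)) UNIV"
  unfolding indep_vars_def2 indep_sets_def
proof (intro conjI ballI allI impI)
  have rv: "random_variable (M' (Suc i)) (Z (Suc i))" for i using assms by (simp add: indep_vars_def2)
  then show "random_variable (M' (Suc i)) (Z (Suc i))" for i .
  show "{Z (Suc i) -` A \<inter> space M |A. A \<in> sets (M' (Suc i))} \<subseteq> events" for i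
    using rv by auto
  fix J and A :: "nat \<Rightarrow> 'a set"
  assume J: "J \<subseteq> UNIV" "J \<noteq> {}" "finite J"
    and A: "A \<in> (\<Pi> i\<in>J. {Z (Suc i) -` A \<inter> space M |A. A \<in> sets (M' (Suc i))})"
  have "indep_sets (\<lambda>i. {Z i -` A \<inter> space M |A. A \<in> sets (M' i)}) {1..}"
    using assms by (simp add: indep_vars_def2)
  from indep_setsD[OF this, of "Suc ` J" "\<lambda>k. A (k - 1)"] J A
  have "prob (\<Inter>j\<in>Suc ` J. A (j - 1)) = (\<Prod>j\<in>Suc ` J. prob (A (j - 1)))" by (auto simp: Pi_iff)
  then show "prob (\<Inter> (A ` J)) = (\<Prod>j\<in>J. prob (A j))"
    by (simp add: prod.reindex image_image)
qed

section \<open>The empirical fluctuation\<close>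

lemma integrable_pmf_ell2: "integrable (measure_pmf p) (ell2_nth h)"
  by (rule measure_pmf.integrable_const_bound[of _ "norm h"]) (auto simp: abs_ell2_nth_le)

lemma integrable_pmf_ell2_mult: "integrable (measure_pmf p) (\<lambda>x. ell2_nth h x * ell2_nth k x)"
  by (rule measure_pmf.integrable_const_bound[of _ "norm h * norm k"])
    (auto simp: abs_mult intro!: mult_mono abs_ell2_nth_le)

lemma pmf_expectation_basis_mult:
  "measure_pmf.expectation p (\<lambda>x. ell2_nth (ell2_basis i) x * ell2_nth k x) = pmf p i * ell2_nth k i"
proof -
  have "measure_pmf.expectation p (\<lambda>x. ell2_nth (ell2_basis i) x * ell2_nth k x)
      = measure_pmf.expectation p (\<lambda>x. indicator {i} x * ell2_nth k i)"
    by (intro Bochner_Integration.integral_cong) (auto simp: ell2_basis.rep_eq indicator_def)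
  also have "\<dots> = measure (measure_pmf p) {i} * ell2_nth k i" by simp
  finally show ?thesis by (simp add: measure_pmf_single)
qed

lemma bounded_linear_pmf_expectation_mult:
  "bounded_linear (\<lambda>h. measure_pmf.expectation p (\<lambda>x. ell2_nth h x * ell2_nth k x))"
proof (rule bounded_linear_intro[of _ "norm k"])
  fix h :: "'a ell2"
  have "\<bar>measure_pmf.expectation p (\<lambda>x. ell2_nth h x * ell2_nth k x)\<bar>
      \<le> measure_pmf.expectation p (\<lambda>x. \<bar>ell2_nth h x * ell2_nth k x\<bar>)" by (rule integral_abs_bound)
  also have "\<dots> \<le> measure_pmf.expectation p (\<lambda>x. norm h * norm k)"
    using integrable_abs[OF integrable_pmf_ell2_mult[of p h k]]
    by (intro integral_mono) (simp_all add: abs_mult mult_mono abs_ell2_nth_le)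
  finally show "norm (measure_pmf.expectation p (\<lambda>x. ell2_nth h x * ell2_nth k x)) \<le> norm h * norm k" by simp
qed (simp_all add: ell2_nth_simps distrib_right integrable_pmf_ell2_mult mult.assoc)

text \<open>Both sides are bounded linear in \<open>h\<close> and agree on basis vectors. The right
  side is the mean of \<open>h\<close> at a random point with law \<open>p\<close>, so subtracting
  \<open>ell2_of_pmf p \<bullet> h\<close> centres the sample terms.\<close>

lemma inner_ell2_of_pmf: "ell2_of_pmf p \<bullet> h = measure_pmf.expectation p (ell2_nth h)"
proof -
  have "(\<lambda>h. ell2_of_pmf p \<bullet> h) = (\<lambda>h. measure_pmf.expectation p (ell2_nth h))"
  proof (rule bounded_linear_eq_on_ell2_basis)
    show "bounded_linear (\<lambda>h. measure_pmf.expectation p (ell2_nth h))"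
    proof (rule bounded_linear_intro[of _ 1])
      fix h :: "'a ell2"
      have "\<bar>measure_pmf.expectation p (ell2_nth h)\<bar> \<le> measure_pmf.expectation p (\<lambda>x. \<bar>ell2_nth h x\<bar>)"
        by (rule integral_abs_bound)
      also have "\<dots> \<le> measure_pmf.expectation p (\<lambda>x. norm h)"
        using integrable_pmf_ell2[of p h] by (intro integral_mono) (auto intro: abs_ell2_nth_le)
      finally show "norm (measure_pmf.expectation p (ell2_nth h)) \<le> norm h * 1" by simp
    qed (simp_all add: ell2_nth_simps integrable_pmf_ell2)
    fix i
    have "measure_pmf.expectation p (ell2_nth (ell2_basis i)) = measure_pmf.expectation p (indicator {i})"
      by (intro Bochner_Integration.integral_cong) (auto simp: ell2_basis.rep_eq indicator_def)
    then show "ell2_of_pmf p \<bullet> ell2_basis i = measure_pmf.expectation p (ell2_nth (ell2_basis i))"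
      by (simp add: inner_ell2_basis ell2_of_pmf.rep_eq measure_pmf_single)
  qed (rule bounded_linear_inner_right)
  then show ?thesis by (rule fun_cong)
qed

text \<open>The covariance of \<open>h\<close> and \<open>k\<close> evaluated at one random point
  with law \<open>p\<close>; it will be the bilinear form of \<open>C\<close>.\<close>

definition pmf_covariance :: "'a pmf \<Rightarrow> 'a ell2 \<Rightarrow> 'a ell2 \<Rightarrow> real" where
  "pmf_covariance p h k = measure_pmf.expectation p (\<lambda>x. ell2_nth h x * ell2_nth k x)
     - (ell2_of_pmf p \<bullet> h) * (ell2_of_pmf p \<bullet> k)"

text \<open>Each side is bounded linear in \<open>u\<close> and in \<open>v\<close> separately, so
  the values on pairs of basis vectors are extended in two passes, one per argument.\<close>

lemma covariance_operator_eq: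
  assumes C: "bounded_linear C"
    and basis: "\<And>i i'. C (ell2_basis i) \<bullet> ell2_basis i' =
           pmf p i * (if i = i' then 1 else 0) - pmf p i * pmf p i'"
  shows "C u \<bullet> v = pmf_covariance p u v"
proof -
  have row: "C (ell2_basis i) \<bullet> v = pmf p i * (v \<bullet> ell2_basis i) - pmf p i * (ell2_of_pmf p \<bullet> v)" for i v
  proof -
    have "(\<lambda>v. C (ell2_basis i) \<bullet> v) = (\<lambda>v. pmf p i * (v \<bullet> ell2_basis i) - pmf p i * (ell2_of_pmf p \<bullet> v))"
    proof (rule bounded_linear_eq_on_ell2_basis)
      show "C (ell2_basis i) \<bullet> ell2_basis j
          = pmf p i * (ell2_basis j \<bullet> ell2_basis i) - pmf p i * (ell2_of_pmf p \<bullet> ell2_basis j)" for j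
        unfolding basis by (simp add: inner_ell2_basis ell2_nth_simps)
    qed (intro bounded_linear_inner_right bounded_linear_sub bounded_linear_const_mult bounded_linear_inner_left)+
    then show ?thesis by (rule fun_cong)
  qed
  have "(\<lambda>u. C u \<bullet> v) = (\<lambda>u. pmf_covariance p u v)"
    unfolding pmf_covariance_def
  proof (rule bounded_linear_eq_on_ell2_basis)
    show "bounded_linear (\<lambda>u. C u \<bullet> v)"
      by (rule bounded_linear_compose[OF bounded_linear_inner_left C])
    show "bounded_linear (\<lambda>u. measure_pmf.expectation p (\<lambda>x. ell2_nth u x * ell2_nth v x)
        - ell2_of_pmf p \<bullet> u * (ell2_of_pmf p \<bullet> v))"
      by (intro bounded_linear_sub bounded_linear_pmf_expectation_mult bounded_linear_mult_const
          bounded_linear_inner_right)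
    show "C (ell2_basis i) \<bullet> v = measure_pmf.expectation p (\<lambda>x. ell2_nth (ell2_basis i) x * ell2_nth v x)
        - ell2_of_pmf p \<bullet> ell2_basis i * (ell2_of_pmf p \<bullet> v)" for i
      by (simp add: row pmf_expectation_basis_mult inner_ell2_basis ell2_of_pmf.rep_eq)
  qed
  then show ?thesis by (rule fun_cong)
qed

text \<open>The left side is the variance of the indicator of \<open>x\<close>, namely
  \<open>p x\<close> minus its square. The bound makes the second moments of the coordinates
  summable.\<close>

lemma pmf_covariance_basis_le: "pmf_covariance p (ell2_basis x) (ell2_basis x) \<le> pmf p x"
  unfolding pmf_covariance_def pmf_expectation_basis_mult inner_ell2_basis by (simp add: ell2_nth_simps)

lemma pmf_covariance_eq_variance:
  "pmf_covariance p h h = measure_pmf.expectation p (\<lambda>x. (ell2_nth h x - ell2_of_pmf p \<bullet> h)\<^sup>2)"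
proof -
  define m where "m = ell2_of_pmf p \<bullet> h"
  have "measure_pmf.expectation p (\<lambda>x. (ell2_nth h x - m)\<^sup>2)
      = measure_pmf.expectation p (\<lambda>x. ell2_nth h x * ell2_nth h x - 2 * m * ell2_nth h x + m * m)"
    by (intro Bochner_Integration.integral_cong) (auto simp: power2_eq_square algebra_simps)
  also have "\<dots> = measure_pmf.expectation p (\<lambda>x. ell2_nth h x * ell2_nth h x) - 2 * m * m + m * m"
    using integrable_pmf_ell2_mult[of p h h] integrable_pmf_ell2[of p h]
    by (simp add: inner_ell2_of_pmf[symmetric] m_def)
  finally show ?thesis by (simp add: pmf_covariance_def m_def)
qed

text \<open>\<open>empirical_pmf\<close> is a bare function; as an average of basis vectors it
  becomes an element of the Hilbert space, and its inner product with \<open>h\<close> is a sample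
  mean.\<close>

definition empirical_ell2 :: "(nat \<Rightarrow> 'w \<Rightarrow> 'a) \<Rightarrow> nat \<Rightarrow> 'w \<Rightarrow> 'a ell2" where
  "empirical_ell2 Z n \<omega> = (1 / real n) *\<^sub>R (\<Sum>j=1..n. ell2_basis (Z j \<omega>))"

lemma ell2_nth_empirical: "ell2_nth (empirical_ell2 Z n \<omega>) x = empirical_pmf Z n \<omega> x"
  by (auto simp: empirical_ell2_def empirical_pmf_def ell2_nth_simps of_bool_def intro!: sum.cong)

definition empirical_fluctuation :: "(nat \<Rightarrow> 'w \<Rightarrow> 'a) \<Rightarrow> 'a pmf \<Rightarrow> nat \<Rightarrow> 'w \<Rightarrow> 'a ell2" where
  "empirical_fluctuation Z p n \<omega> = sqrt (real n) *\<^sub>R (empirical_ell2 Z n \<omega> - ell2_of_pmf p)"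

lemma empirical_fluctuation_inner:
  "empirical_fluctuation Z p n \<omega> \<bullet> h = (\<Sum>i<n. ell2_nth h (Z (Suc i) \<omega>) - ell2_of_pmf p \<bullet> h) / sqrt (real n)"
proof (cases "n = 0")
  case False
  then have n: "sqrt (real n) / real n = 1 / sqrt (real n)" "real n / sqrt (real n) = sqrt (real n)"
    by (auto simp: real_div_sqrt field_simps)
  have "(\<Sum>j=1..n. ell2_basis (Z j \<omega>)) \<bullet> h = (\<Sum>j=1..n. ell2_nth h (Z j \<omega>))"
    by (simp add: inner_sum_left inner_commute[of "ell2_basis _"] inner_ell2_basis)
  also have "\<dots> = (\<Sum>i<n. ell2_nth h (Z (Suc i) \<omega>))"
    by (rule sum.reindex_bij_witness[of _ Suc "\<lambda>j. j - 1"]) auto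
  finally have "empirical_fluctuation Z p n \<omega> \<bullet> h
      = (sqrt (real n) / real n) * (\<Sum>i<n. ell2_nth h (Z (Suc i) \<omega>)) - sqrt (real n) * (ell2_of_pmf p \<bullet> h)"
    by (simp add: empirical_fluctuation_def empirical_ell2_def inner_diff_left right_diff_distrib)
  also have "\<dots> = (\<Sum>i<n. ell2_nth h (Z (Suc i) \<omega>)) / sqrt (real n) - (real n / sqrt (real n)) * (ell2_of_pmf p \<bullet> h)"
    unfolding n by simp
  finally show ?thesis by (simp add: sum_subtractf diff_divide_distrib)
qed (simp add: empirical_fluctuation_def)

section \<open>Tightness and limit law of the empirical fluctuation\<close>

locale iid_sample = prob_space M for M :: "'w measure" +
  fixes Z :: "nat \<Rightarrow> 'w \<Rightarrow> 'a::countable" and p :: "'a pmf"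
  assumes Z_indep: "indep_vars (\<lambda>_. count_space UNIV) Z {1..}"
    and Z_distr: "\<And>j. 1 \<le> j \<Longrightarrow> distr M (count_space UNIV) (Z j) = measure_pmf p"
begin

lemma measurable_Z: "1 \<le> j \<Longrightarrow> Z j \<in> measurable M (count_space UNIV)"
  using Z_indep by (simp add: indep_vars_def)

text \<open>The first \<open>n\<close> observations form a random list in a countable discrete
  space, on which every function is measurable; this yields measurability for the norm topology
  without adding measurable Hilbert space valued functions.\<close>

lemma measurable_empirical_ell2: "empirical_ell2 Z n \<in> borel_measurable M"
proof -
  define L where "L \<omega> = map (\<lambda>j. Z j \<omega>) [1..<Suc n]" for \<omega>
  have "L \<in> measurable M (count_space UNIV)"
  proof (subst measurable_count_space_eq2_countable, safe)
    fix l :: "'a list"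
    have "L \<omega> = l \<longleftrightarrow> length l = n \<and> (\<forall>i\<in>{..<n}. Z (Suc i) \<omega> = l ! i)" for \<omega>
      unfolding L_def list_eq_iff_nth_eq by (auto simp del: upt_Suc)
    then have "L -` {l} \<inter> space M = {\<omega>\<in>space M. length l = n \<and> (\<forall>i\<in>{..<n}. Z (Suc i) \<omega> = l ! i)}"
      by auto
    also have "\<dots> \<in> sets M"
    proof (intro sets.sets_Collect_conj sets.sets_Collect_const sets.sets_Collect_finite_All)
      fix i
      have "{\<omega>\<in>space M. Z (Suc i) \<omega> = l ! i} = Z (Suc i) -` {l ! i} \<inter> space M" by auto
      then show "{\<omega>\<in>space M. Z (Suc i) \<omega> = l ! i} \<in> sets M"
        using measurable_sets[OF measurable_Z[of "Suc i"], of "{l ! i}"] by simp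
    qed simp
    finally show "L -` {l} \<inter> space M \<in> sets M" .
  qed auto
  then have "(\<lambda>\<omega>. (1 / real n) *\<^sub>R (\<Sum>x\<leftarrow>L \<omega>. ell2_basis x)) \<in> borel_measurable M"
    by (rule measurable_compose) simp
  moreover have "(\<Sum>x\<leftarrow>L \<omega>. ell2_basis x) = (\<Sum>j=1..n. ell2_basis (Z j \<omega>))" for \<omega>
    by (simp add: L_def interv_sum_list_conv_sum_set_nat comp_def atLeastLessThanSuc_atLeastAtMost del: upt_Suc)
  ultimately show ?thesis by (simp add: empirical_ell2_def[abs_def])
qed

lemma measurable_empirical_fluctuation: "empirical_fluctuation Z p n \<in> borel_measurable M"
  unfolding empirical_fluctuation_def[abs_def]
  by (rule borel_measurable_continuous_compose[OF _ measurable_empirical_ell2]) (intro continuous_intros)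

context
  fixes h :: "'a ell2"
begin

private definition "\<xi> i \<omega> = ell2_nth h (Z (Suc i) \<omega>) - ell2_of_pmf p \<bullet> h"

private lemma \<xi>_expectation:
  fixes g :: "real \<Rightarrow> real"
  shows "expectation (\<lambda>\<omega>. g (\<xi> i \<omega>)) = measure_pmf.expectation p (\<lambda>x. g (ell2_nth h x - ell2_of_pmf p \<bullet> h))"
  unfolding \<xi>_def Z_distr[of "Suc i", simplified, symmetric]
  by (subst integral_distr) (auto intro: measurable_Z)

private lemma \<xi>_indep: "indep_vars (\<lambda>_. borel) \<xi> UNIV"
  unfolding \<xi>_def[abs_def] by (rule indep_vars_compose2[OF indep_vars_Suc[OF Z_indep]]) simp

private lemma \<xi>_measurable: "\<xi> i \<in> borel_measurable M"
  using \<xi>_indep by (simp add: indep_vars_def)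

private lemma \<xi>_square_integrable: "integrable M (\<lambda>\<omega>. (\<xi> i \<omega>)\<^sup>2)"
proof (rule integrable_const_bound[of _ "(norm h + \<bar>ell2_of_pmf p \<bullet> h\<bar>)\<^sup>2"])
  have "\<bar>\<xi> i \<omega>\<bar> \<le> norm h + \<bar>ell2_of_pmf p \<bullet> h\<bar>" for \<omega>
    using abs_ell2_nth_le[of h "Z (Suc i) \<omega>"] unfolding \<xi>_def by linarith
  then have "(\<xi> i \<omega>)\<^sup>2 \<le> (norm h + \<bar>ell2_of_pmf p \<bullet> h\<bar>)\<^sup>2" for \<omega>
    by (metis abs_ge_zero power2_abs power_mono)
  then show "AE \<omega> in M. norm ((\<xi> i \<omega>)\<^sup>2) \<le> (norm h + \<bar>ell2_of_pmf p \<bullet> h\<bar>)\<^sup>2" by simp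
qed (use \<xi>_measurable in measurable)

private lemma \<xi>_mean: "expectation (\<xi> i) = 0"
  using \<xi>_expectation[of "\<lambda>u. u" i] by (simp add: integrable_pmf_ell2 inner_ell2_of_pmf[symmetric])

private lemma \<xi>_square: "expectation (\<lambda>\<omega>. (\<xi> i \<omega>)\<^sup>2) = pmf_covariance p h h"
  using \<xi>_expectation[of power2 i] by (simp add: pmf_covariance_eq_variance)

text \<open>Variances of independent centred terms add up, so the second relation is an equality for
  positive \<open>n\<close>; the inequality also covers \<open>n = 0\<close>, where the fluctuation
  is 0.\<close>

lemma empirical_fluctuation_second_moment:
  "integrable M (\<lambda>\<omega>. (empirical_fluctuation Z p n \<omega> \<bullet> h)\<^sup>2)"
  "expectation (\<lambda>\<omega>. (empirical_fluctuation Z p n \<omega> \<bullet> h)\<^sup>2) \<le> pmf_covariance p h h"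
proof -
  have *: "integrable M (\<lambda>\<omega>. (\<Sum>i<n. \<xi> i \<omega>)\<^sup>2)"
    "expectation (\<lambda>\<omega>. (\<Sum>i<n. \<xi> i \<omega>)\<^sup>2) = (\<Sum>i<n. expectation (\<lambda>\<omega>. (\<xi> i \<omega>)\<^sup>2))"
    using square_sum_indep_vars[of "{..<n}" \<xi>] indep_vars_subset[OF \<xi>_indep] \<xi>_square_integrable \<xi>_mean
    by auto
  have eq: "(empirical_fluctuation Z p n \<omega> \<bullet> h)\<^sup>2 = (\<Sum>i<n. \<xi> i \<omega>)\<^sup>2 / n" for \<omega>
    by (simp add: empirical_fluctuation_inner \<xi>_def power_divide)
  show "integrable M (\<lambda>\<omega>. (empirical_fluctuation Z p n \<omega> \<bullet> h)\<^sup>2)" unfolding eq using *(1) by simp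
  have "0 \<le> pmf_covariance p h h" by (simp add: pmf_covariance_eq_variance)
  then show "expectation (\<lambda>\<omega>. (empirical_fluctuation Z p n \<omega> \<bullet> h)\<^sup>2) \<le> pmf_covariance p h h"
    unfolding eq by (simp add: *(2) \<xi>_square)
qed

text \<open>The real central limit theorem for the centred values \<open>\<xi> i\<close>. It
  normalizes to variance 1, so the test function is rescaled by \<open>sqrt v\<close>.\<close>

lemma empirical_fluctuation_clt:
  fixes g :: "real \<Rightarrow> real"
  assumes g: "continuous_on UNIV g" "\<And>u. \<bar>g u\<bar> \<le> B"
  shows "(\<lambda>n. expectation (\<lambda>\<omega>. g (empirical_fluctuation Z p n \<omega> \<bullet> h)))
    \<longlonglongrightarrow> (\<integral>z. g (sqrt (pmf_covariance p h h) * z) \<partial>std_normal_distribution)"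
proof -
  define v where "v = pmf_covariance p h h"
  have v0: "0 \<le> v" by (simp add: v_def pmf_covariance_eq_variance)
  have fl: "empirical_fluctuation Z p n \<omega> \<bullet> h = (\<Sum>i<n. \<xi> i \<omega>) / sqrt (real n)" for n \<omega>
    by (simp add: empirical_fluctuation_inner \<xi>_def)
  note [measurable] = \<xi>_measurable
  have [measurable]: "g \<in> borel_measurable borel" using g(1) by (rule borel_measurable_continuous_onI)
  interpret S: prob_space std_normal_distribution by (rule prob_space_normal_density) simp
  show ?thesis
  proof (cases "v = 0")
    \<comment> \<open>The normalization divides by \<open>sqrt v\<close>, so \<open>v = 0\<close> is
      treated apart: all \<open>\<xi> i\<close> then vanish almost surely.\<close>
    case True
    have "AE \<omega> in M. (\<xi> i \<omega>)\<^sup>2 = 0" for i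
      using integral_nonneg_eq_0_iff_AE[OF \<xi>_square_integrable[of i]] \<xi>_square[of i] True by (simp add: v_def)
    then have "AE \<omega> in M. \<forall>i. \<xi> i \<omega> = 0" by (simp add: AE_all_countable)
    then have "expectation (\<lambda>\<omega>. g (empirical_fluctuation Z p n \<omega> \<bullet> h)) = expectation (\<lambda>\<omega>. g 0)" for n
      unfolding fl by (intro integral_cong_AE) auto
    then show ?thesis using True by (simp add: v_def prob_space S.prob_space[simplified])
  next
    case False
    define \<mu> where "\<mu> n = distr M borel (\<lambda>\<omega>. (\<Sum>i<n. \<xi> i \<omega>) / sqrt (real n * (sqrt v)\<^sup>2))" for n
    have "weak_conv_m \<mu> std_normal_distribution"
      unfolding \<mu>_def
    proof (rule central_limit_theorem_zero_mean)
      show "variance (\<xi> i) = (sqrt v)\<^sup>2" for i using \<xi>_square[of i] \<xi>_mean[of i] v0 by (simp add: v_def)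
      show "distr M borel (\<xi> i) = distr (measure_pmf p) borel (\<lambda>x. ell2_nth h x - ell2_of_pmf p \<bullet> h)" for i
        unfolding Z_distr[of "Suc i", simplified, symmetric] \<xi>_def[abs_def]
        by (subst distr_distr) (auto intro: measurable_Z simp: comp_def)
    qed (use False v0 in \<open>auto intro: \<xi>_indep \<xi>_mean \<xi>_square_integrable\<close>)
    then have "(\<lambda>n. \<integral>x. g (sqrt v * x) \<partial>\<mu> n) \<longlonglongrightarrow> (\<integral>x. g (sqrt v * x) \<partial>std_normal_distribution)"
    proof (rule weak_conv_imp_integral_bdd_continuous_conv[where B = B, rotated 2])
      show "isCont (\<lambda>x. g (sqrt v * x)) x" for x
        using continuous_on_compose2[OF g(1), of UNIV "\<lambda>x. sqrt v * x"]
        by (simp add: continuous_on_eq_continuous_at continuous_intros)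
      show "real_distribution (\<mu> n)" for n unfolding \<mu>_def by (rule real_distribution_distr) measurable
    qed (auto simp: g(2) real_dist_normal_dist)
    moreover have "(\<integral>x. g (sqrt v * x) \<partial>\<mu> n) = expectation (\<lambda>\<omega>. g (empirical_fluctuation Z p n \<omega> \<bullet> h))" for n
      unfolding \<mu>_def fl using v0 False by (subst integral_distr) (auto simp: real_sqrt_mult)
    ultimately show ?thesis by (simp add: v_def)
  qed
qed

end

lemma empirical_fluctuation_tight: "uniformly_tight M (empirical_fluctuation Z p)"
proof (rule ell2_uniformly_tight[where p = p])
  show "expectation (\<lambda>\<omega>. (ell2_nth (empirical_fluctuation Z p n \<omega>) x)\<^sup>2) \<le> pmf p x" for n x
    using empirical_fluctuation_second_moment(2)[where h = "ell2_basis x" and n = n] pmf_covariance_basis_le[of p x]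
    by (simp add: inner_ell2_basis)
  show "integrable M (\<lambda>\<omega>. (ell2_nth (empirical_fluctuation Z p n \<omega>) x)\<^sup>2)" for n x
    using empirical_fluctuation_second_moment(1)[where h = "ell2_basis x" and n = n] by (simp add: inner_ell2_basis)
qed (auto intro: prob_space_axioms measurable_empirical_fluctuation)

text \<open>The cosine of one functional is a one-dimensional test function, so the real central
  limit theorem supplies what \<open>weak_convergence_trigI\<close> demands. Tightness of
  \<open>Y\<close> follows from the same coordinate bound as that of the sample.\<close>

theorem empirical_fluctuation_converges:
  fixes Y :: "'v \<Rightarrow> 'a ell2" and f :: "'a ell2 \<Rightarrow> real"
  assumes Y: "gaussian_process N Y 0 C" and C: "\<And>u v. C u \<bullet> v = pmf_covariance p u v"
    and f: "continuous_on UNIV f" "bounded (range f)"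
  shows "(\<lambda>n. expectation (\<lambda>\<omega>. f (empirical_fluctuation Z p n \<omega>))) \<longlonglongrightarrow> (\<integral>\<omega>. f (Y \<omega>) \<partial>N)"
proof -
  have N: "prob_space N" and Ym: "Y \<in> borel_measurable N"
    and gv: "gaussian_variable N (\<lambda>\<omega>. Y \<omega> \<bullet> h)" and mean: "(\<integral>\<omega>. Y \<omega> \<bullet> h \<partial>N) = 0"
    and cov: "(\<integral>\<omega>. (Y \<omega> \<bullet> h) * (Y \<omega> \<bullet> h) \<partial>N) = pmf_covariance p h h" for h
    using Y C by (simp_all add: gaussian_process_def)
  note moments = gaussian_variable_moments[OF N gv mean cov]
  show ?thesis
  proof (rule weak_convergence_trigI[OF prob_space_axioms N, where X = "empirical_fluctuation Z p" and Y = Y])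
    show "uniformly_tight N (\<lambda>_::unit. Y)"
    proof (rule ell2_uniformly_tight[OF N, where p = p])
      show "integrable N (\<lambda>\<omega>. (ell2_nth (Y \<omega>) x)\<^sup>2)" for x
        using moments(1)[of "ell2_basis x"] by (simp add: inner_ell2_basis)
      show "(\<integral>\<omega>. (ell2_nth (Y \<omega>) x)\<^sup>2 \<partial>N) \<le> pmf p x" for x
        using cov[of "ell2_basis x"] pmf_covariance_basis_le[of p x] by (simp add: inner_ell2_basis power2_eq_square)
    qed (rule Ym)
    fix h :: "'a ell2" and a :: real
    have "continuous_on UNIV (\<lambda>u. cos (u + a))" by (intro continuous_intros)
    moreover from this have "(\<lambda>u. cos (u + a)) \<in> borel_measurable borel" by (rule borel_measurable_continuous_onI)
    ultimately show "(\<lambda>n. expectation (\<lambda>\<omega>. cos (empirical_fluctuation Z p n \<omega> \<bullet> h + a)))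
        \<longlonglongrightarrow> (\<integral>\<omega>. cos (Y \<omega> \<bullet> h + a) \<partial>N)"
      using empirical_fluctuation_clt[of "\<lambda>u. cos (u + a)" 1 h] moments(2)[of "\<lambda>u. cos (u + a)" h] by simp
  qed (auto intro: measurable_empirical_fluctuation Ym empirical_fluctuation_tight f)
qed

end

section \<open>Existence of the Gaussian limit\<close>

text \<open>Levy's uniqueness theorem identifies the law of \<open>U\<close> with that of
  \<open>\<sigma>\<close> times a standard normal variable, from which the moments are read off. For
  \<open>\<sigma> = 0\<close> there is no density, and the vanishing second moment gives the point
  mass.\<close>

lemma gaussian_variable_charI:
  assumes N: "prob_space N" and U: "U \<in> borel_measurable N" and "0 \<le> \<sigma>"
    and char: "\<And>t. char (distr N borel U) t = complex_of_real (exp (- (t * \<sigma>)\<^sup>2 / 2))"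
  shows "gaussian_variable N U" "integrable N (\<lambda>\<omega>. (U \<omega>)\<^sup>2)" "(\<integral>\<omega>. U \<omega> \<partial>N) = 0" "(\<integral>\<omega>. (U \<omega>)\<^sup>2 \<partial>N) = \<sigma>\<^sup>2"
proof -
  interpret prob_space N by fact
  interpret S: prob_space std_normal_distribution by (rule prob_space_normal_density) simp
  note [measurable] = U
  have "char (distr std_normal_distribution borel (\<lambda>z. \<sigma> * z)) t = char std_normal_distribution (t * \<sigma>)" for t
    unfolding char_def by (subst integral_distr) (auto simp: mult.assoc)
  then have eq: "distr N borel U = distr std_normal_distribution borel (\<lambda>z. \<sigma> * z)"
    by (intro Levy_uniqueness real_distribution_distr S.real_distribution_distr)
      (auto simp: char char_std_normal_distribution fun_eq_iff)
  have "(\<integral>\<omega>. U \<omega> \<partial>N) = (\<integral>x. x \<partial>distr N borel U)" by (subst integral_distr) auto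
  also have "\<dots> = (\<integral>z. \<sigma> * z \<partial>std_normal_distribution)" unfolding eq by (subst integral_distr) auto
  finally show "(\<integral>\<omega>. U \<omega> \<partial>N) = 0"
    using integral_std_normal_distribution_moment_odd[of 1] by simp
  have "integrable (distr N borel U) (\<lambda>x. x\<^sup>2)"
    unfolding eq using integrable_std_normal_distribution_moment[of 2]
    by (subst integrable_distr_eq) (auto simp: power_mult_distrib)
  then show int: "integrable N (\<lambda>\<omega>. (U \<omega>)\<^sup>2)" by (subst (asm) integrable_distr_eq) auto
  have "(\<integral>\<omega>. (U \<omega>)\<^sup>2 \<partial>N) = (\<integral>x. x\<^sup>2 \<partial>distr N borel U)" by (subst integral_distr) auto
  also have "\<dots> = (\<integral>z. (\<sigma> * z)\<^sup>2 \<partial>std_normal_distribution)" unfolding eq by (subst integral_distr) auto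
  also have "\<dots> = \<sigma>\<^sup>2" using std_normal_distribution_even_moments[of 1] by (simp add: power_mult_distrib)
  finally show sq: "(\<integral>\<omega>. (U \<omega>)\<^sup>2 \<partial>N) = \<sigma>\<^sup>2" .
  show "gaussian_variable N U"
  proof (cases "\<sigma> = 0")
    case True
    then have "AE \<omega> in N. (U \<omega>)\<^sup>2 = 0" using integral_nonneg_eq_0_iff_AE[OF int] sq by simp
    then show ?thesis by (auto simp: gaussian_variable_def)
  next
    case False
    then have \<sigma>: "0 < \<sigma>" using \<open>0 \<le> \<sigma>\<close> by simp
    have "distributed std_normal_distribution lborel (\<lambda>z. 0 + \<sigma> * z) (normal_density 0 \<sigma>)"
      using S.normal_density_affine[OF distributed_std_normal, of \<sigma> 0] \<sigma> by simp
    then have "distr std_normal_distribution lborel (\<lambda>z. \<sigma> * z) = density lborel (normal_density 0 \<sigma>)"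
      by (simp add: distributed_def)
    moreover have "distr N lborel U = distr std_normal_distribution lborel (\<lambda>z. \<sigma> * z)"
      using eq distr_cong[OF refl sets_lborel, of N U U]
        distr_cong[OF refl sets_lborel, of std_normal_distribution "\<lambda>z. \<sigma> * z" "\<lambda>z. \<sigma> * z"] by simp
    ultimately have "distributed N lborel U (normal_density 0 \<sigma>)" by (simp add: distributed_def)
    then show ?thesis using \<sigma> by (auto simp: gaussian_variable_def)
  qed
qed

text \<open>The coordinates on a countable product. That its sigma-algebra is the Borel one of the
  product topology is recorded so that measurability of vector-valued partial sums can be deduced
  from continuity.\<close>

lemma iid_std_normal_sequence:
  defines "\<Omega> \<equiv> PiM (UNIV :: nat set) (\<lambda>_. std_normal_distribution)"
  shows "prob_space \<Omega>" "sets \<Omega> = sets borel"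
    "prob_space.indep_vars \<Omega> (\<lambda>_. borel) (\<lambda>k \<omega>. \<omega> k) UNIV"
    "distr \<Omega> borel (\<lambda>\<omega>. \<omega> k) = std_normal_distribution"
proof -
  interpret S: prob_space std_normal_distribution by (rule prob_space_normal_density) simp
  interpret product_prob_space "\<lambda>_. std_normal_distribution" "UNIV :: nat set"
    by unfold_locales
  interpret \<Omega>: prob_space \<Omega> unfolding \<Omega>_def by (rule prob_space_axioms)
  show "prob_space \<Omega>" by (rule \<Omega>.prob_space_axioms)
  show sets: "sets \<Omega> = sets borel"
    unfolding \<Omega>_def sets_PiM_equal_borel[symmetric] by (intro sets_PiM_cong) auto
  have comp: "distr \<Omega> borel (\<lambda>\<omega>. \<omega> k) = std_normal_distribution" for k
    using PiM_component[of k] distr_cong[of \<Omega> \<Omega> borel std_normal_distribution "\<lambda>\<omega>. \<omega> k" "\<lambda>\<omega>. \<omega> k"]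
    by (simp add: \<Omega>_def)
  then show "distr \<Omega> borel (\<lambda>\<omega>. \<omega> k) = std_normal_distribution" .
  have meas: "(\<lambda>\<omega>. \<omega> k) \<in> borel_measurable \<Omega>" for k
    unfolding measurable_cong_sets[OF sets refl]
    by (intro borel_measurable_continuous_onI continuous_on_product_coordinates)
  show "\<Omega>.indep_vars (\<lambda>_. borel) (\<lambda>k \<omega>. \<omega> k) UNIV"
  proof (subst \<Omega>.indep_vars_iff_distr_eq_PiM)
    show "distr \<Omega> (Pi\<^sub>M UNIV (\<lambda>_. borel)) (\<lambda>x. \<lambda>i\<in>UNIV. x i) = Pi\<^sub>M UNIV (\<lambda>i. distr \<Omega> borel (\<lambda>\<omega>. \<omega> i))"
      unfolding comp \<Omega>_def[symmetric] restrict_UNIV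
      by (intro distr_id2) (simp add: sets sets_PiM_equal_borel)
  qed (auto intro: meas)
qed

text \<open>The partial sums converge almost surely along a subsequence whose tails are small enough in
  mean square; characteristic functions identify the limit.\<close>

theorem gaussian_series_exists:
  fixes v :: "nat \<Rightarrow> 'h::{real_inner, banach}"
  assumes v: "summable (\<lambda>k. (norm (v k))\<^sup>2)"
  obtains N :: "'h measure" where "prob_space N" "sets N = sets borel"
    "\<And>h t. char (distr N borel (\<lambda>y. y \<bullet> h)) t = complex_of_real (exp (- (t\<^sup>2 * (\<Sum>k. (v k \<bullet> h)\<^sup>2)) / 2))"
proof -
  define \<Omega> where "\<Omega> = PiM (UNIV :: nat set) (\<lambda>_. std_normal_distribution)"
  note \<Omega> = iid_std_normal_sequence[folded \<Omega>_def]
  interpret \<Omega>: prob_space \<Omega> by (rule \<Omega>(1))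
  have meas: "f \<in> borel_measurable \<Omega>" if "continuous_on UNIV f" for f :: "(nat \<Rightarrow> real) \<Rightarrow> 'c::topological_space"
    unfolding measurable_cong_sets[OF \<Omega>(2) refl] using that by (rule borel_measurable_continuous_onI)
  have coord [measurable]: "(\<lambda>\<omega>. \<omega> k) \<in> borel_measurable \<Omega>" for k
    by (intro meas continuous_on_product_coordinates)
  have G_sq: "integrable \<Omega> (\<lambda>\<omega>. (\<omega> k)\<^sup>2)" "(\<integral>\<omega>. (\<omega> k)\<^sup>2 \<partial>\<Omega>) = 1" "(\<integral>\<omega>. \<omega> k \<partial>\<Omega>) = 0" for k
  proof -
    show "integrable \<Omega> (\<lambda>\<omega>. (\<omega> k)\<^sup>2)"
      using integrable_std_normal_distribution_moment[of 2] unfolding \<Omega>(4)[of k, symmetric]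
      by (subst (asm) integrable_distr_eq) auto
    show "(\<integral>\<omega>. (\<omega> k)\<^sup>2 \<partial>\<Omega>) = 1"
      using std_normal_distribution_even_moments(1)[of 1] unfolding \<Omega>(4)[of k, symmetric]
      by (subst (asm) integral_distr) auto
    show "(\<integral>\<omega>. \<omega> k \<partial>\<Omega>) = 0"
      using integral_std_normal_distribution_moment_odd[OF odd_one] unfolding \<Omega>(4)[of k, symmetric]
      by (subst (asm) integral_distr) auto
  qed
  have G_int: "integrable \<Omega> (\<lambda>\<omega>. \<omega> k)" for k
    by (rule \<Omega>.square_integrable_imp_integrable[OF coord G_sq(1)])
  have G_prod: "integrable \<Omega> (\<lambda>\<omega>. \<omega> j * \<omega> k)" "(\<integral>\<omega>. \<omega> j * \<omega> k \<partial>\<Omega>) = (if j = k then 1 else 0)" for j k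
  proof -
    have "integrable \<Omega> (\<lambda>\<omega>. \<omega> j * \<omega> k) \<and> (\<integral>\<omega>. \<omega> j * \<omega> k \<partial>\<Omega>) = (if j = k then 1 else 0)"
    proof (cases "j = k")
      case False
      then have "\<Omega>.indep_var borel (\<lambda>\<omega>. \<omega> j) borel (\<lambda>\<omega>. \<omega> k)"
        using \<Omega>.indep_vars_sum[of "{k}" j "\<lambda>k \<omega>. \<omega> k"] \<Omega>.indep_vars_subset[OF \<Omega>(3)] by simp
      from \<Omega>.indep_var_integrable[OF this G_int G_int] \<Omega>.indep_var_lebesgue_integral[OF this G_int G_int]
      show ?thesis using False by (simp add: G_sq)
    qed (use G_sq[of k] in \<open>simp add: power2_eq_square\<close>)
    then show "integrable \<Omega> (\<lambda>\<omega>. \<omega> j * \<omega> k)" "(\<integral>\<omega>. \<omega> j * \<omega> k \<partial>\<Omega>) = (if j = k then 1 else 0)" by auto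
  qed
  \<comment> \<open>The coordinates are orthonormal in mean square, which makes this a Pythagorean
    identity.\<close>
  have L2: "integrable \<Omega> (\<lambda>\<omega>. (norm (\<Sum>k\<in>B. \<omega> k *\<^sub>R v k))\<^sup>2)"
    "(\<integral>\<omega>. (norm (\<Sum>k\<in>B. \<omega> k *\<^sub>R v k))\<^sup>2 \<partial>\<Omega>) = (\<Sum>k\<in>B. (norm (v k))\<^sup>2)" if B: "finite B" for B
  proof -
    have eq: "(norm (\<Sum>k\<in>B. \<omega> k *\<^sub>R v k))\<^sup>2 = (\<Sum>k\<in>B. \<Sum>j\<in>B. (\<omega> j * \<omega> k) * (v j \<bullet> v k))" for \<omega>
      unfolding power2_norm_eq_inner inner_sum_left inner_sum_right
      by (intro sum.cong refl) (simp add: mult.left_commute inner_commute)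
    show "integrable \<Omega> (\<lambda>\<omega>. (norm (\<Sum>k\<in>B. \<omega> k *\<^sub>R v k))\<^sup>2)"
      unfolding eq by (intro Bochner_Integration.integrable_sum integrable_mult_left G_prod)
    have "(\<integral>\<omega>. (norm (\<Sum>k\<in>B. \<omega> k *\<^sub>R v k))\<^sup>2 \<partial>\<Omega>) = (\<Sum>k\<in>B. \<Sum>j\<in>B. (if j = k then 1 else 0) * (v j \<bullet> v k))"
      unfolding eq by (simp add: G_prod)
    also have "\<dots> = (\<Sum>k\<in>B. (norm (v k))\<^sup>2)"
      using B by (intro sum.cong) (auto simp: power2_norm_eq_inner if_distrib[of "\<lambda>u. u * _"] cong: if_cong)
    finally show "(\<integral>\<omega>. (norm (\<Sum>k\<in>B. \<omega> k *\<^sub>R v k))\<^sup>2 \<partial>\<Omega>) = (\<Sum>k\<in>B. (norm (v k))\<^sup>2)" .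
  qed
  have "\<exists>N. \<forall>a b. N \<le> a \<longrightarrow> (\<Sum>k=a..<b. (norm (v k))\<^sup>2) < (1/4)^n" for n
    using summable_Cauchy[THEN iffD1, OF v, rule_format, of "(1/4)^n"] by (auto simp: sum_nonneg)
  then obtain m0 where m0: "\<And>n a b. m0 n \<le> a \<Longrightarrow> (\<Sum>k=a..<b. (norm (v k))\<^sup>2) < (1/4)^n" by metis
  \<comment> \<open>Blocks starting at \<open>m0 n\<close> or later have mean square below
    \<open>(1/4)^n\<close>. The sum makes \<open>m\<close> monotone and at least \<open>m0\<close>;
    the added \<open>n\<close> makes it tend to infinity.\<close>
  define m where "m n = n + (\<Sum>i\<le>n. m0 i)" for n
  have m_mono: "m n \<le> m (Suc n)" for n by (simp add: m_def)
  have m_ge: "m0 n \<le> m n" for n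
    using member_le_sum[of n "{..n}" m0] by (simp add: m_def trans_le_add2)
  have m_lim: "filterlim m at_top sequentially"
    by (rule filterlim_at_top_mono[OF filterlim_ident]) (auto simp: m_def)
  define S where "S n \<omega> = (\<Sum>k<m n. \<omega> k *\<^sub>R v k)" for n and \<omega> :: "nat \<Rightarrow> real"
  have S_cont: "continuous_on UNIV (S n)" for n
    unfolding S_def by (intro continuous_intros continuous_on_product_coordinates)
  define D where "D n \<omega> = norm (S (Suc n) \<omega> - S n \<omega>)" for n \<omega>
  have D_meas [measurable]: "D n \<in> borel_measurable \<Omega>" for n
    unfolding D_def by (intro meas continuous_intros S_cont)
  have D_eq: "D n \<omega> = norm (\<Sum>k=m n..<m (Suc n). \<omega> k *\<^sub>R v k)" for n \<omega>
    unfolding D_def S_def using m_mono[of n] by (simp add: sum_diff_nat_ivl[of 0, simplified] lessThan_atLeast0)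
  have D_le: "(\<integral>\<^sup>+\<omega>. D n \<omega> \<partial>\<Omega>) \<le> ennreal ((1/2)^n)" for n
  proof -
    have sq: "integrable \<Omega> (\<lambda>\<omega>. (D n \<omega>)\<^sup>2)" "(\<integral>\<omega>. (D n \<omega>)\<^sup>2 \<partial>\<Omega>) \<le> (1/4)^n"
      unfolding D_eq using L2[of "{m n..<m (Suc n)}"] m0[OF m_ge, of n "m (Suc n)"] by auto
    have int: "integrable \<Omega> (D n)" by (rule \<Omega>.square_integrable_imp_integrable[OF D_meas sq(1)])
    \<comment> \<open>Expanding the square of \<open>D n \<omega> - (1/2)^n\<close> gives a weighted
      arithmetic-geometric bound in place of Cauchy-Schwarz, balanced so that both terms have mean
      at most \<open>(1/2)^n\<close>.\<close>
    have "(\<integral>\<omega>. D n \<omega> \<partial>\<Omega>) \<le> (\<integral>\<omega>. ((1/2)^n + 2^n * (D n \<omega>)\<^sup>2) / 2 \<partial>\<Omega>)"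
    proof (rule integral_mono[OF int])
      show "integrable \<Omega> (\<lambda>\<omega>. ((1/2)^n + 2^n * (D n \<omega>)\<^sup>2) / 2)" using sq(1) by simp
      fix \<omega>
      have "0 \<le> 2^n * (D n \<omega> - (1/2)^n)\<^sup>2" by simp
      also have "\<dots> = 2^n * (D n \<omega>)\<^sup>2 - 2 * (2^n * (1/2)^n) * D n \<omega> + (2^n * (1/2)^n) * (1/2)^n"
        by (simp add: power2_eq_square algebra_simps)
      also have "2^n * (1/2)^n = (1::real)" by (simp add: power_mult_distrib[symmetric])
      finally show "D n \<omega> \<le> ((1/2)^n + 2^n * (D n \<omega>)\<^sup>2) / 2" by simp
    qed
    also have "\<dots> = ((1/2)^n + 2^n * (\<integral>\<omega>. (D n \<omega>)\<^sup>2 \<partial>\<Omega>)) / 2" using sq(1) by (simp add: \<Omega>.prob_space)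
    also have "\<dots> \<le> ((1/2)^n + 2^n * (1/4)^n) / 2" using sq(2) by (intro divide_right_mono add_mono mult_left_mono) auto
    also have "2^n * (1/4)^n = (1/2::real)^n" by (simp add: power_mult_distrib[symmetric])
    finally have "(\<integral>\<omega>. D n \<omega> \<partial>\<Omega>) \<le> (1/2)^n" by simp
    moreover have "(\<integral>\<^sup>+\<omega>. D n \<omega> \<partial>\<Omega>) = ennreal (\<integral>\<omega>. D n \<omega> \<partial>\<Omega>)"
      by (rule nn_integral_eq_integral[OF int]) (simp add: D_def)
    ultimately show ?thesis by (simp add: ennreal_leI)
  qed
  define A where "A = {\<omega>\<in>space \<Omega>. (\<Sum>n. ennreal (D n \<omega>)) \<noteq> \<top>}"
  have A [measurable]: "A \<in> sets \<Omega>" unfolding A_def by measurable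
  have AE_A: "AE \<omega> in \<Omega>. \<omega> \<in> A"
  proof -
    have "(\<integral>\<^sup>+\<omega>. (\<Sum>n. ennreal (D n \<omega>)) \<partial>\<Omega>) = (\<Sum>n. \<integral>\<^sup>+\<omega>. D n \<omega> \<partial>\<Omega>)"
      by (rule nn_integral_suminf) measurable
    also have "\<dots> \<le> (\<Sum>n. ennreal ((1/2)^n))" by (intro suminf_le D_le) auto
    also have "\<dots> = ennreal (\<Sum>n. (1/2)^n)" by (intro suminf_ennreal2) auto
    also have "\<dots> < \<top>" by simp
    finally have "(\<integral>\<^sup>+\<omega>. (\<Sum>n. ennreal (D n \<omega>)) \<partial>\<Omega>) \<noteq> \<infinity>" by simp
    then have "AE \<omega> in \<Omega>. (\<Sum>n. ennreal (D n \<omega>)) \<noteq> \<infinity>" by (intro nn_integral_PInf_AE) measurable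
    then show ?thesis by (auto simp: A_def)
  qed
  \<comment> \<open>Setting the sums to 0 off the event \<open>A\<close> of full measure yields a
    limit at every point, hence a measurable one.\<close>
  define T where "T n \<omega> = (if \<omega> \<in> A then S n \<omega> else 0)" for n \<omega>
  have T_meas: "T n \<in> borel_measurable \<Omega>" for n
    unfolding T_def[abs_def] using meas[OF S_cont] by (intro measurable_If_set) auto
  have "\<exists>y. (\<lambda>n. T n \<omega>) \<longlonglongrightarrow> y" for \<omega>
  proof (cases "\<omega> \<in> A")
    case True
    then have "summable (\<lambda>n. norm (S (Suc n) \<omega> - S n \<omega>))"
      by (intro summable_suminf_not_top) (auto simp: A_def D_def)
    then have "summable (\<lambda>n. S (Suc n) \<omega> - S n \<omega>)" by (rule summable_norm_cancel)
    then have "(\<lambda>n. \<Sum>i<n. S (Suc i) \<omega> - S i \<omega>) \<longlonglongrightarrow> (\<Sum>i. S (Suc i) \<omega> - S i \<omega>)" by (rule summable_LIMSEQ)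
    then have "(\<lambda>n. S n \<omega> - S 0 \<omega> + S 0 \<omega>) \<longlonglongrightarrow> (\<Sum>i. S (Suc i) \<omega> - S i \<omega>) + S 0 \<omega>"
      unfolding sum_lessThan_telescope[of "\<lambda>n. S n \<omega>"] by (intro tendsto_intros)
    then show ?thesis using True by (auto simp: T_def)
  qed (auto simp: T_def)
  then obtain Y where Y: "\<And>\<omega>. (\<lambda>n. T n \<omega>) \<longlonglongrightarrow> Y \<omega>" by metis
  have Y_meas: "Y \<in> borel_measurable \<Omega>"
    by (rule borel_measurable_LIMSEQ_metric[OF T_meas]) (rule Y)
  have char: "char (distr \<Omega> borel (\<lambda>\<omega>. Y \<omega> \<bullet> h)) t = complex_of_real (exp (- (t\<^sup>2 * (\<Sum>k. (v k \<bullet> h)\<^sup>2)) / 2))" for h t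
  proof (rule LIMSEQ_unique)
    have inner: "(\<lambda>\<omega>. X \<omega> \<bullet> h) \<in> borel_measurable \<Omega>" if "X \<in> borel_measurable \<Omega>" for X :: "_ \<Rightarrow> 'h"
      by (rule borel_measurable_continuous_compose[OF _ that]) (intro continuous_intros)
    have [measurable]: "(\<lambda>\<omega>. S n \<omega> \<bullet> h) \<in> borel_measurable \<Omega>" "(\<lambda>\<omega>. Y \<omega> \<bullet> h) \<in> borel_measurable \<Omega>" for n
      by (auto intro: inner meas[OF S_cont] Y_meas)
    have "(\<lambda>n. \<integral>\<omega>. iexp (t * (S n \<omega> \<bullet> h)) \<partial>\<Omega>) \<longlonglongrightarrow> (\<integral>\<omega>. iexp (t * (Y \<omega> \<bullet> h)) \<partial>\<Omega>)"
    proof (rule integral_dominated_convergence[where w = "\<lambda>_. 1"])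
      show "AE \<omega> in \<Omega>. (\<lambda>n. iexp (t * (S n \<omega> \<bullet> h))) \<longlonglongrightarrow> iexp (t * (Y \<omega> \<bullet> h))"
        using AE_A
      proof eventually_elim
        case (elim \<omega>)
        then have "(\<lambda>n. S n \<omega>) \<longlonglongrightarrow> Y \<omega>" using Y[of \<omega>] by (simp add: T_def)
        then show ?case by (intro tendsto_intros)
      qed
    qed auto
    then show "(\<lambda>n. char (distr \<Omega> borel (\<lambda>\<omega>. S n \<omega> \<bullet> h)) t) \<longlonglongrightarrow> char (distr \<Omega> borel (\<lambda>\<omega>. Y \<omega> \<bullet> h)) t"
      by (simp add: char_def integral_distr)
    have S_char: "char (distr \<Omega> borel (\<lambda>\<omega>. S n \<omega> \<bullet> h)) t
        = complex_of_real (exp (- (t\<^sup>2 * (\<Sum>k<m n. (v k \<bullet> h)\<^sup>2)) / 2))" for n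
    proof -
      have "\<Omega>.indep_vars (\<lambda>_. borel) (\<lambda>k \<omega>. \<omega> k * (v k \<bullet> h)) {..<m n}"
        by (rule \<Omega>.indep_vars_compose2[OF \<Omega>.indep_vars_subset[OF \<Omega>(3)]]) auto
      from \<Omega>.char_distr_sum[OF this, of t]
      have "char (distr \<Omega> borel (\<lambda>\<omega>. S n \<omega> \<bullet> h)) t = (\<Prod>k<m n. char (distr \<Omega> borel (\<lambda>\<omega>. \<omega> k * (v k \<bullet> h))) t)"
        by (simp add: S_def inner_sum_left)
      also have "\<dots> = (\<Prod>k<m n. complex_of_real (exp (- (t * (v k \<bullet> h))\<^sup>2 / 2)))"
      proof (rule prod.cong[OF refl])
        fix k
        have "char (distr \<Omega> borel (\<lambda>\<omega>. \<omega> k * (v k \<bullet> h))) t = char (distr \<Omega> borel (\<lambda>\<omega>. \<omega> k)) (t * (v k \<bullet> h))"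
          by (simp add: char_def integral_distr mult.commute mult.left_commute)
        then show "char (distr \<Omega> borel (\<lambda>\<omega>. \<omega> k * (v k \<bullet> h))) t = complex_of_real (exp (- (t * (v k \<bullet> h))\<^sup>2 / 2))"
          by (simp add: \<Omega>(4) char_std_normal_distribution)
      qed
      also have "\<dots> = complex_of_real (\<Prod>k<m n. exp (- (t * (v k \<bullet> h))\<^sup>2 / 2))" by (simp only: of_real_prod)
      also have "(\<Prod>k<m n. exp (- (t * (v k \<bullet> h))\<^sup>2 / 2)) = exp (\<Sum>k<m n. - (t * (v k \<bullet> h))\<^sup>2 / 2)"
        by (simp add: exp_sum)
      also have "(\<Sum>k<m n. - (t * (v k \<bullet> h))\<^sup>2 / 2) = - (t\<^sup>2 * (\<Sum>k<m n. (v k \<bullet> h)\<^sup>2)) / 2"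
        by (simp add: power_mult_distrib sum_distrib_left sum_negf sum_divide_distrib)
      finally show ?thesis .
    qed
    have "summable (\<lambda>k. (v k \<bullet> h)\<^sup>2)"
    proof (rule summable_comparison_test'[OF summable_mult2[OF v, of "(norm h)\<^sup>2"]])
      show "norm ((v k \<bullet> h)\<^sup>2) \<le> (norm (v k))\<^sup>2 * (norm h)\<^sup>2" for k
        using power_mono[OF Cauchy_Schwarz_ineq2[of "v k" h], of 2] by (simp add: power_mult_distrib)
    qed
    then have "(\<lambda>n. \<Sum>k<m n. (v k \<bullet> h)\<^sup>2) \<longlonglongrightarrow> (\<Sum>k. (v k \<bullet> h)\<^sup>2)"
      by (intro filterlim_compose[OF summable_LIMSEQ m_lim])
    then show "(\<lambda>n. char (distr \<Omega> borel (\<lambda>\<omega>. S n \<omega> \<bullet> h)) t)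
        \<longlonglongrightarrow> complex_of_real (exp (- (t\<^sup>2 * (\<Sum>k. (v k \<bullet> h)\<^sup>2)) / 2))"
      unfolding S_char by (intro tendsto_intros) auto
  qed
  show thesis
  proof (rule that[of "distr \<Omega> borel Y"])
    show "prob_space (distr \<Omega> borel Y)" by (rule \<Omega>.prob_space_distr[OF Y_meas])
    fix h :: 'h and t
    have [measurable]: "(\<lambda>y. y \<bullet> h) \<in> borel_measurable borel"
      by (intro borel_measurable_continuous_onI continuous_intros)
    have "distr (distr \<Omega> borel Y) borel (\<lambda>y. y \<bullet> h) = distr \<Omega> borel (\<lambda>\<omega>. Y \<omega> \<bullet> h)"
      using Y_meas by (subst distr_distr) (auto simp: comp_def)
    then show "char (distr (distr \<Omega> borel Y) borel (\<lambda>y. y \<bullet> h)) t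
        = complex_of_real (exp (- (t\<^sup>2 * (\<Sum>k. (v k \<bullet> h)\<^sup>2)) / 2))" by (simp add: char)
  qed simp
qed

instance ell2 :: (type) banach ..

text \<open>An explicit series takes the place of a square root of \<open>C\<close>. With
  independent standard normal coefficients, the vectors \<open>v k\<close>, each the root of a mass
  times a centred basis vector, give the functional \<open>h\<close> a variance equal to the sum of
  the masses times the squares of \<open>h - ell2_of_pmf p \<bullet> h\<close>, that is, the
  variance of \<open>h\<close> under \<open>p\<close>. Their squared norms are summable because the
  masses are.\<close>

theorem gaussian_process_pmf_covariance_exists:
  fixes p :: "'a::countable pmf"
  assumes C: "\<And>u v. C u \<bullet> v = pmf_covariance p u v"
  shows "\<exists>N :: 'a ell2 measure. gaussian_process N (\<lambda>y. y) 0 C"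
proof -
  \<comment> \<open>Transport to the naturals turns sums over the countable type into ordinary
    series; indices outside the range of \<open>to_nat\<close> carry mass 0, so the arbitrary value
    of \<open>from_nat\<close> there is invisible.\<close>
  define q where "q = map_pmf to_nat p"
  define v where "v k = sqrt (pmf q k) *\<^sub>R (ell2_basis (from_nat k) - ell2_of_pmf p)" for k
  have series: "(\<lambda>k. pmf q k * g (from_nat k)) sums measure_pmf.expectation p g"
    if g: "integrable (measure_pmf p) g" for g :: "'a \<Rightarrow> real"
  proof -
    have "integrable (measure_pmf q) (\<lambda>k. g (from_nat k))" using g by (simp add: q_def)
    then have "integrable (count_space UNIV) (\<lambda>k. pmf q k * g (from_nat k))"
      unfolding measure_pmf_eq_density by (subst (asm) integrable_density) auto
    then have "(\<lambda>k. pmf q k * g (from_nat k)) sums (\<integral>k. pmf q k * g (from_nat k) \<partial>count_space UNIV)"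
      by (rule sums_integral_count_space_nat)
    also have "(\<integral>k. pmf q k * g (from_nat k) \<partial>count_space UNIV) = measure_pmf.expectation q (\<lambda>k. g (from_nat k))"
      unfolding measure_pmf_eq_density by (subst integral_density) auto
    also have "\<dots> = measure_pmf.expectation p g" by (simp add: q_def)
    finally show ?thesis .
  qed
  have "summable (\<lambda>k. (norm (v k))\<^sup>2)"
  proof (rule summable_comparison_test')
    show "summable (\<lambda>k. pmf q k * (1 + norm (ell2_of_pmf p))\<^sup>2)"
      using series[of "\<lambda>_. (1 + norm (ell2_of_pmf p))\<^sup>2"] by (simp add: sums_iff)
    fix k
    have "norm (ell2_basis (from_nat k) - ell2_of_pmf p) \<le> 1 + norm (ell2_of_pmf p)"
      using norm_triangle_ineq4[of "ell2_basis (from_nat k)" "ell2_of_pmf p"]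
      by (simp add: norm_eq_sqrt_inner[of "ell2_basis _"] inner_ell2_basis ell2_basis.rep_eq)
    then have "(norm (ell2_basis (from_nat k) - ell2_of_pmf p))\<^sup>2 \<le> (1 + norm (ell2_of_pmf p))\<^sup>2"
      by (intro power_mono) auto
    then show "norm ((norm (v k))\<^sup>2) \<le> pmf q k * (1 + norm (ell2_of_pmf p))\<^sup>2"
      by (simp add: v_def power_mult_distrib mult_left_mono)
  qed
  then obtain N :: "'a ell2 measure" where N: "prob_space N" "sets N = sets borel"
    and char: "\<And>h t. char (distr N borel (\<lambda>y. y \<bullet> h)) t = complex_of_real (exp (- (t\<^sup>2 * (\<Sum>k. (v k \<bullet> h)\<^sup>2)) / 2))"
    by (rule gaussian_series_exists) (rule that)
  have cov: "(\<Sum>k. (v k \<bullet> h)\<^sup>2) = pmf_covariance p h h" for h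
  proof -
    define g where "g x = (ell2_nth h x - ell2_of_pmf p \<bullet> h)\<^sup>2" for x
    have "(v k \<bullet> h)\<^sup>2 = pmf q k * g (from_nat k)" for k
      by (simp add: v_def g_def power_mult_distrib inner_diff_left inner_commute[of "ell2_basis _"] inner_ell2_basis)
    moreover have "integrable (measure_pmf p) g"
      unfolding g_def power2_diff using integrable_pmf_ell2_mult[of p h h] integrable_pmf_ell2[of p h]
      by (simp add: power2_eq_square)
    ultimately show ?thesis
      using series[of g] by (simp add: sums_iff pmf_covariance_eq_variance g_def[abs_def])
  qed
  have nonneg: "0 \<le> pmf_covariance p h h" for h by (simp add: pmf_covariance_eq_variance)
  have meas: "(\<lambda>y. y \<bullet> h) \<in> borel_measurable N" for h :: "'a ell2"
    unfolding measurable_cong_sets[OF N(2) refl] by (intro borel_measurable_continuous_onI continuous_intros)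
  note gauss = gaussian_variable_charI[OF N(1) meas, of "sqrt (pmf_covariance p h h)" h for h]
  have gauss: "gaussian_variable N (\<lambda>y. y \<bullet> h)" "integrable N (\<lambda>y. (y \<bullet> h)\<^sup>2)" "(\<integral>y. y \<bullet> h \<partial>N) = 0"
    "(\<integral>y. (y \<bullet> h)\<^sup>2 \<partial>N) = pmf_covariance p h h" for h
    using gauss[of h] nonneg[of h] by (simp_all add: char cov power_mult_distrib)
  have "(\<integral>y. (y \<bullet> u) * (y \<bullet> w) \<partial>N) = pmf_covariance p u w" for u w
  proof -
    \<comment> \<open>Polarization, since the characteristic functions reveal only
      variances.\<close>
    have "(\<integral>y. (y \<bullet> u) * (y \<bullet> w) \<partial>N) = (\<integral>y. ((y \<bullet> (u + w))\<^sup>2 - (y \<bullet> u)\<^sup>2 - (y \<bullet> w)\<^sup>2) / 2 \<partial>N)"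
      by (intro Bochner_Integration.integral_cong) (auto simp: inner_add_right power2_sum)
    also have "\<dots> = (pmf_covariance p (u + w) (u + w) - pmf_covariance p u u - pmf_covariance p w w) / 2"
      by (simp add: gauss)
    also have "\<dots> = pmf_covariance p u w"
    proof -
      have "measure_pmf.expectation p (\<lambda>x. ell2_nth (u + w) x * ell2_nth (u + w) x)
          = measure_pmf.expectation p (\<lambda>x. ell2_nth u x * ell2_nth u x + 2 * (ell2_nth u x * ell2_nth w x)
              + ell2_nth w x * ell2_nth w x)"
        by (simp add: ell2_nth_simps algebra_simps)
      also have "\<dots> = measure_pmf.expectation p (\<lambda>x. ell2_nth u x * ell2_nth u x)
          + 2 * measure_pmf.expectation p (\<lambda>x. ell2_nth u x * ell2_nth w x)
          + measure_pmf.expectation p (\<lambda>x. ell2_nth w x * ell2_nth w x)"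
        by (simp add: integrable_pmf_ell2_mult)
      finally show ?thesis by (simp add: pmf_covariance_def inner_add_right field_simps)
    qed
    finally show ?thesis .
  qed
  then have "gaussian_process N (\<lambda>y. y) 0 C"
    unfolding gaussian_process_def using N gauss by (auto simp: C measurable_cong_sets[OF N(2) refl])
  then show ?thesis ..
qed

section \<open>Antitonic cones\<close>

text \<open>The pairs are a parameter because two cones occur: the whole order gives the constraint
  set of the estimator, the pairs inside level sets of \<open>p\<close> give its tangent cone at
  \<open>p\<close>.\<close>

definition antitone_cone :: "('a \<times> 'a) set \<Rightarrow> 'a ell2 set" where
  "antitone_cone E = {\<xi>. \<forall>(x, y)\<in>E. ell2_nth \<xi> y \<le> ell2_nth \<xi> x}"

lemma closed_antitone_cone: "closed (antitone_cone E)"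
proof -
  have "antitone_cone E = (\<Inter>(x, y)\<in>E. {\<xi>. \<xi> \<bullet> ell2_basis y \<le> \<xi> \<bullet> ell2_basis x})"
    by (auto simp: antitone_cone_def inner_ell2_basis)
  then show ?thesis by (auto intro!: closed_INT closed_Collect_le continuous_intros)
qed

lemma convex_antitone_cone: "convex (antitone_cone E)"
proof (rule convexI)
  fix \<xi> \<zeta> :: "'a ell2" and u v :: real
  assume "\<xi> \<in> antitone_cone E" "\<zeta> \<in> antitone_cone E" "0 \<le> u" "0 \<le> v"
  then show "u *\<^sub>R \<xi> + v *\<^sub>R \<zeta> \<in> antitone_cone E"
    by (auto simp: antitone_cone_def ell2_nth_simps intro!: add_mono mult_left_mono)
qed

lemma antitone_cone_nonempty: "antitone_cone E \<noteq> {}"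
  by (auto simp: antitone_cone_def ell2_nth_simps intro: exI[of _ 0])

lemmas antitone_cone = closed_antitone_cone convex_antitone_cone antitone_cone_nonempty

lemma antitonic_ell2_eq: "antitonic_ell2 = antitone_cone {(x, y). x \<le> y}"
  by (auto simp: antitonic_ell2_def antitone_cone_def antimono_def)

section \<open>The estimator and the level set regression as metric projections\<close>

lemma antitonic_estimator_eq_nearest:
  "antitonic_estimator Z n \<omega> = nearest antitonic_ell2 (empirical_ell2 Z n \<omega>)"
proof -
  define F :: "'a ell2 set" where "F = antitonic_ell2"
  define a where "a = empirical_ell2 Z n \<omega>"
  define z where "z = nearest F a"
  note cone = antitone_cone[of "{(x, y :: 'a). x \<le> y}", folded antitonic_ell2_eq F_def]
  have obj: "(\<Sum>\<^sub>\<infinity>x. (ell2_nth \<xi> x - empirical_pmf Z n \<omega> x)\<^sup>2) = (norm (a - \<xi>))\<^sup>2" for \<xi>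
    unfolding norm_minus_commute[of a] ell2_norm_sq by (simp add: ell2_nth_simps ell2_nth_empirical a_def)
  have "antitonic_estimator Z n \<omega> = (THE \<xi>. is_arg_min (\<lambda>\<xi>. (norm (a - \<xi>))\<^sup>2) (\<lambda>\<xi>. \<xi> \<in> F) \<xi>)"
    by (simp add: antitonic_estimator_def obj F_def)
  also have "\<dots> = z"
  proof (rule the_equality)
    show "is_arg_min (\<lambda>\<xi>. (norm (a - \<xi>))\<^sup>2) (\<lambda>\<xi>. \<xi> \<in> F) z"
      using nearest_in[OF cone] nearest_le[OF cone] by (auto simp: is_arg_min_def z_def not_less intro!: power_mono)
    fix \<xi> assume "is_arg_min (\<lambda>\<xi>. (norm (a - \<xi>))\<^sup>2) (\<lambda>\<xi>. \<xi> \<in> F) \<xi>"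
    then have "\<xi> \<in> F" "(norm (a - \<xi>))\<^sup>2 \<le> (norm (a - z))\<^sup>2"
      using nearest_in[OF cone] by (auto simp: is_arg_min_def z_def not_less)
    then show "\<xi> = z" unfolding z_def by (intro nearest_eqI[OF cone]) (auto intro: power2_le_imp_le)
  qed
  finally show ?thesis by (simp add: z_def F_def a_def)
qed

lemma comparable_level_set_value:
  assumes "y \<in> comparable_level_set le p x" shows "p y = p x"
  using assms unfolding comparable_level_set_def mem_Collect_eq by (induction rule: rtrancl_induct) auto

lemma comparable_level_set_step:
  assumes "u \<in> comparable_level_set le p x" "p v = p u" "comparable le u v"
  shows "v \<in> comparable_level_set le p x"
proof -
  have "p u = p x" by (rule comparable_level_set_value[OF assms(1)])
  then show ?thesis using assms unfolding comparable_level_set_def by (auto intro: rtrancl_into_rtrancl)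
qed

text \<open>A pair with \<open>p x > p y\<close> stays ordered under a small perturbation, so only
  pairs of equal mass constrain directions to first order. Such pairs lie in one comparable level
  set, hence the constraints decouple over these sets.\<close>

abbreviation level_cone :: "('a::order \<Rightarrow> real) \<Rightarrow> 'a ell2 set" where
  "level_cone p \<equiv> antitone_cone {(x, y). x \<le> y \<and> p x = p y}"

text \<open>A competitor on one comparable level set can be glued with the global projection off that set,
  because no constraint of the level cone links the set with its complement.\<close>

lemma isotonic_regression_level_set:
  fixes p :: "'a::order \<Rightarrow> real" and \<theta> :: "'a ell2"
  shows "isotonic_regression (\<ge>) (comparable_level_set (\<ge>) p x) (ell2_nth \<theta>) =
    restrict (ell2_nth (nearest (level_cone p) \<theta>)) (comparable_level_set (\<ge>) p x)"
proof -
  define A where "A = comparable_level_set (\<ge>) p x"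
  define K where "K = level_cone p"
  define z where "z = nearest K \<theta>"
  define J where "J f = (\<Sum>\<^sub>\<infinity>x\<in>A. (f x - ell2_nth \<theta> x)\<^sup>2)" for f
  define P where "P f \<longleftrightarrow> f \<in> extensional A \<and> (\<lambda>x. (f x)\<^sup>2) summable_on A \<and> monotone_on A (\<ge>) (\<le>) f"
    for f :: "'a \<Rightarrow> real"
  note cone = antitone_cone[of "{(x, y). x \<le> y \<and> p x = p y}", folded K_def]
  have zK: "z \<in> K" unfolding z_def by (rule nearest_in[OF cone])
  have A_iff: "u \<in> A \<longleftrightarrow> v \<in> A" if "u \<le> v" "p u = p v" for u v
    using that comparable_level_set_step[of u "(\<ge>)" p x v] comparable_level_set_step[of v "(\<ge>)" p x u]
    by (auto simp: A_def comparable_def)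
  have sq: "(\<lambda>y. (ell2_nth f y)\<^sup>2) summable_on B" for f and B :: "'a set"
    by (rule summable_on_subset_banach[OF square_summable_ell2_nth]) auto
  have split: "(norm (\<theta> - f))\<^sup>2 = J (ell2_nth f) + (\<Sum>\<^sub>\<infinity>y\<in>-A. (ell2_nth f y - ell2_nth \<theta> y)\<^sup>2)" for f
  proof -
    have "(norm (\<theta> - f))\<^sup>2 = (\<Sum>\<^sub>\<infinity>y\<in>A \<union> -A. (ell2_nth (f - \<theta>) y)\<^sup>2)"
      unfolding norm_minus_commute[of \<theta>] ell2_norm_sq by simp
    also have "\<dots> = (\<Sum>\<^sub>\<infinity>y\<in>A. (ell2_nth (f - \<theta>) y)\<^sup>2) + (\<Sum>\<^sub>\<infinity>y\<in>-A. (ell2_nth (f - \<theta>) y)\<^sup>2)"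
      by (intro infsum_Un_disjoint sq) auto
    finally show ?thesis by (simp add: J_def ell2_nth_simps)
  qed
  have J_cong: "J f = J g" if "\<And>y. y \<in> A \<Longrightarrow> f y = g y" for f g
    unfolding J_def using that by (intro infsum_cong) simp
  have glue: "J (ell2_nth z) \<le> J g" "J g \<le> J (ell2_nth z) \<Longrightarrow> g = restrict (ell2_nth z) A" if g: "P g" for g
  proof -
    define G where "G y = (if y \<in> A then g y else ell2_nth z y)" for y
    have "(\<lambda>y. (G y)\<^sup>2) summable_on A \<union> -A"
    proof (rule summable_on_Un_disjoint)
      show "(\<lambda>y. (G y)\<^sup>2) summable_on A"
        using g by (subst summable_on_cong[where g = "\<lambda>y. (g y)\<^sup>2"]) (auto simp: G_def P_def)
      show "(\<lambda>y. (G y)\<^sup>2) summable_on -A"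
        using sq[of z "-A"] by (subst summable_on_cong[where g = "\<lambda>y. (ell2_nth z y)\<^sup>2"]) (auto simp: G_def)
    qed auto
    then have nth: "ell2_nth (Abs_ell2 G) = G" by (intro ell2_nth_Abs) simp
    have GK: "Abs_ell2 G \<in> K"
    proof -
      have "G v \<le> G u" if uv: "u \<le> v" "p u = p v" for u v
      proof -
        have "ell2_nth z v \<le> ell2_nth z u" using zK uv by (auto simp: K_def antitone_cone_def)
        moreover have "g v \<le> g u" if "u \<in> A" "v \<in> A" using g uv that by (auto simp: P_def monotone_on_def)
        ultimately show ?thesis using A_iff[OF uv] by (auto simp: G_def)
      qed
      then show ?thesis by (auto simp: K_def antitone_cone_def nth)
    qed
    have tail: "(\<Sum>\<^sub>\<infinity>y\<in>-A. (G y - ell2_nth \<theta> y)\<^sup>2) = (\<Sum>\<^sub>\<infinity>y\<in>-A. (ell2_nth z y - ell2_nth \<theta> y)\<^sup>2)"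
      by (intro infsum_cong) (auto simp: G_def)
    have JG: "J G = J g" by (rule J_cong) (simp add: G_def)
    \<comment> \<open>The losses off \<open>A\<close> cancel, so comparing \<open>g\<close> with
      \<open>z\<close> on \<open>A\<close> amounts to comparing the glued function with
      \<open>z\<close> globally.\<close>
    have diff: "(norm (\<theta> - Abs_ell2 G))\<^sup>2 - (norm (\<theta> - z))\<^sup>2 = J g - J (ell2_nth z)"
      unfolding split nth tail JG by simp
    have "(norm (\<theta> - z))\<^sup>2 \<le> (norm (\<theta> - Abs_ell2 G))\<^sup>2"
      unfolding z_def by (intro power_mono nearest_le[OF cone] GK) auto
    then show "J (ell2_nth z) \<le> J g" using diff by linarith
    assume "J g \<le> J (ell2_nth z)"
    then have "(norm (\<theta> - Abs_ell2 G))\<^sup>2 \<le> (norm (\<theta> - z))\<^sup>2" using diff by linarith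
    then have "Abs_ell2 G = z"
      unfolding z_def by (intro nearest_eqI[OF cone] GK) (auto intro: power2_le_imp_le)
    then have "G = ell2_nth z" using nth by simp
    then have "g y = ell2_nth z y" if "y \<in> A" for y using that by (metis G_def)
    then show "g = restrict (ell2_nth z) A"
      using g by (auto simp: P_def fun_eq_iff restrict_def extensional_def)
  qed
  have zP: "P (restrict (ell2_nth z) A)"
  proof -
    have "(\<lambda>y. (restrict (ell2_nth z) A y)\<^sup>2) summable_on A"
      using sq[of z A] by (subst summable_on_cong[where g = "\<lambda>y. (ell2_nth z y)\<^sup>2"]) auto
    moreover have "ell2_nth z v \<le> ell2_nth z u" if "u \<in> A" "v \<in> A" "u \<le> v" for u v
      using zK that comparable_level_set_value[of u "(\<ge>)" p x] comparable_level_set_value[of v "(\<ge>)" p x]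
      by (auto simp: K_def antitone_cone_def A_def)
    ultimately show ?thesis by (auto simp: P_def monotone_on_def)
  qed
  have Jz: "J (restrict (ell2_nth z) A) = J (ell2_nth z)" by (rule J_cong) simp
  have "isotonic_regression (\<ge>) A (ell2_nth \<theta>) = (THE f. is_arg_min J P f)"
    unfolding isotonic_regression_def J_def[abs_def] P_def[abs_def] ..
  also have "\<dots> = restrict (ell2_nth z) A"
  proof (rule the_equality)
    show "is_arg_min J P (restrict (ell2_nth z) A)"
      using zP glue(1) by (auto simp: is_arg_min_def Jz not_less)
    fix g assume "is_arg_min J P g"
    then show "g = restrict (ell2_nth z) A"
      using zP by (intro glue(2)) (auto simp: is_arg_min_def Jz[symmetric] not_less)
  qed
  finally show ?thesis by (simp add: A_def z_def K_def)
qed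

lemma level_set_regression_eq_nearest:
  fixes p :: "'a::order \<Rightarrow> real"
  shows "level_set_regression (\<ge>) p \<theta> = nearest (level_cone p) \<theta>"
proof -
  have "x \<in> comparable_level_set (\<ge>) p x" for x by (simp add: comparable_level_set_def)
  then show ?thesis
    unfolding level_set_regression_def isotonic_regression_level_set by (simp add: ell2_nth_inverse)
qed

section \<open>Tangent cone at a bimonotone probability mass function\<close>

instance grid :: countable
proof (rule countable_classI[of "\<lambda>x. to_nat (coords x)"])
  show "x = y" if "to_nat (coords x) = to_nat (coords y)" for x y
    using that by (simp add: coords_inject)
qed

lemma infinite_grid_above: "infinite {y::grid. x \<le> y}"
proof
  assume fin: "finite {y::grid. x \<le> y}"
  define f where "f n = Abs_grid (fst (coords x) + n, snd (coords x))" for n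
  have f: "coords (f n) = (fst (coords x) + n, snd (coords x))" for n
    using coords[of x] unfolding f_def by (intro Abs_grid_inverse) (auto split: prod.splits)
  have "inj f" by (rule injI) (metis Pair_inject add_left_cancel f)
  moreover have "range f \<subseteq> {y. x \<le> y}" by (auto simp: less_eq_grid_def f)
  ultimately show False using finite_subset[OF _ fin] by (meson finite_imageD infinite_UNIV_nat)
qed

lemma finite_grid_below: "finite {y::grid. y \<le> x}"
proof (rule inj_on_finite[of coords])
  show "coords ` {y. y \<le> x} \<subseteq> {..fst (coords x)} \<times> {..snd (coords x)}"
    by (simp add: image_subset_iff less_eq_grid_def mem_Times_iff)
qed (auto simp: inj_on_def coords_inject)

lemma finite_pmf_superlevel: "0 < d \<Longrightarrow> finite {x. d \<le> pmf p x}"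
  using ell2_superlevel_finite[of d "ell2_of_pmf p"] by (simp add: ell2_of_pmf.rep_eq)

text \<open>Only finitely many points have mass at least \<open>pmf p x / 2\<close>, and all others
  are at least that far below \<open>x\<close>. The gap depends on \<open>x\<close>; masses
  accumulating at 0 preclude a uniform one.\<close>

lemma pmf_gap_below: "\<exists>d>0. \<forall>y. pmf p y < pmf p x \<longrightarrow> d \<le> pmf p x - pmf p y"
proof (cases "pmf p x = 0")
  case True
  then show ?thesis by (auto intro: exI[of _ 1] simp: not_less)
next
  case False
  then have pos: "0 < pmf p x" using pmf_nonneg[of p x] by linarith
  define V where "V = (\<lambda>y. pmf p x - pmf p y) ` {y. pmf p x / 2 \<le> pmf p y \<and> pmf p y < pmf p x}"
  have fin: "finite V" unfolding V_def
    by (intro finite_imageI finite_subset[OF _ finite_pmf_superlevel[of "pmf p x / 2" p]]) (use pos in auto)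
  define d where "d = Min (insert (pmf p x / 2) V)"
  have "0 < d" unfolding d_def using fin pos by (auto simp: V_def)
  moreover have "d \<le> pmf p x - pmf p y" if "pmf p y < pmf p x" for y
  proof (cases "pmf p x / 2 \<le> pmf p y")
    case True
    then have "pmf p x - pmf p y \<in> insert (pmf p x / 2) V" using that by (auto simp: V_def)
    then show ?thesis unfolding d_def using fin by (intro Min_le) auto
  next
    case False
    have "d \<le> pmf p x / 2" unfolding d_def using fin by (intro Min_le) auto
    then show ?thesis using False by linarith
  qed
  ultimately show ?thesis by blast
qed

text \<open>Only finitely many grid points lie below \<open>y\<close>. Comparability matters here:
  if \<open>y\<close> has mass 0, positive masses at incomparable points may come arbitrarily close
  to it.\<close>

lemma pmf_gap_above:
  fixes p :: "grid pmf"
  shows "\<exists>d>0. \<forall>x\<le>y. pmf p y < pmf p x \<longrightarrow> d \<le> pmf p x - pmf p y"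
proof -
  define V where "V = (\<lambda>x. pmf p x - pmf p y) ` {x. x \<le> y \<and> pmf p y < pmf p x}"
  have fin: "finite V" unfolding V_def
    by (intro finite_imageI finite_subset[OF _ finite_grid_below[of y]]) auto
  define d where "d = Min (insert 1 V)"
  have "0 < d" unfolding d_def using fin by (auto simp: V_def)
  moreover have "d \<le> pmf p x - pmf p y" if "x \<le> y" "pmf p y < pmf p x" for x
    unfolding d_def using fin that by (intro Min_le) (auto simp: V_def)
  ultimately show ?thesis by blast
qed

text \<open>A negative value at \<open>x\<close> would persist in modulus at all points above
  \<open>x\<close>, which are null points too; there are infinitely many of them, contradicting
  square summability.\<close>

lemma level_cone_nonneg:
  fixes p :: "grid pmf"
  assumes p: "antimono (pmf p)" and \<xi>: "\<xi> \<in> level_cone (pmf p)" and x: "pmf p x = 0"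
  shows "0 \<le> ell2_nth \<xi> x"
proof (rule ccontr)
  assume neg: "\<not> 0 \<le> ell2_nth \<xi> x"
  have "- ell2_nth \<xi> x \<le> \<bar>ell2_nth \<xi> y\<bar>" if "x \<le> y" for y
  proof -
    have "pmf p y = 0" using antimonoD[OF p that] x pmf_nonneg[of p y] by linarith
    then have "ell2_nth \<xi> y \<le> ell2_nth \<xi> x" using \<xi> that x by (auto simp: antitone_cone_def)
    then show ?thesis using neg by linarith
  qed
  then have "{y. x \<le> y} \<subseteq> {y. - ell2_nth \<xi> x \<le> \<bar>ell2_nth \<xi> y\<bar>}" by auto
  moreover have "finite {y. - ell2_nth \<xi> x \<le> \<bar>ell2_nth \<xi> y\<bar>}" using neg by (intro ell2_superlevel_finite) simp
  ultimately show False using infinite_grid_above finite_subset by blast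
qed

text \<open>Finitely supported elements of the level cone are admissible directions at \<open>p\<close>: only finitely many
  values of \<open>p\<close> matter, so that the strict inequalities of \<open>p\<close> survive a small perturbation. They are dense
  because positive level sets are finite and elements of the level cone are nonnegative on the null set of \<open>p\<close>.\<close>

lemma level_cone_admissible_dense:
  fixes p :: "grid pmf"
  assumes p: "antimono (pmf p)" and \<xi>: "\<xi> \<in> level_cone (pmf p)" and \<delta>: "0 < \<delta>"
  obtains \<eta> where "norm (\<xi> - \<eta>) < \<delta>"
    "\<forall>\<^sub>F n in sequentially. ell2_of_pmf p + (1 / sqrt (real n)) *\<^sub>R \<eta> \<in> antitonic_ell2"
proof -
  obtain F0 where F0: "finite F0" "\<And>A. F0 \<subseteq> A \<Longrightarrow> norm (\<xi> - ell2_restrict A \<xi>) < \<delta>"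
    by (rule ell2_restrict_approx[OF \<delta>, of \<xi>]) (rule that)
  \<comment> \<open>A finite hull of \<open>F0\<close> on which truncation respects the constraints:
    on the support of \<open>p\<close> it consists of whole level sets, on the null set it is closed
    downwards. Cutting to 0 further up in the null set is allowed because \<open>\<xi>\<close> is
    nonnegative there.\<close>
  define F where "F = {x. \<exists>y\<in>F0. 0 < pmf p y \<and> pmf p y \<le> pmf p x} \<union> {x. pmf p x = 0 \<and> (\<exists>y\<in>F0. x \<le> y)}"
  have "F0 \<subseteq> F"
  proof
    fix y assume "y \<in> F0"
    moreover have "pmf p y = 0 \<or> 0 < pmf p y" using pmf_nonneg[of p y] by linarith
    ultimately show "y \<in> F" unfolding F_def by blast
  qed
  have fin: "finite F"
  proof (rule finite_subset)
    show "F \<subseteq> (\<Union>y\<in>F0 \<inter> {y. 0 < pmf p y}. {x. pmf p y \<le> pmf p x}) \<union> (\<Union>y\<in>F0. {x. x \<le> y})"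
      by (auto simp: F_def)
    show "finite \<dots>" using F0(1) by (auto intro!: finite_UN_I finite_pmf_superlevel finite_grid_below)
  qed
  define \<eta> where "\<eta> = ell2_restrict F \<xi>"
  have \<eta>_nth: "ell2_nth \<eta> x = (if x \<in> F then ell2_nth \<xi> x else 0)" for x
    by (simp add: \<eta>_def ell2_restrict.rep_eq)
  have \<eta>_mono: "ell2_nth \<eta> y \<le> ell2_nth \<eta> x" if xy: "x \<le> y" "pmf p x = pmf p y" for x y
  proof -
    have \<xi>_mono: "ell2_nth \<xi> y \<le> ell2_nth \<xi> x" using \<xi> xy by (auto simp: antitone_cone_def)
    show ?thesis
    proof (cases "pmf p x = 0")
      case True
      have "x \<in> F" if "y \<in> F" using that True xy by (auto simp: F_def intro: order_trans)
      then show ?thesis using \<xi>_mono level_cone_nonneg[OF p \<xi> True] by (auto simp: \<eta>_nth)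
    next
      case False
      then have "x \<in> F \<longleftrightarrow> y \<in> F" using xy(2) by (auto simp: F_def)
      then show ?thesis using \<xi>_mono by (auto simp: \<eta>_nth)
    qed
  qed
  \<comment> \<open>Coordinates of \<open>\<eta>\<close> differ by at most
    \<open>2 * norm \<eta>\<close>, so this quotient bounds the change of any difference of masses
    under the perturbation.\<close>
  have "(\<lambda>n. 2 * norm \<eta> / sqrt (real n)) \<longlonglongrightarrow> 0"
    by (intro tendsto_divide_0[OF tendsto_const] filterlim_at_top_imp_at_infinity
        filterlim_compose[OF sqrt_at_top filterlim_real_sequentially])
  then have small: "\<forall>\<^sub>F n in sequentially. 2 * norm \<eta> / sqrt (real n) < d" if "0 < d" for d
    using that by (rule order_tendstoD)
  have "\<forall>\<^sub>F n in sequentially. \<forall>x\<in>F. \<forall>y. pmf p y < pmf p x \<longrightarrow> 2 * norm \<eta> / sqrt (real n) \<le> pmf p x - pmf p y"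
  proof (rule eventually_ball_finite[OF fin], rule ballI)
    fix x
    obtain d where d: "0 < d" "\<And>y. pmf p y < pmf p x \<Longrightarrow> d \<le> pmf p x - pmf p y" using pmf_gap_below[of p x] by blast
    show "\<forall>\<^sub>F n in sequentially. \<forall>y. pmf p y < pmf p x \<longrightarrow> 2 * norm \<eta> / sqrt (real n) \<le> pmf p x - pmf p y"
      using small[OF d(1)] by eventually_elim (use d(2) in force)
  qed
  moreover have "\<forall>\<^sub>F n in sequentially. \<forall>y\<in>F. \<forall>x\<le>y. pmf p y < pmf p x \<longrightarrow> 2 * norm \<eta> / sqrt (real n) \<le> pmf p x - pmf p y"
  proof (rule eventually_ball_finite[OF fin], rule ballI)
    fix y
    obtain d where d: "0 < d" "\<And>x. x \<le> y \<Longrightarrow> pmf p y < pmf p x \<Longrightarrow> d \<le> pmf p x - pmf p y"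
      using pmf_gap_above[of y p] by blast
    show "\<forall>\<^sub>F n in sequentially. \<forall>x\<le>y. pmf p y < pmf p x \<longrightarrow> 2 * norm \<eta> / sqrt (real n) \<le> pmf p x - pmf p y"
      using small[OF d(1)] by eventually_elim (use d(2) in force)
  qed
  ultimately have "\<forall>\<^sub>F n in sequentially. ell2_of_pmf p + (1 / sqrt (real n)) *\<^sub>R \<eta> \<in> antitonic_ell2"
  proof eventually_elim
    case (elim n)
    have "pmf p y + ell2_nth \<eta> y / sqrt (real n) \<le> pmf p x + ell2_nth \<eta> x / sqrt (real n)" if xy: "x \<le> y" for x y
    proof (cases "pmf p x = pmf p y")
      case True
      then show ?thesis using \<eta>_mono[OF xy] by (simp add: divide_right_mono)
    next
      case False
      then have less: "pmf p y < pmf p x" using antimonoD[OF p xy] by simp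
      show ?thesis
      \<comment> \<open>Strict pairs that meet \<open>F\<close> are protected by the gaps; at all
        other pairs the perturbation is 0.\<close>
      proof (cases "x \<in> F \<or> y \<in> F")
        case True
        then have "2 * norm \<eta> / sqrt (real n) \<le> pmf p x - pmf p y" using elim less xy by blast
        moreover have "(ell2_nth \<eta> y - ell2_nth \<eta> x) / sqrt (real n) \<le> 2 * norm \<eta> / sqrt (real n)"
          using abs_ell2_nth_le[of \<eta> x] abs_ell2_nth_le[of \<eta> y] by (intro divide_right_mono) auto
        ultimately show ?thesis by (simp add: diff_divide_distrib)
      qed (use less in \<open>simp add: \<eta>_nth\<close>)
    qed
    then show ?case by (auto simp: antitonic_ell2_def antimono_def ell2_nth_simps)
  qed
  then show thesis using F0(2)[OF \<open>F0 \<subseteq> F\<close>] by (intro that[of \<eta>]) (simp_all add: \<eta>_def)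
qed

section \<open>Convergence of the rescaled projections\<close>

definition rescaled_projection :: "'a::order pmf \<Rightarrow> nat \<Rightarrow> 'a ell2 \<Rightarrow> 'a ell2" where
  "rescaled_projection p n \<theta> = sqrt (real n) *\<^sub>R
    (nearest antitonic_ell2 (ell2_of_pmf p + (1 / sqrt (real n)) *\<^sub>R \<theta>) - ell2_of_pmf p)"

lemmas antitonic_cone = antitone_cone[of "{(x, y :: 'a::order). x \<le> y}", folded antitonic_ell2_eq]

lemma rescaled_projection_lipschitz:
  "norm (rescaled_projection p n \<theta> - rescaled_projection p n \<theta>') \<le> norm (\<theta> - \<theta>')"
proof (cases "n = 0")
  case False
  define c where "c = sqrt (real n)"
  have c: "0 < c" using False by (simp add: c_def)
  define a where "a \<theta> = ell2_of_pmf p + (1 / c) *\<^sub>R \<theta>" for \<theta>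
  have "rescaled_projection p n \<theta> - rescaled_projection p n \<theta>'
      = c *\<^sub>R (nearest antitonic_ell2 (a \<theta>) - nearest antitonic_ell2 (a \<theta>'))"
    by (simp add: rescaled_projection_def c_def[symmetric] a_def algebra_simps)
  also have "norm \<dots> \<le> c * norm (a \<theta> - a \<theta>')"
    using c nearest_lipschitz[OF antitonic_cone] by (simp add: mult_left_mono)
  also have "a \<theta> - a \<theta>' = (1 / c) *\<^sub>R (\<theta> - \<theta>')" by (simp add: a_def algebra_simps)
  finally show ?thesis using c by simp
qed (simp add: rescaled_projection_def)

text \<open>The rescaled projection \<open>q\<close> lies in the level cone, so the Pythagorean
  inequality of that cone bounds its distance to the limit \<open>z\<close>. An admissible
  \<open>\<eta>\<close> near \<open>z\<close> competes with \<open>q\<close>, hence \<open>q\<close>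
  is at most \<open>norm (z - \<eta>)\<close> farther from \<open>\<theta>\<close> than
  \<open>z\<close> is.\<close>

lemma rescaled_projection_tendsto:
  fixes p :: "grid pmf"
  assumes p: "antimono (pmf p)"
  shows "(\<lambda>n. rescaled_projection p n \<theta>) \<longlonglongrightarrow> nearest (level_cone (pmf p)) \<theta>"
proof (rule LIMSEQ_I)
  fix e :: real assume e: "0 < e"
  define z where "z = nearest (level_cone (pmf p)) \<theta>"
  define d where "d = norm (\<theta> - z)"
  \<comment> \<open>With \<open>t = norm (z - \<eta>)\<close>, the excess
    \<open>(d + t)^2 - d^2\<close> is at most \<open>t * (2 * d + 2)\<close> because
    \<open>t\<close> is below 1; this choice brings it below \<open>e^2\<close>.\<close>
  define \<delta> where "\<delta> = min 1 (e\<^sup>2 / (2 * d + 2))"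
  have d0: "0 \<le> d" by (simp add: d_def)
  then have "0 < e\<^sup>2 / (2 * d + 2)" using e by (intro divide_pos_pos) auto
  then have \<delta>: "0 < \<delta>" "\<delta> \<le> 1" "\<delta> \<le> e\<^sup>2 / (2 * d + 2)" by (auto simp: \<delta>_def)
  then have \<delta>_le: "\<delta> * (2 * d + 2) \<le> e\<^sup>2" using d0 by (simp add: pos_le_divide_eq)
  have "z \<in> level_cone (pmf p)" unfolding z_def by (rule nearest_in[OF antitone_cone])
  then obtain \<eta> where \<eta>: "norm (z - \<eta>) < \<delta>"
    "\<forall>\<^sub>F n in sequentially. ell2_of_pmf p + (1 / sqrt (real n)) *\<^sub>R \<eta> \<in> antitonic_ell2"
    by (rule level_cone_admissible_dense[OF p _ \<delta>(1)]) (rule that)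
  have "\<forall>\<^sub>F n in sequentially. norm (rescaled_projection p n \<theta> - z) < e"
    using \<eta>(2) eventually_gt_at_top[of 0]
  proof eventually_elim
    case (elim n)
    define c where "c = sqrt (real n)"
    have c: "0 < c" using elim by (simp add: c_def)
    define w where "w = nearest antitonic_ell2 (ell2_of_pmf p + (1 / c) *\<^sub>R \<theta>)"
    define q where "q = rescaled_projection p n \<theta>"
    have q: "q = c *\<^sub>R (w - ell2_of_pmf p)" by (simp add: q_def rescaled_projection_def c_def w_def)
    have w: "w = ell2_of_pmf p + (1 / c) *\<^sub>R q" using c by (simp add: q)
    have "w \<in> antitonic_ell2" unfolding w_def by (rule nearest_in[OF antitonic_cone])
    then have mono: "pmf p y + ell2_nth q y / c \<le> pmf p x + ell2_nth q x / c" if "x \<le> y" for x y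
      using that unfolding antitonic_ell2_eq w by (simp add: antitone_cone_def ell2_nth_simps)
    have "ell2_nth q y \<le> ell2_nth q x" if "x \<le> y" "pmf p x = pmf p y" for x y
      using mono[OF that(1)] that(2) c by (simp add: divide_le_cancel)
    then have "q \<in> level_cone (pmf p)" by (auto simp: antitone_cone_def)
    then have "(norm (q - z))\<^sup>2 \<le> (norm (\<theta> - q))\<^sup>2 - d\<^sup>2"
      unfolding d_def z_def by (rule nearest_pythagoras[OF antitone_cone])
    also have "norm (\<theta> - q) \<le> norm (\<theta> - \<eta>)"
    proof -
      have "norm ((1 / c) *\<^sub>R (\<theta> - q)) \<le> norm ((1 / c) *\<^sub>R (\<theta> - \<eta>))"
        using nearest_le[OF antitonic_cone elim(1), of "ell2_of_pmf p + (1 / c) *\<^sub>R \<theta>"]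
        unfolding w_def[symmetric] w c_def[symmetric] by (simp add: scaleR_diff_right)
      then show ?thesis using c by (simp add: divide_le_cancel)
    qed
    then have "(norm (\<theta> - q))\<^sup>2 - d\<^sup>2 \<le> (norm (\<theta> - \<eta>))\<^sup>2 - d\<^sup>2" by (intro diff_right_mono power_mono) auto
    also have "norm (\<theta> - \<eta>) \<le> d + norm (z - \<eta>)"
      using norm_triangle_ineq[of "\<theta> - z" "z - \<eta>"] by (simp add: d_def)
    then have "(norm (\<theta> - \<eta>))\<^sup>2 - d\<^sup>2 \<le> (d + norm (z - \<eta>))\<^sup>2 - d\<^sup>2" by (intro diff_right_mono power_mono) auto
    also have "\<dots> = norm (z - \<eta>) * (2 * d + norm (z - \<eta>))" by (simp add: power2_eq_square algebra_simps)
    also have "\<dots> \<le> norm (z - \<eta>) * (2 * d + 2)" using \<eta>(1) \<delta>(2) by (intro mult_left_mono) auto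
    also have "\<dots> < \<delta> * (2 * d + 2)" using \<eta>(1) d0 by (intro mult_strict_right_mono) auto
    also note \<delta>_le
    finally show "norm (rescaled_projection p n \<theta> - z) < e"
      unfolding q_def by (rule power2_less_imp_less) (use e in simp)
  qed
  then show "\<exists>no. \<forall>n\<ge>no. norm (rescaled_projection p n \<theta> - nearest (level_cone (pmf p)) \<theta>) < e"
    by (simp add: z_def eventually_sequentially)
qed

lemma estimator_eq_rescaled_projection:
  "sqrt (real n) *\<^sub>R (antitonic_estimator Z n \<omega> - ell2_of_pmf p)
    = rescaled_projection p n (empirical_fluctuation Z p n \<omega>)"
  by (cases "n = 0")
    (simp_all add: rescaled_projection_def antitonic_estimator_eq_nearest empirical_fluctuation_def)

text \<open>The existence clause guards the convergence clause against vacuity, while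
  \<open>Y\<close> may live on any probability space. The order \<open>(\<ge>)\<close> makes the
  isotonic regressions decreasing, matching the constraint on \<open>p\<close>.\<close>

theorem theorem6:
  fixes M :: "'w measure"
    and Z :: "nat \<Rightarrow> 'w \<Rightarrow> grid"
    and p :: "grid pmf"
    and C :: "grid ell2 \<Rightarrow> grid ell2"
  assumes "prob_space M"
    and "prob_space.indep_vars M (\<lambda>_. count_space UNIV) Z {1..}"
    and "\<And>j. 1 \<le> j \<Longrightarrow> distr M (count_space UNIV) (Z j) = measure_pmf p"
    and "antimono (pmf p)"
    and "bounded_linear C"
    and "\<And>i i'. C (ell2_basis i) \<bullet> ell2_basis i' =
           pmf p i * (if i = i' then 1 else 0) - pmf p i * pmf p i'"
  shows "(\<exists>N :: grid ell2 measure. gaussian_process N (\<lambda>y. y) 0 C) \<and>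
    (\<forall>(N :: 'v measure) Y. gaussian_process N Y 0 C \<longrightarrow>
       converges_in_distribution M
         (\<lambda>n \<omega>. sqrt (real n) *\<^sub>R (antitonic_estimator Z n \<omega> - ell2_of_pmf p))
         N (\<lambda>\<omega>. level_set_regression (\<ge>) (pmf p) (Y \<omega>)))"
proof (intro conjI allI impI)
  have C: "C u \<bullet> v = pmf_covariance p u v" for u v by (rule covariance_operator_eq[OF assms(5,6)])
  then show "\<exists>N :: grid ell2 measure. gaussian_process N (\<lambda>y. y) 0 C"
    by (rule gaussian_process_pmf_covariance_exists)
  interpret iid_sample M Z p
    using assms(1-3) by (intro iid_sample.intro iid_sample_axioms.intro)
  fix N :: "'v measure" and Y assume Y: "gaussian_process N Y 0 C"
  define P where "P = nearest (level_cone (pmf p))"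
  have P: "continuous_on UNIV P" unfolding P_def by (rule continuous_on_nearest[OF antitone_cone])
  have Q: "continuous_on UNIV (rescaled_projection p n)" for n
    unfolding rescaled_projection_def[abs_def]
    by (intro continuous_intros continuous_on_compose2[OF continuous_on_nearest[OF antitonic_cone, of UNIV]]) auto
  show "converges_in_distribution M
      (\<lambda>n \<omega>. sqrt (real n) *\<^sub>R (antitonic_estimator Z n \<omega> - ell2_of_pmf p))
      N (\<lambda>\<omega>. level_set_regression (\<ge>) (pmf p) (Y \<omega>))"
    unfolding converges_in_distribution_def estimator_eq_rescaled_projection level_set_regression_eq_nearest
      P_def[symmetric]
  proof (intro conjI allI impI)
    show "(\<lambda>\<omega>. rescaled_projection p n (empirical_fluctuation Z p n \<omega>)) \<in> borel_measurable M" for n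
      by (rule borel_measurable_continuous_compose[OF Q measurable_empirical_fluctuation])
    show "(\<lambda>\<omega>. P (Y \<omega>)) \<in> borel_measurable N"
      using Y by (intro borel_measurable_continuous_compose[OF P]) (simp add: gaussian_process_def)
    fix f :: "grid ell2 \<Rightarrow> real" assume f: "continuous_on UNIV f" "bounded (range f)"
    \<comment> \<open>Composed with \<open>P\<close>, the test function is again bounded and
      continuous, so the limit law of the fluctuations applies to it.\<close>
    have fP: "continuous_on UNIV (\<lambda>\<theta>. f (P \<theta>))" using continuous_on_compose2[OF f(1) P] by simp
    have bP: "bounded (range (\<lambda>\<theta>. f (P \<theta>)))" using f(2) by (rule bounded_subset) auto
    have "(\<lambda>n. expectation (\<lambda>\<omega>. f (rescaled_projection p n (empirical_fluctuation Z p n \<omega>)))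
        - expectation (\<lambda>\<omega>. f (P (empirical_fluctuation Z p n \<omega>)))) \<longlonglongrightarrow> 0"
      using prob_space_axioms measurable_empirical_fluctuation empirical_fluctuation_tight
        rescaled_projection_lipschitz rescaled_projection_tendsto[OF assms(4), folded P_def] f
      by (rule weak_convergence_lipschitz_maps)
    from tendsto_add[OF this empirical_fluctuation_converges[OF Y C fP bP]]
    show "(\<lambda>n. expectation (\<lambda>\<omega>. f (rescaled_projection p n (empirical_fluctuation Z p n \<omega>))))
        \<longlonglongrightarrow> (\<integral>\<omega>. f (P (Y \<omega>)) \<partial>N)" by simp
  qed
qed

end
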